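(* Let $T>0$ and let $q_{ij}, b_i:\mathbb{R}^{1+d}\to\mathbb{R}$ ($i,j=1,\dots,d$) be $T$-periodic in the time variable and satisfy the following assumptions. (H1) $q_{ij}, b_i\in C^{\alpha/2,\alpha}_{loc}(\mathbb{R}^{1+d})$ for some $\alpha\in(0,1)$. (H2) For every $(s,x)\in\mathbb{R}^{1+d}$ the matrix $Q(s,x)=(q_{ij}(s,x))$ is symmetric, and there is a function $\eta:\mathbb{R}^{1+d}\to\mathbb{R}$ with $\inf_{\mathbb{R}^{1+d}}\eta>0$ such that $\langle Q(s,x)\xi,\xi\rangle\ge\eta(s,x)|\xi|^2$ for all $\xi\in\mathbb{R}^d$, $(s,x)\in\mathbb{R}^{1+d}$. (H3) There exist a positive function $W\in C^2(\mathbb{R}^d)$ and $\lambda\in\mathbb{R}$ such that $\lim_{|x|\to\infty}W(x)=\infty$ and $\sup_{s\in\mathbb{R},\,x\in\mathbb{R}^d}\big((\mathcal{A}(s)W)(x)-\lambda W(x)\big)<0$. Let $G(t,s)$ be compact in $C_b(\mathbb{R}^d)$ for all $t>s$, and let $\{\mu_s:s\in\mathbb{R}\}$ be the unique $T$-periodic evolution system of measures for $G(t,s)$. Then for every $p\in(1,\infty)$ the operator $G(t,s):L^p(\mathbb{R}^d,\mu_s)\to L^p(\mathbb{R}^d,\mu_t)$ is compact for all $t>s$. Moreover, let $\omega_0=\frac{\log r}{T}$, where $$r:=\sup\{|\lambda|:\ \lambda\in\sigma(V(s)),\ |\lambda|<1,\ s\in\mathbb{R}\}<1,\qquad V(s):=G(s+T,s)\in\mathcal{L}(C_b(\mathbb{R}^d))$$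 (with $\omega_0=-\infty$ if $r=0$). Then for every $\omega\in(\omega_0,0)$ and $p\in(1,\infty)$ there exists $M=M(\omega,p)>0$ such that $$\Big\|G(t,s)\varphi-\int_{\mathbb{R}^d}\varphi\,d\mu_s\Big\|_{L^p(\mathbb{R}^d,\mu_t)}\le M e^{\omega(t-s)}\|\varphi\|_{L^p(\mathbb{R}^d,\mu_s)},\qquad t>s,\ \varphi\in L^p(\mathbb{R}^d,\mu_s),$$ and for every $\omega<\omega_0$ (and $p\in(1,\infty)$) there is no $M$ such that this estimate holds.
   Context: $C_b(\mathbb{R}^d)$ is the space of bounded continuous functions $\mathbb{R}^d\to\mathbb{R}$ with the sup norm. For $0<\alpha<1$, $C^{\alpha/2,\alpha}_{loc}(\mathbb{R}^{1+d})$ is the space of continuous functions on $\mathbb{R}^{1+d}$ (variables $(s,x)\in\mathbb{R}\times\mathbb{R}^d$) whose restriction to $[a,b]\times B(0,R)$ belongs to the usual parabolic Hölder space $C^{\alpha/2,\alpha}([a,b]\times B(0,R))$ ($\alpha/2$-Hölder in time, $\alpha$-Hölder in space) for every $a<b$, $R>0$. The coefficients are allowed to be unbounded. For $s\in\mathbb{R}$ and $\varphi\in C^2(\mathbb{R}^d)$, $$(\mathcal{A}(s)\varphi)(x)=\sum_{i,j=1}^d q_{ij}(s,x)D_{ij}\varphi(x)+\sum_{i=1}^d b_i(s,x)D_i\varphi(x).$$ Evolution operator. Under (H1)-(H3) it is known that for every $s\in\mathbb{R}$, $\varphi\in C_b(\mathbb{R}^d)$ there is a unique bounded classical solution $u$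 (bounded, continuous on $[s,\infty)\times\mathbb{R}^d$, $C^1$ in time and $C^2$ in space for $t>s$) of $D_tu(t,x)=(\mathcal{A}(t)u(t,\cdot))(x)$ for $t>s$, $x\in\mathbb{R}^d$, $u(s,x)=\varphi(x)$. One sets $G(t,s)\varphi:=u(t,\cdot)$, $t\ge s$; each $G(t,s)$ is a linear contraction in $C_b(\mathbb{R}^d)$. An evolution system of measures for $G(t,s)$ is a family $\{\mu_s:s\in\mathbb{R}\}$ of Borel probability measures on $\mathbb{R}^d$ such that $\int_{\mathbb{R}^d}G(t,s)\varphi\,d\mu_t=\int_{\mathbb{R}^d}\varphi\,d\mu_s$ for all $t>s$, $\varphi\in C_b(\mathbb{R}^d)$. It is $T$-periodic if $\mu_{s+T}=\mu_s$ for all $s\in\mathbb{R}$. If $G(t,s)$ is compact in $C_b(\mathbb{R}^d)$ for $t>s$ (and the coefficients are $T$-periodic in time), there is exactly one $T$-periodic evolution system of measures. Given an evolution system of measures, $G(t,s)$ extends from $C_b(\mathbb{R}^d)$ by density to a contraction, still denoted $G(t,s)$, from $L^p(\mathbb{R}^d,\mu_s)$ to $L^p(\mathbb{R}^d,\mu_t)$ for $t>s$, $1\le p<\infty$. $\sigma(V(s))$ is the spectrum of $V(s)$ in (the complexification of) $C_b(\mathbb{R}^d)$. When $G(t,s)$ is compact in $C_b(\mathbb{R}^d)$ for $t>s$, $\sigma(V(s))\setminus\{0\}$ consists of isolated eigenvalues and does not depend on $s$, so that $r<1$. *)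

theory Defs
  imports "HOL-Probability.Probability"
begin

section \<open>Differentiability and parabolic Hoelder regularity\<close>

definition partial_D :: "'n::finite \<Rightarrow> (real^'n \<Rightarrow> real) \<Rightarrow> real^'n \<Rightarrow> real" where
  "partial_D i f x = frechet_derivative f (at x) (axis i 1)"

definition C1_fun :: "(real^'n::finite \<Rightarrow> real) \<Rightarrow> bool" where
  "C1_fun f \<longleftrightarrow> (\<forall>x. f differentiable (at x)) \<and> (\<forall>i. continuous_on UNIV (partial_D i f))"

definition C2_fun :: "(real^'n::finite \<Rightarrow> real) \<Rightarrow> bool" where
  "C2_fun f \<longleftrightarrow> C1_fun f \<and> (\<forall>i. C1_fun (partial_D i f))"

definition parabolic_Hoelder ::
    "real \<Rightarrow> real set \<Rightarrow> (real^'n::finite) set \<Rightarrow> (real \<Rightarrow> real^'n \<Rightarrow> real) \<Rightarrow> bool" where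
  "parabolic_Hoelder \<alpha> I B f \<longleftrightarrow>
     (\<exists>K. (\<forall>t\<in>I. \<forall>x\<in>B. \<bar>f t x\<bar> \<le> K) \<and>
          (\<forall>t\<in>I. \<forall>t'\<in>I. \<forall>x\<in>B. \<bar>f t x - f t' x\<bar> \<le> K * \<bar>t - t'\<bar> powr (\<alpha> / 2)) \<and>
          (\<forall>t\<in>I. \<forall>x\<in>B. \<forall>x'\<in>B. \<bar>f t x - f t x'\<bar> \<le> K * norm (x - x') powr \<alpha>))"

definition parabolic_Hoelder_loc :: "real \<Rightarrow> (real \<Rightarrow> real^'n::finite \<Rightarrow> real) \<Rightarrow> bool" where
  "parabolic_Hoelder_loc \<alpha> f \<longleftrightarrow>
     continuous_on UNIV (\<lambda>(s, x). f s x) \<and>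
     (\<forall>a b R. a < b \<longrightarrow> R > 0 \<longrightarrow> parabolic_Hoelder \<alpha> {a..b} (ball 0 R) f)"


section \<open>The operators $A(s)$ and the standing hypotheses\<close>

text \<open>The coefficients are \<open>Q s x $ i $ j\<close> and \<open>b s x $ i\<close>.\<close>

definition elliptic_op ::
    "(real \<Rightarrow> real^'n \<Rightarrow> real^'n^'n) \<Rightarrow> (real \<Rightarrow> real^'n \<Rightarrow> real^'n) \<Rightarrow>
     real \<Rightarrow> (real^'n::finite \<Rightarrow> real) \<Rightarrow> real^'n \<Rightarrow> real" where
  "elliptic_op Q b s \<phi> x =
     (\<Sum>i\<in>UNIV. \<Sum>j\<in>UNIV. Q s x $ i $ j * partial_D i (partial_D j \<phi>) x) +
     (\<Sum>i\<in>UNIV. b s x $ i * partial_D i \<phi> x)"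

definition time_periodic :: "real \<Rightarrow> (real \<Rightarrow> 'b) \<Rightarrow> bool" where
  "time_periodic T f \<longleftrightarrow> (\<forall>s. f (s + T) = f s)"

definition hyp_H1 ::
    "(real \<Rightarrow> real^'n \<Rightarrow> real^'n^'n) \<Rightarrow> (real \<Rightarrow> real^'n \<Rightarrow> real^'n::finite) \<Rightarrow> bool" where
  "hyp_H1 Q b \<longleftrightarrow>
     (\<exists>\<alpha>. 0 < \<alpha> \<and> \<alpha> < 1 \<and>
        (\<forall>i j. parabolic_Hoelder_loc \<alpha> (\<lambda>s x. Q s x $ i $ j)) \<and>
        (\<forall>i. parabolic_Hoelder_loc \<alpha> (\<lambda>s x. b s x $ i)))"

text \<open>The conditions $\inf \eta > 0$ below and $\sup(\ldots) < 0$ in the next definition are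
  spelled out by means of a bound, since \<open>Inf\<close> and \<open>Sup\<close> on type \<open>real\<close> are only
  meaningful for bounded sets.\<close>

definition hyp_H2 :: "(real \<Rightarrow> real^'n \<Rightarrow> real^'n^'n::finite) \<Rightarrow> bool" where
  "hyp_H2 Q \<longleftrightarrow>
     (\<forall>s x. transpose (Q s x) = Q s x) \<and>
     (\<exists>\<eta> :: real \<Rightarrow> real^'n \<Rightarrow> real.
        (\<exists>\<eta>\<^sub>0>0. \<forall>s x. \<eta>\<^sub>0 \<le> \<eta> s x) \<and>
        (\<forall>s x \<xi>. (Q s x *v \<xi>) \<bullet> \<xi> \<ge> \<eta> s x * (norm \<xi>)\<^sup>2))"

definition hyp_H3 ::
    "(real \<Rightarrow> real^'n \<Rightarrow> real^'n^'n) \<Rightarrow> (real \<Rightarrow> real^'n \<Rightarrow> real^'n::finite) \<Rightarrow> bool" where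
  "hyp_H3 Q b \<longleftrightarrow>
     (\<exists>W \<kappa>. C2_fun W \<and> (\<forall>x. W x > 0) \<and> filterlim W at_top at_infinity \<and>
        (\<exists>\<epsilon>>0. \<forall>s x. elliptic_op Q b s W x - \<kappa> * W x \<le> - \<epsilon>))"


section \<open>The evolution operator and evolution systems of measures\<close>

text \<open>Only the values \<open>u t x\<close> for \<open>t \<ge> s\<close> are relevant.\<close>

definition bounded_classical_solution ::
    "(real \<Rightarrow> real^'n \<Rightarrow> real^'n^'n) \<Rightarrow> (real \<Rightarrow> real^'n \<Rightarrow> real^'n) \<Rightarrow>
     real \<Rightarrow> (real^'n::finite \<Rightarrow> real) \<Rightarrow> (real \<Rightarrow> real^'n \<Rightarrow> real) \<Rightarrow> bool" where
  "bounded_classical_solution Q b s \<phi> u \<longleftrightarrow>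
     bounded ((\<lambda>(t, x). u t x) ` ({s..} \<times> UNIV)) \<and>
     continuous_on ({s..} \<times> UNIV) (\<lambda>(t, x). u t x) \<and>
     (\<forall>t>s. C2_fun (u t)) \<and>
     (\<forall>i. continuous_on ({s<..} \<times> UNIV) (\<lambda>(t, x). partial_D i (u t) x)) \<and>
     (\<forall>i j. continuous_on ({s<..} \<times> UNIV) (\<lambda>(t, x). partial_D i (partial_D j (u t)) x)) \<and>
     continuous_on ({s<..} \<times> UNIV) (\<lambda>(t, x). deriv (\<lambda>\<tau>. u \<tau> x) t) \<and>
     (\<forall>t>s. \<forall>x. ((\<lambda>\<tau>. u \<tau> x) has_real_derivative elliptic_op Q b t (u t) x) (at t)) \<and>
     (\<forall>x. u s x = \<phi> x)"

text \<open>Under the standing hypotheses the bounded classical solution exists and is unique, so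
  this determines \<open>G t s\<close> for \<open>t \<ge> s\<close>; the values for \<open>t < s\<close> are irrelevant.\<close>

definition evolution_operator ::
    "(real \<Rightarrow> real^'n \<Rightarrow> real^'n^'n) \<Rightarrow> (real \<Rightarrow> real^'n \<Rightarrow> real^'n) \<Rightarrow>
     (real \<Rightarrow> real \<Rightarrow> ((real^'n::finite) \<Rightarrow>\<^sub>C real) \<Rightarrow> ((real^'n) \<Rightarrow>\<^sub>C real)) \<Rightarrow> bool" where
  "evolution_operator Q b G \<longleftrightarrow>
     (\<forall>s \<phi>. bounded_classical_solution Q b s (apply_bcontfun \<phi>) (\<lambda>t. apply_bcontfun (G t s \<phi>)))"

definition evolution_system_of_measures ::
    "(real \<Rightarrow> real \<Rightarrow> ((real^'n::finite) \<Rightarrow>\<^sub>C real) \<Rightarrow> ((real^'n) \<Rightarrow>\<^sub>C real)) \<Rightarrow>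
     (real \<Rightarrow> (real^'n) measure) \<Rightarrow> bool" where
  "evolution_system_of_measures G \<mu> \<longleftrightarrow>
     (\<forall>s. prob_space (\<mu> s) \<and> sets (\<mu> s) = sets borel) \<and>
     (\<forall>s t \<phi>. s < t \<longrightarrow>
        (\<integral>x. apply_bcontfun (G t s \<phi>) x \<partial>\<mu> t) = (\<integral>x. apply_bcontfun \<phi> x \<partial>\<mu> s))"


section \<open>Compactness and spectrum\<close>

definition compact_operator :: "('a::real_normed_vector \<Rightarrow> 'b::real_normed_vector) \<Rightarrow> bool" where
  "compact_operator A \<longleftrightarrow> (\<forall>S. bounded S \<longrightarrow> compact (closure (A ` S)))"

text \<open>The complexification of a real normed space \<open>E\<close> is \<open>E \<times> E\<close>, the pair \<open>(x, y)\<close>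
  standing for $x + iy$. The product norm is equivalent to every usual complexification norm,
  so the notion of a bounded inverse does not depend on the choice.\<close>

definition complex_scale :: "complex \<Rightarrow> 'a::real_normed_vector \<times> 'a \<Rightarrow> 'a \<times> 'a" where
  "complex_scale c = (\<lambda>(x, y). (Re c *\<^sub>R x - Im c *\<^sub>R y, Re c *\<^sub>R y + Im c *\<^sub>R x))"

definition complexified :: "('a::real_normed_vector \<Rightarrow> 'a) \<Rightarrow> 'a \<times> 'a \<Rightarrow> 'a \<times> 'a" where
  "complexified A = (\<lambda>(x, y). (A x, A y))"

definition op_spectrum :: "('a::real_normed_vector \<Rightarrow> 'a) \<Rightarrow> complex set" where
  "op_spectrum A =
     {c. \<not> (\<exists>B. bounded_linear B \<and>
              B \<circ> (\<lambda>z. complex_scale c z - complexified A z) = id \<and>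
              (\<lambda>z. complex_scale c z - complexified A z) \<circ> B = id)}"

text \<open>For an evolution operator \<open>G (s + T) s\<close> is the monodromy operator $V(s)$. The set is
  bounded above by 1, and nonempty since 0 is in the spectrum of a compact operator on $C_b$.\<close>

definition subunit_radius ::
    "real \<Rightarrow> (real \<Rightarrow> real \<Rightarrow> ((real^'n::finite) \<Rightarrow>\<^sub>C real) \<Rightarrow> ((real^'n) \<Rightarrow>\<^sub>C real)) \<Rightarrow> real" where
  "subunit_radius T G = Sup {cmod c | c s. c \<in> op_spectrum (G (s + T) s) \<and> cmod c < 1}"

definition log_rate :: "real \<Rightarrow> real \<Rightarrow> ereal" where
  "log_rate T r = (if r = 0 then - \<infinity> else ereal (ln r / T))"


section \<open>$L^p$ spaces and the extension of operators from $C_b$\<close>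

text \<open>$L^p$ is represented by functions rather than by classes modulo a.e. equality;
  \<open>Lp_norm\<close> is a seminorm on \<open>Lp_space\<close>.\<close>

definition Lp_space :: "real \<Rightarrow> 'a measure \<Rightarrow> ('a \<Rightarrow> real) set" where
  "Lp_space p M = {f \<in> borel_measurable M. integrable M (\<lambda>x. \<bar>f x\<bar> powr p)}"

definition Lp_norm :: "real \<Rightarrow> 'a measure \<Rightarrow> ('a \<Rightarrow> real) \<Rightarrow> real" where
  "Lp_norm p M f = (\<integral>x. \<bar>f x\<bar> powr p \<partial>M) powr (1 / p)"

text \<open>Extension by density of \<open>A\<close> to a map from $L^p(M)$ to $L^p(N)$: the value at \<open>\<phi>\<close>
  is (a representative of) the common $L^p(N)$-limit of \<open>A (\<phi>n n)\<close> along all sequences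
  \<open>\<phi>n\<close> in $C_b$ converging to \<open>\<phi>\<close> in $L^p(M)$. It is determined up to a.e. equality
  whenever \<open>A\<close> is linear and contractive for the $L^p$ norms and $C_b$ is dense in $L^p(M)$.\<close>

definition Lp_extension ::
    "real \<Rightarrow> 'a measure \<Rightarrow> 'a measure \<Rightarrow>
     (('a::topological_space \<Rightarrow>\<^sub>C real) \<Rightarrow> ('a \<Rightarrow>\<^sub>C real)) \<Rightarrow> ('a \<Rightarrow> real) \<Rightarrow> ('a \<Rightarrow> real)" where
  "Lp_extension p M N A \<phi> =
     (SOME g. g \<in> Lp_space p N \<and>
        (\<forall>\<phi>n :: nat \<Rightarrow> ('a \<Rightarrow>\<^sub>C real).
           (\<lambda>n. Lp_norm p M (\<lambda>x. apply_bcontfun (\<phi>n n) x - \<phi> x)) \<longlonglongrightarrow> 0 \<longrightarrow>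
           (\<lambda>n. Lp_norm p N (\<lambda>x. apply_bcontfun (A (\<phi>n n)) x - g x)) \<longlonglongrightarrow> 0))"

text \<open>Sequential form of relative compactness of images of bounded sets, as the norm of $L^p$ is only a
  seminorm on functions.\<close>

definition Lp_compact_operator ::
    "real \<Rightarrow> 'a measure \<Rightarrow> 'a measure \<Rightarrow> (('a \<Rightarrow> real) \<Rightarrow> ('a \<Rightarrow> real)) \<Rightarrow> bool" where
  "Lp_compact_operator p M N A \<longleftrightarrow>
     A ` Lp_space p M \<subseteq> Lp_space p N \<and>
     (\<forall>f :: nat \<Rightarrow> 'a \<Rightarrow> real. (\<forall>n. f n \<in> Lp_space p M) \<longrightarrow> (\<exists>K. \<forall>n. Lp_norm p M (f n) \<le> K) \<longrightarrow>
        (\<exists>g \<in> Lp_space p N. \<exists>k :: nat \<Rightarrow> nat. strict_mono k \<and>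
           (\<lambda>n. Lp_norm p N (\<lambda>x. A (f (k n)) x - g x)) \<longlonglongrightarrow> 0))"

definition Lp_decay_estimate ::
    "(real \<Rightarrow> real \<Rightarrow> ((real^'n::finite) \<Rightarrow>\<^sub>C real) \<Rightarrow> ((real^'n) \<Rightarrow>\<^sub>C real)) \<Rightarrow>
     (real \<Rightarrow> (real^'n) measure) \<Rightarrow> real \<Rightarrow> real \<Rightarrow> real \<Rightarrow> bool" where
  "Lp_decay_estimate G \<mu> p \<omega> M \<longleftrightarrow>
     (\<forall>s t. s < t \<longrightarrow> (\<forall>\<phi>\<in>Lp_space p (\<mu> s).
        Lp_norm p (\<mu> t)
          (\<lambda>x. Lp_extension p (\<mu> s) (\<mu> t) (G t s) \<phi> x - (\<integral>y. \<phi> y \<partial>\<mu> s))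
        \<le> M * exp (\<omega> * (t - s)) * Lp_norm p (\<mu> s) \<phi>))"

end

theory Submission
  imports Defs "HOL-Complex_Analysis.Complex_Analysis" "HOL-Library.Diagonal_Subsequence"
begin

text \<open>The Lyapunov function gives a maximum principle, hence \<open>G\<close> is a linear positive contractive
  evolution family; a barrier supported in a moving ball shows that it is strictly positive.

  Let \<open>V\<close> be the monodromy operator at time 0. Strict positivity and the invariance of \<open>\<mu>\<close> exclude
  nonconstant eigenfunctions for eigenvalues of modulus at least 1, and the Fredholm alternative
  turns nonzero spectral values into eigenvalues. Thus \<open>V\<close> restricted to functions of mean zero has
  spectral radius \<open>r < 1\<close>, and Cauchy's estimates for its resolvent yield decay in the sup norm.

  Positivity also gives Jensen's inequality, hence contractivity in $L^p$. Compactness in $L^p$ follows from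
  a partition of the space on which \<open>G \<phi>\<close> oscillates by at most \<open>\<epsilon> \<parallel>\<phi>\<parallel>\<close>, a bound that truncation
  transfers to $L^p$. Since the unit ball of $L^p$ is mapped into a small neighbourhood of finitely
  many bounded continuous functions, the sup norm decay rate carries over to $L^p$ without loss.
  Conversely, an eigenfunction for an eigenvalue of modulus close to \<open>r\<close> violates any faster rate.\<close>


section \<open>The maximum principle\<close>

text \<open>The coefficients are unbounded and the space is not compact, so an infimum need not be
  attained; a small multiple of the Lyapunov function forces it into a bounded set. The eigenvalue 1
  is removed without a spectral projection: invariance makes the functions of mean zero an invariant
  complement of the constants. Excluding nonconstant eigenfunctions on the unit circle does not yet
  give \<open>r < 1\<close>, since moduli below 1 might accumulate at 1; a lower bound for
  \<open>1 - \<zeta> N\<close>, uniform over the circle, with \<open>N\<close> the monodromy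
  operator after centering, supplies the gap. The passage to L^p is delicate because the sup norm
  decay has the sup norm on its right-hand side, and interpolating it with mere contractivity would
  cost part of the exponent. Compactness avoids this: finitely many continuous functions decay at
  the right rate, and the error left by the net is a small multiple of a function of the same kind.
  Compactness itself is passed to L^p through pointwise differences of \<open>G \<phi>\<close>,
  where positivity controls the large values of \<open>\<phi>\<close> by \<open>G\<close> applied to
  \<open>|\<phi>|^p\<close>.\<close>

text \<open>Diagonalising \<open>q\<close> is avoided by completing one square at a time: if
  \<open>q a a > 0\<close>, then \<open>q\<close> is a rank one form built from its row
  \<open>a\<close> plus a Schur complement supported on fewer indices. The rank one form contributes
  the quadratic form of \<open>h\<close> at that row, divided by \<open>q a a\<close>. Symmetry is
  asked of \<open>q\<close> alone, so a Hessian can be inserted for \<open>h\<close> without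
  interchanging derivatives.\<close>

lemma psd_frobenius_nonneg:
  fixes q h :: "'n::finite \<Rightarrow> 'n \<Rightarrow> real"
  assumes "\<And>i j. q i j = q j i"
    and "\<And>\<xi>. 0 \<le> (\<Sum>i\<in>UNIV. \<Sum>j\<in>UNIV. q i j * \<xi> i * \<xi> j)"
    and h: "\<And>\<xi>. 0 \<le> (\<Sum>i\<in>UNIV. \<Sum>j\<in>UNIV. h i j * \<xi> i * \<xi> j)"
  shows "0 \<le> (\<Sum>i\<in>UNIV. \<Sum>j\<in>UNIV. q i j * h i j)"
proof -
  have "finite S \<Longrightarrow> (\<And>i j. q i j = q j i) \<Longrightarrow>
      (\<And>\<xi>. 0 \<le> (\<Sum>i\<in>UNIV. \<Sum>j\<in>UNIV. q i j * \<xi> i * \<xi> j)) \<Longrightarrow>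
      (\<And>i j. i \<notin> S \<Longrightarrow> q i j = 0) \<Longrightarrow>
      0 \<le> (\<Sum>i\<in>UNIV. \<Sum>j\<in>UNIV. q i j * h i j)" for S :: "'n set" and q
  proof (induction S arbitrary: q rule: finite_induct)
    case empty
    then show ?case by simp
  next
    case (insert a S)
    note sym = insert.prems(1) and psd = insert.prems(2) and supp = insert.prems(3)
    define l where "l \<xi> = (\<Sum>j\<in>UNIV. q a j * \<xi> j)" for \<xi>
    have delta: "(\<Sum>i\<in>UNIV. of_bool (i = a) * f i) = f a" for f :: "'n \<Rightarrow> real"
      by (subst sum.remove[of UNIV a]) auto
    have expand: "(\<Sum>i\<in>UNIV. \<Sum>j\<in>UNIV. q i j * (\<xi> i + t * of_bool (i = a)) * (\<xi> j + t * of_bool (j = a)))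
        = (\<Sum>i\<in>UNIV. \<Sum>j\<in>UNIV. q i j * \<xi> i * \<xi> j) + 2 * t * l \<xi> + t\<^sup>2 * q a a" for \<xi> t
    proof -
      have expd: "q i j * (\<xi> i + t * of_bool (i = a)) * (\<xi> j + t * of_bool (j = a))
          = q i j * \<xi> i * \<xi> j + of_bool (j = a) * (t * (q i j * \<xi> i))
            + of_bool (i = a) * (t * (q i j * \<xi> j)) + of_bool (i = a) * (of_bool (j = a) * (t\<^sup>2 * q i j))"
        for i j by (simp only: power2_eq_square algebra_simps)
      have "(\<Sum>i\<in>UNIV. q i a * \<xi> i) = l \<xi>" using sym by (simp add: l_def)
      then show ?thesis
        unfolding expd sum.distrib delta sum_distrib_left[symmetric] by (simp add: l_def)
    qed
    have quad: "0 \<le> (\<Sum>i\<in>UNIV. \<Sum>j\<in>UNIV. q i j * \<xi> i * \<xi> j) + 2 * t * l \<xi> + t\<^sup>2 * q a a" for \<xi> t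
      using psd[of "\<lambda>i. \<xi> i + t * of_bool (i = a)"] expand by simp
    have qaa: "0 \<le> q a a" using quad[of "\<lambda>_. 0" 1] by (simp add: l_def)
    show ?case
    proof (cases "q a a = 0")
      case True
      \<comment> \<open>With \<open>q a a = 0\<close> the nonnegative expression in
        \<open>quad\<close> is affine in \<open>t\<close>, so its slope vanishes; the
        \<open>t\<close> chosen below would give it the value -1.\<close>
      have l0: "l \<xi> = 0" for \<xi>
      proof (rule ccontr)
        assume "l \<xi> \<noteq> 0"
        define c where "c = (\<Sum>i\<in>UNIV. \<Sum>j\<in>UNIV. q i j * \<xi> i * \<xi> j)"
        have "0 \<le> c + 2 * (- (c + 1) / (2 * l \<xi>)) * l \<xi>"
          using quad[of \<xi> "- (c + 1) / (2 * l \<xi>)"] True unfolding c_def by simp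
        then show False using \<open>l \<xi> \<noteq> 0\<close> by (simp add: field_simps)
      qed
      have qa: "q a j = 0" for j
        using l0[of "\<lambda>i. of_bool (i = j)"] by (simp add: l_def of_bool_def if_distrib cong: if_cong)
      have "q i j = 0" if "i \<notin> S" for i j
        using that supp[of i] qa by (cases "i = a") auto
      then show ?thesis by (intro insert.IH sym psd)
    next
      case False
      then have pos: "q a a > 0" using qaa by simp
      define q' where "q' i j = q i j - q a i * q a j / q a a" for i j
      have q'sym: "q' i j = q' j i" for i j using sym by (simp add: q'_def mult.commute)
      have prod_sum: "(\<Sum>i\<in>UNIV. \<Sum>j\<in>UNIV. q a i * q a j / q a a * \<xi> i * \<xi> j) = (l \<xi>)\<^sup>2 / q a a" for \<xi>
        unfolding l_def power2_eq_square sum_product sum_divide_distrib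
        by (intro sum.cong refl) (simp add: field_simps)
      \<comment> \<open>The form of \<open>q'\<close> at \<open>\<xi>\<close> is the minimum over
        \<open>t\<close> of the expression in \<open>quad\<close>, attained at
        \<open>t = - l \<xi> / q a a\<close>.\<close>
      have q'psd: "0 \<le> (\<Sum>i\<in>UNIV. \<Sum>j\<in>UNIV. q' i j * \<xi> i * \<xi> j)" for \<xi>
      proof -
        have "(\<Sum>i\<in>UNIV. \<Sum>j\<in>UNIV. q' i j * \<xi> i * \<xi> j)
            = (\<Sum>i\<in>UNIV. \<Sum>j\<in>UNIV. q i j * \<xi> i * \<xi> j) - (l \<xi>)\<^sup>2 / q a a"
          unfolding prod_sum[symmetric] q'_def left_diff_distrib sum_subtractf ..
        moreover have "2 * (- l \<xi> / q a a) * l \<xi> + (- l \<xi> / q a a)\<^sup>2 * q a a = - (l \<xi>)\<^sup>2 / q a a"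
          using pos by (simp add: power2_eq_square field_simps)
        ultimately show ?thesis using quad[of \<xi> "- l \<xi> / q a a"] by linarith
      qed
      have q'supp: "q' i j = 0" if "i \<notin> S" for i j
        using that supp[of i] sym[of i a] pos by (cases "i = a") (auto simp: q'_def)
      have "0 \<le> (\<Sum>i\<in>UNIV. \<Sum>j\<in>UNIV. q' i j * h i j)"
        by (intro insert.IH q'sym q'psd q'supp)
      moreover have "(\<Sum>i\<in>UNIV. \<Sum>j\<in>UNIV. q i j * h i j) = (\<Sum>i\<in>UNIV. \<Sum>j\<in>UNIV. q' i j * h i j)
          + (\<Sum>i\<in>UNIV. \<Sum>j\<in>UNIV. h i j * q a i * q a j) / q a a"
        unfolding q'_def sum_divide_distrib sum.distrib[symmetric]
        by (intro sum.cong refl) (simp add: field_simps)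
      ultimately show ?thesis using h[of "q a"] pos by simp
    qed
  qed
  from this[of UNIV q] show ?thesis using assms by simp
qed

section \<open>First and second order conditions at a local minimum\<close>

lemma has_derivative_partial_D:
  fixes f :: "real^'n::finite \<Rightarrow> real"
  assumes "f differentiable (at x)"
  shows "(f has_derivative (\<lambda>v. \<Sum>i\<in>UNIV. v $ i * partial_D i f x)) (at x)"
proof -
  let ?D = "frechet_derivative f (at x)"
  have D: "(f has_derivative ?D) (at x)" using assms frechet_derivative_works by blast
  then have lin: "linear ?D" by (rule has_derivative_linear)
  have "?D v = (\<Sum>i\<in>UNIV. v $ i * partial_D i f x)" for v
  proof -
    have "?D v = ?D (\<Sum>i\<in>UNIV. v $ i *s axis i 1)" by (simp add: basis_expansion)
    also have "\<dots> = (\<Sum>i\<in>UNIV. v $ i * ?D (axis i 1))"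
      by (simp add: linear_sum[OF lin] linear_cmul[OF lin] scalar_mult_eq_scaleR)
    finally show ?thesis by (simp add: partial_D_def)
  qed
  then show ?thesis using D by (metis (no_types, lifting) ext)
qed

lemma partial_D_eqI:
  assumes "(f has_derivative f') (at x)"
  shows "partial_D i f x = f' (axis i 1)"
  unfolding partial_D_def using frechet_derivative_at[OF assms] by simp

lemma DERIV_along_line:
  fixes f :: "real^'n::finite \<Rightarrow> real"
  assumes "\<And>x. f differentiable (at x)"
  shows "((\<lambda>h. f (x + h *\<^sub>R \<xi>)) has_real_derivative (\<Sum>i\<in>UNIV. \<xi> $ i * partial_D i f (x + h *\<^sub>R \<xi>))) (at h)"
proof -
  have "((\<lambda>h. x + h *\<^sub>R \<xi>) has_derivative (\<lambda>h. h *\<^sub>R \<xi>)) (at h)"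
    by (auto intro!: derivative_eq_intros)
  from has_derivative_compose[OF this has_derivative_partial_D[OF assms]]
  have "((\<lambda>h. f (x + h *\<^sub>R \<xi>)) has_derivative
      (\<lambda>v. \<Sum>i\<in>UNIV. (v *\<^sub>R \<xi>) $ i * partial_D i f (x + h *\<^sub>R \<xi>))) (at h)" .
  then show ?thesis
    unfolding has_field_derivative_def
    by (rule has_derivative_eq_rhs) (auto simp: sum_distrib_left mult.assoc mult.commute mult.left_commute)
qed

text \<open>Both facts are read off on lines through \<open>x\<close>. If the second derivative
  \<open>c\<close> along a line were negative, the first derivative, which vanishes at the minimum,
  would be negative just after it, and the mean value theorem would produce a smaller value of
  \<open>f\<close>.\<close>

lemma C2_local_min:
  fixes f :: "real^'n::finite \<Rightarrow> real"
  assumes C2: "C2_fun f" and e: "e > 0" and min: "\<And>y. dist x y < e \<Longrightarrow> f x \<le> f y"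
  shows "partial_D i f x = 0"
    and "0 \<le> (\<Sum>i\<in>UNIV. \<Sum>j\<in>UNIV. partial_D i (partial_D j f) x * \<xi> i * \<xi> j)"
proof -
  have diff: "f differentiable (at y)" and diff2: "partial_D i f differentiable (at y)" for y i
    using C2 by (auto simp: C2_fun_def C1_fun_def)
  have min': "f x \<le> f (x + h *\<^sub>R v)" if "\<bar>h\<bar> < e / (norm v + 1)" for h v
  proof (rule min)
    have "\<bar>h\<bar> * (norm v + 1) < e"
      using that by (simp add: pos_less_divide_eq add_nonneg_pos)
    moreover have "\<bar>h\<bar> * norm v \<le> \<bar>h\<bar> * (norm v + 1)" by (simp add: mult_left_mono)
    ultimately show "dist x (x + h *\<^sub>R v) < e" by (simp add: dist_norm)
  qed
  define g' where "g' v h = (\<Sum>i\<in>UNIV. v $ i * partial_D i f (x + h *\<^sub>R v))" for v h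
  have g: "((\<lambda>h. f (x + h *\<^sub>R v)) has_real_derivative g' v h) (at h)" for v h
    unfolding g'_def by (rule DERIV_along_line[OF diff])
  have pos: "0 < e / (norm v + 1)" for v :: "real^'n" using e by (simp add: add_nonneg_pos)
  have g'0: "g' v 0 = 0" for v
    by (rule DERIV_local_min[OF g pos[of v]]) (use min' in auto)
  show "partial_D i f x = 0"
    using g'0[of "axis i 1"] by (simp add: g'_def axis_def if_distrib if_distribR cong: if_cong)
  define v :: "real^'n" where "v = (\<chi> i. \<xi> i)"
  define c where "c = (\<Sum>j\<in>UNIV. \<xi> j * (\<Sum>i\<in>UNIV. \<xi> i * partial_D i (partial_D j f) x))"
  have g2: "(g' v has_real_derivative c) (at 0)"
    unfolding g'_def c_def
    by (rule DERIV_sum) (use DERIV_cmult[OF DERIV_along_line[OF diff2, where x=x and \<xi>=v and h=0]] in \<open>simp add: v_def\<close>)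
  have "0 \<le> c"
  proof (rule ccontr)
    assume "\<not> 0 \<le> c"
    then obtain d where d: "d > 0" "\<And>h. 0 < h \<Longrightarrow> h < d \<Longrightarrow> g' v h < 0"
      using DERIV_neg_dec_right[OF g2] g'0[of v] by auto
    define e' where "e' = e / (norm v + 1)"
    have "0 < e'" using pos[of v] by (simp add: e'_def)
    define h where "h = min d e' / 2"
    have h: "0 < h" "h < d" "\<bar>h\<bar> < e / (norm v + 1)" using d(1) \<open>0 < e'\<close> by (auto simp: h_def min_def simp flip: e'_def)
    obtain z where z: "0 < z" "z < h" "f (x + h *\<^sub>R v) - f (x + 0 *\<^sub>R v) = (h - 0) * g' v z"
      using MVT2[OF h(1), of "\<lambda>h. f (x + h *\<^sub>R v)" "g' v"] g by blast
    have "g' v z < 0" using d(2) z h by auto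
    then have "h * g' v z < 0" using h(1) by (simp add: mult_pos_neg)
    then show False using z(3) min'[OF h(3)] by simp
  qed
  moreover have "c = (\<Sum>i\<in>UNIV. \<Sum>j\<in>UNIV. partial_D i (partial_D j f) x * \<xi> i * \<xi> j)"
    unfolding c_def sum_distrib_left
    by (subst sum.swap) (simp add: ac_simps)
  ultimately show "0 \<le> (\<Sum>i\<in>UNIV. \<Sum>j\<in>UNIV. partial_D i (partial_D j f) x * \<xi> i * \<xi> j)" by simp
qed

lemma quadratic_form_eq:
  fixes A :: "real^'n::finite^'n"
  shows "(A *v \<xi>) \<bullet> \<xi> = (\<Sum>i\<in>UNIV. \<Sum>j\<in>UNIV. A $ i $ j * \<xi> $ i * \<xi> $ j)"
  by (simp add: inner_vec_def matrix_vector_mult_def sum_distrib_left sum_distrib_right ac_simps)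

text \<open>The drift drops out because the gradient vanishes; what remains is the trace of the
  product of \<open>Q\<close> with the Hessian, two matrices with nonnegative quadratic
  forms.\<close>

lemma elliptic_op_local_min_nonneg:
  fixes f :: "real^'n::finite \<Rightarrow> real"
  assumes "hyp_H2 Q" and C2: "C2_fun f" and e: "e > 0" "\<And>y. dist x y < e \<Longrightarrow> f x \<le> f y"
  shows "0 \<le> elliptic_op Q b s f x"
proof -
  obtain \<eta> \<eta>0 where \<eta>: "0 < \<eta>0" "\<And>s x. \<eta>0 \<le> \<eta> s x"
      "\<And>s x \<xi>. (Q s x *v \<xi>) \<bullet> \<xi> \<ge> \<eta> s x * (norm \<xi>)\<^sup>2"
    and sym: "\<And>s x. transpose (Q s x) = Q s x"
    using assms(1) unfolding hyp_H2_def by blast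
  have psd: "0 \<le> (Q s x *v \<xi>) \<bullet> \<xi>" for \<xi>
    using \<eta>(3)[of s x \<xi>] \<eta>(1) \<eta>(2)[of s x] by (smt (verit) mult_nonneg_nonneg zero_le_power2)
  have "0 \<le> (\<Sum>i\<in>UNIV. \<Sum>j\<in>UNIV. Q s x $ i $ j * partial_D i (partial_D j f) x)"
  proof (rule psd_frobenius_nonneg)
    show "Q s x $ i $ j = Q s x $ j $ i" for i j
      using arg_cong[OF sym[of s x], of "\<lambda>A. A $ j $ i"] by (simp add: transpose_def)
    show "0 \<le> (\<Sum>i\<in>UNIV. \<Sum>j\<in>UNIV. Q s x $ i $ j * \<xi> i * \<xi> j)" for \<xi>
      using psd[of "\<chi> i. \<xi> i"] by (simp add: quadratic_form_eq)
  qed (rule C2_local_min(2)[OF C2 e])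
  moreover have "(\<Sum>i\<in>UNIV. b s x $ i * partial_D i f x) = 0"
    using C2_local_min(1)[OF C2 e] by simp
  ultimately show ?thesis by (simp add: elliptic_op_def)
qed

section \<open>Linearity of the elliptic operator\<close>

lemma partial_D_add:
  fixes f g :: "real^'n::finite \<Rightarrow> real"
  assumes "f differentiable (at x)" "g differentiable (at x)"
  shows "partial_D i (\<lambda>x. f x + g x) x = partial_D i f x + partial_D i g x"
  using frechet_derivative_works[THEN iffD1, OF assms(1)] frechet_derivative_works[THEN iffD1, OF assms(2)]
  by (subst partial_D_eqI[OF has_derivative_add]) (auto simp: partial_D_def)

lemma partial_D_cmult:
  fixes f :: "real^'n::finite \<Rightarrow> real"
  assumes "f differentiable (at x)"
  shows "partial_D i (\<lambda>x. c * f x) x = c * partial_D i f x"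
  using frechet_derivative_works[THEN iffD1, OF assms]
  by (subst partial_D_eqI[OF has_derivative_mult_right]) (auto simp: partial_D_def)

lemma C1_fun_add: "C1_fun f \<Longrightarrow> C1_fun g \<Longrightarrow> C1_fun (\<lambda>x. f x + g x)"
  by (auto simp: C1_fun_def partial_D_add intro!: continuous_on_add)

lemma C1_fun_cmult: "C1_fun f \<Longrightarrow> C1_fun (\<lambda>x. c * f x)"
  by (auto simp: C1_fun_def partial_D_cmult intro!: continuous_on_mult continuous_on_const)

lemma C2_fun_add:
  assumes "C2_fun f" "C2_fun g" shows "C2_fun (\<lambda>x. f x + g x)"
proof -
  have "partial_D i (\<lambda>x. f x + g x) = (\<lambda>x. partial_D i f x + partial_D i g x)" for i
    using assms by (auto simp: C2_fun_def C1_fun_def partial_D_add)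
  then show ?thesis using assms by (auto simp: C2_fun_def C1_fun_add)
qed

lemma C2_fun_cmult:
  assumes "C2_fun f" shows "C2_fun (\<lambda>x. c * f x)"
proof -
  have "partial_D i (\<lambda>x. c * f x) = (\<lambda>x. c * partial_D i f x)" for i
    using assms by (auto simp: C2_fun_def C1_fun_def partial_D_cmult)
  then show ?thesis using assms by (auto simp: C2_fun_def C1_fun_cmult)
qed

lemma elliptic_op_add:
  assumes "C2_fun f" "C2_fun g"
  shows "elliptic_op Q b s (\<lambda>x. f x + g x) x = elliptic_op Q b s f x + elliptic_op Q b s g x"
proof -
  have 1: "partial_D i (\<lambda>x. f x + g x) = (\<lambda>x. partial_D i f x + partial_D i g x)" for i
    using assms by (auto simp: C2_fun_def C1_fun_def partial_D_add)
  have 2: "partial_D i (\<lambda>x. partial_D j f x + partial_D j g x) x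
      = partial_D i (partial_D j f) x + partial_D i (partial_D j g) x" for i j
    using assms by (intro partial_D_add) (auto simp: C2_fun_def C1_fun_def)
  show ?thesis by (simp add: elliptic_op_def 1 2 algebra_simps sum.distrib)
qed

lemma elliptic_op_cmult:
  assumes "C2_fun f"
  shows "elliptic_op Q b s (\<lambda>x. c * f x) x = c * elliptic_op Q b s f x"
proof -
  have 1: "partial_D i (\<lambda>x. c * f x) = (\<lambda>x. c * partial_D i f x)" for i
    using assms by (auto simp: C2_fun_def C1_fun_def partial_D_cmult)
  have 2: "partial_D i (\<lambda>x. c * partial_D j f x) x = c * partial_D i (partial_D j f) x" for i j
    using assms by (intro partial_D_cmult) (auto simp: C2_fun_def C1_fun_def)
  show ?thesis by (simp add: elliptic_op_def 1 2 algebra_simps sum_distrib_left)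
qed

lemma partial_D_const [simp]: "partial_D i (\<lambda>x. c) = (\<lambda>x. 0)"
  using partial_D_eqI[OF has_derivative_const] by fastforce

lemma C1_fun_const: "C1_fun (\<lambda>x. c)"
  by (simp add: C1_fun_def)

lemma C2_fun_const: "C2_fun (\<lambda>x. c)"
  by (simp add: C2_fun_def C1_fun_const)

lemma elliptic_op_const [simp]: "elliptic_op Q b s (\<lambda>x. c) x = 0"
  by (simp add: elliptic_op_def)

section \<open>Comparison principles for bounded solutions\<close>

text \<open>The equation without an initial value: a class of functions closed under linear
  combinations, restriction to a later starting time and shift by a period, to which the maximum
  principle is applied.\<close>

definition para_solution ::
  "(real \<Rightarrow> real^'n \<Rightarrow> real^'n^'n) \<Rightarrow> (real \<Rightarrow> real^'n \<Rightarrow> real^'n) \<Rightarrow>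
   real \<Rightarrow> (real \<Rightarrow> real^'n::finite \<Rightarrow> real) \<Rightarrow> bool" where
  "para_solution Q b s v \<longleftrightarrow>
     bounded ((\<lambda>(t, x). v t x) ` ({s..} \<times> UNIV)) \<and>
     continuous_on ({s..} \<times> UNIV) (\<lambda>(t, x). v t x) \<and>
     (\<forall>t>s. C2_fun (v t)) \<and>
     (\<forall>t>s. \<forall>x. ((\<lambda>\<tau>. v \<tau> x) has_real_derivative elliptic_op Q b t (v t) x) (at t))"

lemma C2_fun_continuous: "C2_fun f \<Longrightarrow> continuous_on A f"
  by (auto simp: C2_fun_def C1_fun_def intro!: differentiable_imp_continuous_on differentiable_at_imp_differentiable_on)

text \<open>A minimum over a time interval may sit at its last instant, so only earlier times are
  compared, and the derivative is bounded on one side instead of vanishing.\<close>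

lemma DERIV_nonpos_left_min:
  fixes f :: "real \<Rightarrow> real"
  assumes "(f has_real_derivative D) (at t)" and "e > 0" and "\<And>h. 0 < h \<Longrightarrow> h < e \<Longrightarrow> f t \<le> f (t - h)"
  shows "D \<le> 0"
proof (rule ccontr)
  assume "\<not> D \<le> 0"
  then obtain d where "d > 0" "\<And>h. 0 < h \<Longrightarrow> h < d \<Longrightarrow> f (t - h) < f t"
    using DERIV_pos_inc_left[OF assms(1)] by auto
  then show False using assms(2) assms(3)[of "min d e / 2"] by (smt (verit) field_sum_of_halves min_def)
qed

text \<open>The function \<open>z\<close> adds to \<open>v\<close> a small multiple of
  \<open>W\<close> that grows exponentially in time. It is positive at time \<open>s\<close> and far
  out in space, so a negative value would produce a negative minimum in the interior of a ball at a
  time after \<open>s\<close>. There the time derivative is at most 0 and the operator applied to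
  \<open>z\<close> is at least 0, against the strict inequality satisfied by
  \<open>W\<close>.\<close>

theorem maximum_principle:
  fixes v :: "real \<Rightarrow> real^'n::finite \<Rightarrow> real"
  assumes H2: "hyp_H2 Q" and H3: "hyp_H3 Q b" and v: "para_solution Q b s v"
    and init: "\<And>x. 0 \<le> v s x" and t: "s \<le> t"
  shows "0 \<le> v t x"
proof (rule ccontr)
  assume neg: "\<not> 0 \<le> v t x"
  obtain W \<kappa>0 \<epsilon> where W: "C2_fun W" "\<And>x. W x > 0" "filterlim W at_top at_infinity"
    and eps: "\<epsilon> > 0" and AW0: "\<And>s x. elliptic_op Q b s W x - \<kappa>0 * W x \<le> - \<epsilon>"
    using H3 unfolding hyp_H3_def by blast
  \<comment> \<open>A nonnegative rate makes the exponential factor at least 1 after time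
    \<open>s\<close>, which \<open>zout\<close> relies on; since \<open>W > 0\<close>, the Lyapunov
    inequality survives the increase.\<close>
  define \<kappa> where "\<kappa> = max \<kappa>0 0"
  have kap: "\<kappa> \<ge> 0" by (simp add: \<kappa>_def)
  have AW: "elliptic_op Q b s W x - \<kappa> * W x \<le> - \<epsilon>" for s x
  proof -
    have "\<kappa>0 * W x \<le> \<kappa> * W x" using W(2)[of x] by (intro mult_right_mono) (auto simp: \<kappa>_def)
    then show ?thesis using AW0[of s x] by simp
  qed
  have bdd: "bounded ((\<lambda>(t, x). v t x) ` ({s..} \<times> UNIV))"
    and cont: "continuous_on ({s..} \<times> UNIV) (\<lambda>(t, x). v t x)"
    and C2: "\<And>t. t > s \<Longrightarrow> C2_fun (v t)"
    and der: "\<And>t x. t > s \<Longrightarrow> ((\<lambda>\<tau>. v \<tau> x) has_real_derivative elliptic_op Q b t (v t) x) (at t)"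
    using v by (auto simp: para_solution_def)
  obtain B where B: "\<And>t x. s \<le> t \<Longrightarrow> \<bar>v t x\<bar> \<le> B"
    using bdd unfolding bounded_iff by fastforce
  \<comment> \<open>With this \<open>\<delta>\<close> the added term at \<open>(t, x)\<close> equals
    half of \<open>- v t x\<close>, so \<open>z\<close> is still negative there.\<close>
  define \<delta> where "\<delta> = - v t x / (2 * exp (\<kappa> * (t - s)) * W x)"
  have \<delta>: "\<delta> > 0" using neg W(2)[of x] by (auto simp: \<delta>_def divide_simps)
  define z where "z t x = v t x + \<delta> * exp (\<kappa> * (t - s)) * W x" for t x
  have ztx: "z t x < 0" using neg W(2)[of x] by (auto simp: z_def \<delta>_def field_simps)
  have zpos_s: "z s y > 0" for y
    using init[of y] W(2)[of y] \<delta> by (simp add: z_def add_nonneg_pos)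
  \<comment> \<open>Outside the ball of radius \<open>R\<close> the added term is at least
    \<open>B + 1\<close> and outweighs the bound \<open>B\<close> of \<open>v\<close>.\<close>
  obtain R where R: "\<And>y. norm y \<ge> R \<Longrightarrow> W y \<ge> (B + 1) / \<delta>"
    using W(3) unfolding filterlim_at_top eventually_at_infinity by blast
  have zout: "z \<tau> y > 0" if "s \<le> \<tau>" "norm y \<ge> R" for \<tau> y
  proof -
    have "B + 1 \<le> \<delta> * W y" using R[OF that(2)] \<delta> by (simp add: field_simps)
    also have "\<dots> \<le> \<delta> * exp (\<kappa> * (\<tau> - s)) * W y"
    proof -
      have "1 \<le> exp (\<kappa> * (\<tau> - s))" using kap that(1) by simp
      then have "\<delta> * W y * 1 \<le> \<delta> * W y * exp (\<kappa> * (\<tau> - s))" 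
        using \<delta> W(2)[of y] by (intro mult_left_mono) auto
      then show ?thesis by (simp add: ac_simps)
    qed
    finally show ?thesis using B[OF that(1), of y] by (simp add: z_def)
  qed
  let ?K = "{s..t} \<times> cball (0::real^'n) R"
  have xR: "norm x < R" using zout[OF t, of x] ztx by linarith
  have "compact ?K" by (intro compact_Times) auto
  moreover have "(t, x) \<in> ?K" using t xR by auto
  then have "?K \<noteq> {}" by blast
  moreover have "continuous_on ?K (\<lambda>p. z (fst p) (snd p))"
    unfolding z_def
    by (intro continuous_intros continuous_on_compose2[OF C2_fun_continuous[OF W(1), of UNIV]]
        continuous_on_subset[OF cont[unfolded case_prod_beta]]) auto
  ultimately obtain p where p: "p \<in> ?K" "\<And>q. q \<in> ?K \<Longrightarrow> z (fst p) (snd p) \<le> z (fst q) (snd q)"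
    using continuous_attains_inf[of ?K "\<lambda>p. z (fst p) (snd p)"] by blast
  obtain \<tau> y where p_eq: "p = (\<tau>, y)" by (cases p)
  have "z \<tau> y < 0" using p(2)[of "(t, x)"] ztx xR t by (simp add: p_eq)
  then have \<tau>: "s < \<tau>" "\<tau> \<le> t" and y: "norm y < R"
    using p(1) zpos_s[of y] zout[of \<tau> y] by (force simp: p_eq less_eq_real_def)+
  define E where "E = exp (\<kappa> * (\<tau> - s))"
  have E: "E > 0" by (simp add: E_def)
  have "((\<lambda>\<tau>. z \<tau> y) has_real_derivative elliptic_op Q b \<tau> (v \<tau>) y + \<delta> * (\<kappa> * E) * W y) (at \<tau>)"
    unfolding z_def E_def by (auto intro!: derivative_eq_intros der[OF \<tau>(1)])
  then have "elliptic_op Q b \<tau> (v \<tau>) y + \<delta> * (\<kappa> * E) * W y \<le> 0"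
  proof (rule DERIV_nonpos_left_min)
    show "0 < \<tau> - s" using \<tau> by simp
    show "z \<tau> y \<le> z (\<tau> - h) y" if "0 < h" "h < \<tau> - s" for h
      using p(2)[of "(\<tau> - h, y)"] that \<tau> y by (simp add: p_eq)
  qed
  moreover have "0 \<le> elliptic_op Q b \<tau> (\<lambda>x. v \<tau> x + (\<delta> * E) * W x) y"
  proof (rule elliptic_op_local_min_nonneg[OF H2])
    show "C2_fun (\<lambda>x. v \<tau> x + (\<delta> * E) * W x)"
      by (intro C2_fun_add C2_fun_cmult C2 \<tau> W)
    show "0 < R - norm y" using y by simp
    show "v \<tau> y + (\<delta> * E) * W y \<le> v \<tau> y' + (\<delta> * E) * W y'" if "dist y y' < R - norm y" for y'
    proof -
      have "norm y' \<le> R" using that norm_triangle_ineq2[of y' y] by (simp add: dist_norm norm_minus_commute)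
      then show ?thesis using p(2)[of "(\<tau>, y')"] \<tau> by (simp add: p_eq z_def E_def)
    qed
  qed
  then have "0 \<le> elliptic_op Q b \<tau> (v \<tau>) y + \<delta> * E * elliptic_op Q b \<tau> W y"
    by (simp add: elliptic_op_add elliptic_op_cmult C2_fun_cmult C2 \<tau> W)
  ultimately have "\<delta> * E * (elliptic_op Q b \<tau> W y - \<kappa> * W y) \<ge> 0" by (simp add: algebra_simps)
  then have "elliptic_op Q b \<tau> W y - \<kappa> * W y \<ge> 0" 
    using mult_pos_neg[OF mult_pos_pos[OF \<delta> E]] by (meson linorder_not_le)
  then show False using AW[of \<tau> y] eps by simp
qed

text \<open>Here \<open>d\<close> is the squared radius of the ball on which the barrier lives. Near
  its boundary the factor \<open>d - (x - c) \<bullet> (x - c)\<close> is small and the first term,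
  which is positive by ellipticity, dominates; taking the square is what produces this term.\<close>

lemma C2_fun_barrier:
  fixes c :: "real^'n::finite"
  shows "C2_fun (\<lambda>y. k * (d - (y - c) \<bullet> (y - c))\<^sup>2)" (is "C2_fun ?w")
    and "elliptic_op Q b s (\<lambda>y. k * (d - (y - c) \<bullet> (y - c))\<^sup>2) x
      = k * (8 * ((Q s x *v (x - c)) \<bullet> (x - c))
        - 4 * (d - (x - c) \<bullet> (x - c)) * ((\<Sum>i\<in>UNIV. Q s x $ i $ i) + b s x \<bullet> (x - c)))" (is ?ell)
proof -
  have D1: "(?w has_derivative (\<lambda>v. k * (2 * (d - (y - c) \<bullet> (y - c)) * (- 2 * ((y - c) \<bullet> v))))) (at y)" for y
    by (auto intro!: derivative_eq_intros ext simp: inner_commute algebra_simps)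
  have P1: "partial_D i ?w = (\<lambda>y. (- 4 * k) * (d - (y - c) \<bullet> (y - c)) * ((y - c) $ i))" for i
    by (rule ext, subst partial_D_eqI[OF D1]) (simp add: inner_axis algebra_simps)
  have D2: "((\<lambda>y. (- 4 * k) * (d - (y - c) \<bullet> (y - c)) * ((y - c) $ i)) has_derivative
      (\<lambda>v. (- 4 * k) * ((- 2 * ((y - c) \<bullet> v)) * ((y - c) $ i) + (d - (y - c) \<bullet> (y - c)) * v $ i))) (at y)" for i y
    by (auto intro!: derivative_eq_intros ext bounded_linear.has_derivative[OF bounded_linear_vec_nth]
        simp: inner_commute algebra_simps)
  have P2: "partial_D j (partial_D i ?w) = (\<lambda>y. (- 4 * k) * ((- 2 * (y - c) $ j) * ((y - c) $ i) +
      (d - (y - c) \<bullet> (y - c)) * of_bool (i = j)))" for i j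
    unfolding P1 by (rule ext, subst partial_D_eqI[OF D2]) (simp add: inner_axis, simp add: axis_def)
  show "C2_fun ?w"
    unfolding C2_fun_def C1_fun_def
  proof (intro conjI allI)
    show "?w differentiable (at y)" for y using D1 unfolding differentiable_def by blast
    show "partial_D i ?w differentiable (at y)" for i y
      using D2 unfolding P1 differentiable_def by blast
    show "continuous_on UNIV (partial_D i ?w)" for i
      unfolding P1 by (intro continuous_intros)
    show "continuous_on UNIV (partial_D j (partial_D i ?w))" for i j
      unfolding P2 by (intro continuous_intros)
  qed
  define h where "h = x - c"
  define \<rho> where "\<rho> = d - h \<bullet> h"
  have expd: "q * ((- 4 * k) * ((- 2 * h $ i) * (h $ j) + \<rho> * of_bool (j = i)))
     = 8 * k * (q * h $ i * h $ j) + (if j = i then (- 4 * k * \<rho>) * q else 0)" for q i j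
    by (simp add: algebra_simps)
  have expd1: "q * ((- 4 * k) * \<rho> * h $ i) = (- 4 * k * \<rho>) * (q * h $ i)" for q i
    by (simp add: algebra_simps)
  have "elliptic_op Q b s ?w x = 8 * k * (\<Sum>i\<in>UNIV. \<Sum>j\<in>UNIV. Q s x $ i $ j * h $ i * h $ j)
      + (- 4 * k * \<rho>) * (\<Sum>i\<in>UNIV. Q s x $ i $ i) + (- 4 * k * \<rho>) * (\<Sum>i\<in>UNIV. b s x $ i * h $ i)"
    unfolding elliptic_op_def P2
    unfolding P1 h_def[symmetric] \<rho>_def[symmetric] expd expd1
    by (simp only: sum.distrib sum.delta finite UNIV_I if_True sum_distrib_left)
  then show ?ell
    unfolding quadratic_form_eq h_def[symmetric] \<rho>_def[symmetric]
    by (simp add: inner_vec_def algebra_simps)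
qed

text \<open>The centre of the ball runs along a straight line from \<open>x0\<close> at time
  \<open>s\<close> to \<open>x\<close> at time \<open>t\<close>, with velocity \<open>e\<close>. If
  \<open>v t x\<close> were 0, the difference \<open>z\<close> of \<open>v\<close> and the barrier
  would have a negative minimum on the tube swept by the ball. It cannot lie at time
  \<open>s\<close>, where the barrier is below \<open>v\<close>, nor on the lateral boundary, where
  the barrier vanishes; elsewhere the barrier, with its decay rate \<open>K\<close>, is a strict
  subsolution.\<close>

theorem strict_positivity:
  fixes v :: "real \<Rightarrow> real^'n::finite \<Rightarrow> real"
  assumes H1: "hyp_H1 Q b" and H2: "hyp_H2 Q" and v: "para_solution Q b s v"
    and nonneg: "\<And>t x. s \<le> t \<Longrightarrow> 0 \<le> v t x" and x0: "0 < v s x0" and t: "s < t"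
  shows "0 < v t x"
proof (rule ccontr)
  assume "\<not> 0 < v t x"
  then have vtx: "v t x \<le> 0" by simp
  have cont: "continuous_on ({s..} \<times> UNIV) (\<lambda>(t, x). v t x)"
    and C2: "\<And>t. t > s \<Longrightarrow> C2_fun (v t)"
    and der: "\<And>t x. t > s \<Longrightarrow> ((\<lambda>\<tau>. v \<tau> x) has_real_derivative elliptic_op Q b t (v t) x) (at t)"
    using v by (auto simp: para_solution_def)
  obtain \<eta> \<eta>0 where \<eta>: "0 < \<eta>0" "\<And>s x. \<eta>0 \<le> \<eta> s x"
      "\<And>s x \<xi>. (Q s x *v \<xi>) \<bullet> \<xi> \<ge> \<eta> s x * (norm \<xi>)\<^sup>2"
    using H2 unfolding hyp_H2_def by blast
  have ell: "(Q s x *v \<xi>) \<bullet> \<xi> \<ge> \<eta>0 * (\<xi> \<bullet> \<xi>)" for s x \<xi>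
    using \<eta>(3)[of s x \<xi>] mult_right_mono[OF \<eta>(2)[of s x], of "(norm \<xi>)\<^sup>2"]
    by (simp add: power2_norm_eq_inner)
  define c where "c = v s x0 / 2"
  have c: "c > 0" using x0 by (simp add: c_def)
  have "continuous_on UNIV (\<lambda>x. (\<lambda>(t, x). v t x) (s, x))"
    by (rule continuous_on_compose2[OF cont]) (auto intro!: continuous_intros)
  then have "isCont (v s) x0" by (simp add: continuous_on_eq_continuous_at)
  then obtain d0 where d0: "d0 > 0" "\<And>y. dist y x0 < d0 \<Longrightarrow> dist (v s y) (v s x0) < c"
    using c unfolding continuous_at_eps_delta by (metis dist_norm real_norm_def)
  define d where "d = d0 / 2"
  have d: "d > 0" using d0(1) by (simp add: d_def)
  have near: "c \<le> v s y" if "norm (y - x0) \<le> d" for y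
  proof -
    have "dist (v s y) (v s x0) < c" using that d0 by (intro d0(2)) (simp add: d_def dist_norm)
    then show ?thesis unfolding dist_real_def by (auto simp: c_def abs_if split: if_splits)
  qed
  define e where "e = (1 / (t - s)) *\<^sub>R (x - x0)"
  define \<xi> where "\<xi> \<tau> = x0 + (\<tau> - s) *\<^sub>R e" for \<tau>
  have \<xi>s: "\<xi> s = x0" and \<xi>t: "\<xi> t = x" using t by (auto simp: \<xi>_def e_def)
  define Tube where "Tube = (\<lambda>p. (fst p, snd p + \<xi> (fst p))) ` ({s..t} \<times> cball (0::real^'n) d)"
  have cont\<xi>: "continuous_on A (\<lambda>p. \<xi> (fst p))" for A :: "(real \<times> (real^'n)) set"
    unfolding \<xi>_def by (intro continuous_intros)
  have "compact Tube" unfolding Tube_def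
    by (intro compact_continuous_image continuous_intros cont\<xi> compact_Times) auto
  have Tube_iff: "(\<tau>, y) \<in> Tube \<longleftrightarrow> s \<le> \<tau> \<and> \<tau> \<le> t \<and> norm (y - \<xi> \<tau>) \<le> d" for \<tau> y
    unfolding Tube_def by (force simp: image_iff intro!: bexI[of _ "(\<tau>, y - \<xi> \<tau>)"])
  \<comment> \<open>The terms that carry one factor \<open>\<rho>\<close> in the inequality for the
    barrier: the motion of the ball, the trace of \<open>Q\<close> and the drift. The coefficients
    are continuous, hence \<open>P\<close> is bounded on the compact tube.\<close>
  define P where "P = (\<lambda>(\<tau>, y). (y - \<xi> \<tau>) \<bullet> e + (\<Sum>i\<in>UNIV. Q \<tau> y $ i $ i) + b \<tau> y \<bullet> (y - \<xi> \<tau>))"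
  have cQ: "continuous_on A (\<lambda>p. Q (fst p) (snd p) $ i $ j)"
    and cb: "continuous_on A (\<lambda>p. b (fst p) (snd p) $ i)" for i j A
    using H1 unfolding hyp_H1_def parabolic_Hoelder_loc_def case_prod_beta
    by (auto intro: continuous_on_subset)
  have "continuous_on Tube P"
    unfolding P_def case_prod_beta inner_vec_def
    by (intro continuous_intros cont\<xi> cQ cb)
  then have "bounded (P ` Tube)" using \<open>compact Tube\<close>
    by (intro compact_imp_bounded compact_continuous_image)
  then obtain C0 where C0: "\<And>p. p \<in> Tube \<Longrightarrow> \<bar>P p\<bar> \<le> C0" unfolding bounded_iff by auto
  define C where "C = max C0 0"
  have C: "P p \<le> C" if "p \<in> Tube" for p using C0[OF that] by (auto simp: C_def)
  \<comment> \<open>Ellipticity gives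
    \<open>8 * qf \<ge> 8 * \<eta>0 * (d\<^sup>2 - \<rho>)\<close>, so the left-hand side of
    \<open>ineq\<close> is at least \<open>K * \<rho>\<^sup>2 - B * \<rho> + 2 * m\<close>. With
    \<open>K\<close> as below, \<open>K * \<rho>\<^sup>2 - B * \<rho> + m\<close> has discriminant
    zero, and the second \<open>m\<close> makes the inequality strict.\<close>
  define B where "B = 4 * C + 8 * \<eta>0"
  define m where "m = 4 * \<eta>0 * d\<^sup>2"
  have m: "m > 0" using \<eta>(1) d by (simp add: m_def)
  define K where "K = B\<^sup>2 / (4 * m)"
  \<comment> \<open>The barrier at time \<open>s\<close> is at most
    \<open>k * (d\<^sup>2)\<^sup>2 = c\<close>, the lower bound of \<open>v s\<close> on the initial
    ball.\<close>
  define k where "k = c / d ^ 4"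
  have k: "k > 0" using c d by (simp add: k_def)
  define \<rho> where "\<rho> \<tau> y = d\<^sup>2 - (y - \<xi> \<tau>) \<bullet> (y - \<xi> \<tau>)" for \<tau> y
  define w where "w \<tau> y = k * exp (- K * (\<tau> - s)) * (\<rho> \<tau> y)\<^sup>2" for \<tau> y
  define z where "z \<tau> y = v \<tau> y + (- 1) * w \<tau> y" for \<tau> y
  have "continuous_on Tube (\<lambda>p. z (fst p) (snd p))"
    unfolding z_def w_def \<rho>_def
    by (intro continuous_intros cont\<xi> continuous_on_subset[OF cont[unfolded case_prod_beta]])
       (auto simp: Tube_def)
  moreover have tx: "(t, x) \<in> Tube" using t d by (simp add: Tube_iff \<xi>t)
  ultimately obtain p where p: "p \<in> Tube" "\<And>q. q \<in> Tube \<Longrightarrow> z (fst p) (snd p) \<le> z (fst q) (snd q)"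
    using continuous_attains_inf[of Tube "\<lambda>p. z (fst p) (snd p)"] \<open>compact Tube\<close> by blast
  obtain \<tau> y where p_eq: "p = (\<tau>, y)" by (cases p)
  have inT: "s \<le> \<tau>" "\<tau> \<le> t" "norm (y - \<xi> \<tau>) \<le> d" using p(1) by (auto simp: p_eq Tube_iff)
  have "0 < w t x" using k d by (simp add: w_def \<rho>_def \<xi>t)
  then have "z t x < 0" using vtx by (simp add: z_def)
  then have zneg: "z \<tau> y < 0" using p(2)[OF tx] by (simp add: p_eq)
  have inner_le: "(y - \<xi> \<tau>) \<bullet> (y - \<xi> \<tau>) \<le> d\<^sup>2"
    using inT(3) d by (metis norm_ge_zero power2_norm_eq_inner power_mono)
  then have \<rho>0: "0 \<le> \<rho> \<tau> y" by (simp add: \<rho>_def)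
  have \<tau>s: "s < \<tau>"
  proof (rule ccontr)
    assume "\<not> s < \<tau>"
    then have "\<tau> = s" using inT by simp
    have "(\<rho> \<tau> y)\<^sup>2 \<le> (d\<^sup>2)\<^sup>2" using \<rho>0 by (intro power_mono) (auto simp: \<rho>_def)
    then have "w s y \<le> k * (d\<^sup>2)\<^sup>2" using k by (simp add: w_def \<open>\<tau> = s\<close>)
    also have "\<dots> = c" using d by (simp add: k_def)
    also have "\<dots> \<le> v s y" using near inT(3) \<open>\<tau> = s\<close> \<xi>s by simp
    finally show False using zneg \<open>\<tau> = s\<close> by (simp add: z_def)
  qed
  have yd: "norm (y - \<xi> \<tau>) < d"
  proof (rule ccontr)
    assume "\<not> norm (y - \<xi> \<tau>) < d"
    then have "norm (y - \<xi> \<tau>) = d" using inT by simp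
    then have "\<rho> \<tau> y = 0" by (simp add: \<rho>_def power2_norm_eq_inner[symmetric])
    then show False using zneg nonneg[of \<tau> y] inT by (simp add: z_def w_def)
  qed
  define E where "E = k * exp (- K * (\<tau> - s))"
  have E: "E > 0" using k by (simp add: E_def)
  define Dw where "Dw = E * (- K * (\<rho> \<tau> y)\<^sup>2 + 4 * \<rho> \<tau> y * ((y - \<xi> \<tau>) \<bullet> e))"
  have \<rho>_expand: "\<rho> \<sigma> y = d\<^sup>2 - ((y - \<xi> \<tau>) \<bullet> (y - \<xi> \<tau>) - 2 * (\<sigma> - \<tau>) * ((y - \<xi> \<tau>) \<bullet> e)
      + (\<sigma> - \<tau>)\<^sup>2 * (e \<bullet> e))" for \<sigma>
  proof -
    have eq: "y - \<xi> \<sigma> = (y - \<xi> \<tau>) - (\<sigma> - \<tau>) *\<^sub>R e" by (simp add: \<xi>_def algebra_simps)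
    show ?thesis unfolding \<rho>_def eq
      by (simp add: inner_diff_left inner_diff_right inner_commute power2_eq_square algebra_simps)
  qed
  have "((\<lambda>\<sigma>. \<rho> \<sigma> y) has_real_derivative 2 * ((y - \<xi> \<tau>) \<bullet> e)) (at \<tau>)"
    unfolding \<rho>_expand by (auto intro!: derivative_eq_intros)
  then have "((\<lambda>\<tau>. w \<tau> y) has_real_derivative Dw) (at \<tau>)"
    unfolding w_def Dw_def E_def
    by (auto intro!: derivative_eq_intros simp: algebra_simps power2_eq_square)
  then have "((\<lambda>\<tau>. z \<tau> y) has_real_derivative elliptic_op Q b \<tau> (v \<tau>) y - Dw) (at \<tau>)"
    unfolding z_def by (auto intro!: derivative_eq_intros der[OF \<tau>s])
  then have D: "elliptic_op Q b \<tau> (v \<tau>) y - Dw \<le> 0"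
  proof (rule DERIV_nonpos_left_min)
    \<comment> \<open>Going back by \<open>h\<close>, the centre of the ball moves by
      \<open>h\<close> times \<open>e\<close>; this bound on \<open>h\<close> keeps \<open>y\<close>
      inside the ball at time \<open>\<tau> - h\<close>. The summand 1 covers
      \<open>e = 0\<close>.\<close>
    show "0 < min (\<tau> - s) ((d - norm (y - \<xi> \<tau>)) / (norm e + 1))"
      using \<tau>s yd by (simp add: add_nonneg_pos)
    show "z \<tau> y \<le> z (\<tau> - h) y" if h: "0 < h" "h < min (\<tau> - s) ((d - norm (y - \<xi> \<tau>)) / (norm e + 1))" for h
    proof -
      have "h * (norm e + 1) < d - norm (y - \<xi> \<tau>)"
        using h by (simp add: pos_less_divide_eq add_nonneg_pos)
      then have h': "h * norm e < d - norm (y - \<xi> \<tau>)" using h(1) by (simp add: distrib_left)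
      have eq: "y - \<xi> (\<tau> - h) = (y - \<xi> \<tau>) + h *\<^sub>R e" by (simp add: \<xi>_def algebra_simps)
      have "norm (y - \<xi> (\<tau> - h)) \<le> norm (y - \<xi> \<tau>) + h * norm e"
        unfolding eq using norm_triangle_ineq[of "y - \<xi> \<tau>" "h *\<^sub>R e"] h by simp
      then have "(\<tau> - h, y) \<in> Tube" using h h' inT by (simp add: Tube_iff)
      then show ?thesis using p(2)[of "(\<tau> - h, y)"] by (simp add: p_eq)
    qed
  qed
  have C2w: "C2_fun (w \<tau>)" unfolding w_def \<rho>_def by (rule C2_fun_barrier)
  have "0 \<le> elliptic_op Q b \<tau> (z \<tau>) y"
  proof (rule elliptic_op_local_min_nonneg[OF H2])
    show "C2_fun (z \<tau>)" unfolding z_def by (intro C2_fun_add C2_fun_cmult C2 \<tau>s C2w)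
    show "0 < d - norm (y - \<xi> \<tau>)" using yd by simp
    show "z \<tau> y \<le> z \<tau> y'" if "dist y y' < d - norm (y - \<xi> \<tau>)" for y'
    proof -
      have "norm (y' - \<xi> \<tau>) \<le> norm (y - \<xi> \<tau>) + dist y y'"
        using norm_triangle_ineq[of "y - \<xi> \<tau>" "y' - y"] by (simp add: dist_norm norm_minus_commute)
      then show ?thesis using p(2)[of "(\<tau>, y')"] that inT by (simp add: p_eq Tube_iff)
    qed
  qed
  then have "elliptic_op Q b \<tau> (w \<tau>) y \<le> elliptic_op Q b \<tau> (v \<tau>) y"
    unfolding z_def
    unfolding elliptic_op_add[OF C2[OF \<tau>s] C2_fun_cmult[OF C2w]] elliptic_op_cmult[OF C2w] by simp
  then have AwDw: "elliptic_op Q b \<tau> (w \<tau>) y \<le> Dw" using D by simp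
  define qf where "qf = (Q \<tau> y *v (y - \<xi> \<tau>)) \<bullet> (y - \<xi> \<tau>)"
  have Aw: "elliptic_op Q b \<tau> (w \<tau>) y
      = E * (8 * qf - 4 * \<rho> \<tau> y * ((\<Sum>i\<in>UNIV. Q \<tau> y $ i $ i) + b \<tau> y \<bullet> (y - \<xi> \<tau>)))"
    unfolding w_def \<rho>_def E_def qf_def by (rule C2_fun_barrier)
  have "E * (8 * qf + K * (\<rho> \<tau> y)\<^sup>2 - 4 * \<rho> \<tau> y * P (\<tau>, y)) \<le> 0"
    using AwDw unfolding Aw Dw_def P_def by (simp add: algebra_simps)
  then have ineq: "8 * qf + K * (\<rho> \<tau> y)\<^sup>2 - 4 * \<rho> \<tau> y * P (\<tau>, y) \<le> 0"
    using E by (simp add: mult_le_0_iff)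
  have "\<rho> \<tau> y * P (\<tau>, y) \<le> \<rho> \<tau> y * C" using \<rho>0 C[OF p(1)] by (simp add: p_eq mult_left_mono)
  moreover have "qf \<ge> \<eta>0 * (d\<^sup>2 - \<rho> \<tau> y)" using ell[of "y - \<xi> \<tau>" \<tau> y] by (simp add: qf_def \<rho>_def)
  moreover have "K * (\<rho> \<tau> y)\<^sup>2 - B * \<rho> \<tau> y + m \<ge> 0"
  proof -
    have "K * (\<rho> \<tau> y)\<^sup>2 - B * \<rho> \<tau> y + m = (B * \<rho> \<tau> y - 2 * m)\<^sup>2 / (4 * m)"
      using m by (simp add: K_def field_simps power2_eq_square)
    then show ?thesis using m by simp
  qed
  ultimately show False using ineq m by (simp add: B_def m_def algebra_simps)
qed

section \<open>The evolution operator\<close>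

lemma para_solution_add_cmult:
  assumes u: "para_solution Q b s u" and v: "para_solution Q b s v"
  shows "para_solution Q b s (\<lambda>t x. u t x + c * v t x)"
  unfolding para_solution_def
proof (intro conjI allI impI)
  obtain B where B: "\<And>t x. s \<le> t \<Longrightarrow> \<bar>u t x\<bar> \<le> B"
    using u unfolding para_solution_def bounded_iff by fastforce
  obtain B' where B': "\<And>t x. s \<le> t \<Longrightarrow> \<bar>v t x\<bar> \<le> B'"
    using v unfolding para_solution_def bounded_iff by fastforce
  have "\<bar>u t x + c * v t x\<bar> \<le> B + \<bar>c\<bar> * B'" if "s \<le> t" for t x
    using abs_triangle_ineq[of "u t x" "c * v t x"] B[OF that, of x]
      mult_left_mono[OF B'[OF that, of x], of "\<bar>c\<bar>"] by (simp add: abs_mult)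
  then show "bounded ((\<lambda>(t, x). u t x + c * v t x) ` ({s..} \<times> UNIV))"
    by (intro boundedI[of _ "B + \<bar>c\<bar> * B'"]) auto
  show "continuous_on ({s..} \<times> UNIV) (\<lambda>(t, x). u t x + c * v t x)"
    using u v unfolding para_solution_def case_prod_beta by (intro continuous_intros) auto
  fix t assume "s < t"
  then have C2: "C2_fun (u t)" "C2_fun (v t)" using u v by (auto simp: para_solution_def)
  then show "C2_fun (\<lambda>x. u t x + c * v t x)" by (intro C2_fun_add C2_fun_cmult)
  show "((\<lambda>\<tau>. u \<tau> x + c * v \<tau> x) has_real_derivative
      elliptic_op Q b t (\<lambda>x. u t x + c * v t x) x) (at t)" for x
    using u v \<open>s < t\<close> C2
    by (auto simp: para_solution_def elliptic_op_add elliptic_op_cmult C2_fun_cmult intro!: derivative_eq_intros)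
qed

lemma para_solution_const: "para_solution Q b s (\<lambda>t x. c)"
  by (auto simp: para_solution_def C2_fun_const image_constant_conv case_prod_beta)

lemma para_solution_mono:
  assumes "para_solution Q b s u" "s \<le> r"
  shows "para_solution Q b r u"
  using assms unfolding para_solution_def
  by (auto elim!: continuous_on_subset bounded_subset)

lemma para_solution_unique:
  assumes H: "hyp_H2 Q" "hyp_H3 Q b" and u: "para_solution Q b s u" and v: "para_solution Q b s v"
    and init: "\<And>x. u s x = v s x" and "s \<le> t"
  shows "u t x = v t x"
  using maximum_principle[OF H para_solution_add_cmult[OF u v, of "-1"] _ \<open>s \<le> t\<close>, of x]
    maximum_principle[OF H para_solution_add_cmult[OF v u, of "-1"] _ \<open>s \<le> t\<close>, of x] init
  by simp

lemma bcontfun_compose: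
  fixes \<phi> :: "'a::topological_space \<Rightarrow>\<^sub>C real" and f :: "real \<Rightarrow> real"
  assumes "continuous_on UNIV f"
  shows "apply_bcontfun (Bcontfun (\<lambda>x. f (apply_bcontfun \<phi> x))) = (\<lambda>x. f (apply_bcontfun \<phi> x))"
proof (rule Bcontfun_inverse)
  have "apply_bcontfun \<phi> x \<in> {- norm \<phi>..norm \<phi>}" for x
    using norm_bounded[of \<phi> x] by (auto simp: abs_le_iff)
  then have "range (\<lambda>x. f (apply_bcontfun \<phi> x)) \<subseteq> f ` {- norm \<phi>..norm \<phi>}" by blast
  moreover have "bounded (f ` {- norm \<phi>..norm \<phi>})"
    by (intro compact_imp_bounded compact_continuous_image continuous_on_subset[OF assms]) auto
  ultimately have "bounded (range (\<lambda>x. f (apply_bcontfun \<phi> x)))" by (rule bounded_subset[rotated])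
  moreover have "continuous_on UNIV (\<lambda>x. f (apply_bcontfun \<phi> x))"
    by (rule continuous_on_compose2[OF assms]) auto
  ultimately show "(\<lambda>x. f (apply_bcontfun \<phi> x)) \<in> bcontfun" by (simp add: bcontfun_def)
qed

lemma norm_bcontfun_leI:
  fixes \<phi> :: "'a::topological_space \<Rightarrow>\<^sub>C real"
  shows "(\<And>x. \<bar>apply_bcontfun \<phi> x\<bar> \<le> c) \<Longrightarrow> norm \<phi> \<le> c"
  by (rule norm_bound) simp

lemma abs_bcontfun_le: "\<bar>apply_bcontfun \<phi> x\<bar> \<le> norm (\<phi> :: 'a::topological_space \<Rightarrow>\<^sub>C real)"
  using norm_bounded[of \<phi> x] by simp

locale periodic_evolution =
  fixes T :: real
    and Q :: "real \<Rightarrow> real^'n::finite \<Rightarrow> real^'n^'n"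
    and b :: "real \<Rightarrow> real^'n \<Rightarrow> real^'n"
    and G :: "real \<Rightarrow> real \<Rightarrow> ((real^'n) \<Rightarrow>\<^sub>C real) \<Rightarrow> ((real^'n) \<Rightarrow>\<^sub>C real)"
    and \<mu> :: "real \<Rightarrow> (real^'n) measure"
  assumes T_pos: "T > 0"
    and Q_periodic: "time_periodic T Q" and b_periodic: "time_periodic T b"
    and H1: "hyp_H1 Q b" and H2: "hyp_H2 Q" and H3: "hyp_H3 Q b"
    and evolution: "evolution_operator Q b G"
    and compact: "s < t \<Longrightarrow> compact_operator (G t s)"
    and measures: "evolution_system_of_measures G \<mu>" and \<mu>_periodic: "time_periodic T \<mu>"
begin

section \<open>Linearity, positivity and composition law of the evolution operator\<close>

lemma para_solution_G: "para_solution Q b s (\<lambda>t. apply_bcontfun (G t s \<phi>))"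
  using evolution unfolding evolution_operator_def bounded_classical_solution_def para_solution_def
  by blast

lemma G_refl [simp]: "G s s \<phi> = \<phi>"
  using evolution unfolding evolution_operator_def bounded_classical_solution_def
  by (intro bcontfun_eqI) blast

text \<open>The source of the identities for \<open>G\<close> that follow: linearity, the action on
  constants, the composition law and periodicity all come from exhibiting a solution with the right
  initial value.\<close>

lemma G_unique:
  assumes "para_solution Q b s u" "\<And>x. u s x = apply_bcontfun \<phi> x" "s \<le> t"
  shows "apply_bcontfun (G t s \<phi>) x = u t x"
  by (rule para_solution_unique[OF H2 H3 para_solution_G assms(1) _ assms(3)]) (simp add: assms(2))

lemma G_add: "s \<le> t \<Longrightarrow> G t s (\<phi> + \<psi>) = G t s \<phi> + G t s \<psi>"
  by (rule bcontfun_eqI, subst G_unique[OF para_solution_add_cmult[OF para_solution_G para_solution_G, of s \<phi> 1 \<psi>]]) auto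

lemma G_scaleR: "s \<le> t \<Longrightarrow> G t s (c *\<^sub>R \<phi>) = c *\<^sub>R G t s \<phi>"
  by (rule bcontfun_eqI, subst G_unique[OF para_solution_add_cmult[OF para_solution_const[of _ _ _ 0] para_solution_G, of s c \<phi>]]) auto

lemma G_diff: "s \<le> t \<Longrightarrow> G t s (\<phi> - \<psi>) = G t s \<phi> - G t s \<psi>"
  using G_add[of s t \<phi> "(- 1) *\<^sub>R \<psi>"] G_scaleR[of s t "- 1" \<psi>] by simp

lemma G_const: "s \<le> t \<Longrightarrow> G t s (const_bcontfun c) = const_bcontfun c"
  by (rule bcontfun_eqI, subst G_unique[OF para_solution_const[of _ _ _ c]]) auto

lemma G_nonneg:
  assumes "s \<le> t" "\<And>x. 0 \<le> apply_bcontfun \<phi> x"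
  shows "0 \<le> apply_bcontfun (G t s \<phi>) x"
  by (rule maximum_principle[OF H2 H3 para_solution_G _ assms(1)]) (simp add: assms(2))

lemma G_mono:
  assumes "s \<le> t" "\<And>x. apply_bcontfun \<phi> x \<le> apply_bcontfun \<psi> x"
  shows "apply_bcontfun (G t s \<phi>) x \<le> apply_bcontfun (G t s \<psi>) x"
  using G_nonneg[OF assms(1), of "\<psi> - \<phi>" x] assms by (simp add: G_diff)

lemma G_contraction:
  assumes "s \<le> t" shows "norm (G t s \<phi>) \<le> norm \<phi>"
proof (rule norm_bcontfun_leI)
  fix x
  have "apply_bcontfun (G t s \<phi>) x \<le> apply_bcontfun (G t s (const_bcontfun (norm \<phi>))) x"
    by (rule G_mono[OF assms]) (use abs_bcontfun_le[of \<phi>] in \<open>simp add: abs_le_iff\<close>)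
  moreover have "apply_bcontfun (G t s (const_bcontfun (- norm \<phi>))) x \<le> apply_bcontfun (G t s \<phi>) x"
    by (rule G_mono[OF assms]) (use abs_bcontfun_le[of \<phi>] in \<open>simp add: abs_le_iff minus_le_iff\<close>)
  ultimately show "\<bar>apply_bcontfun (G t s \<phi>) x\<bar> \<le> norm \<phi>"
    using assms by (simp add: G_const abs_le_iff)
qed

lemma bounded_linear_G: "s \<le> t \<Longrightarrow> bounded_linear (G t s)"
  by (rule bounded_linear_intro[where K = 1]) (auto simp: G_add G_scaleR G_contraction)

lemma G_pos:
  assumes "s < t" "\<And>x. 0 \<le> apply_bcontfun \<phi> x" "0 < apply_bcontfun \<phi> x0"
  shows "0 < apply_bcontfun (G t s \<phi>) x"
  by (rule strict_positivity[where v = "\<lambda>t. apply_bcontfun (G t s \<phi>)" and s = s and ?x0.0 = x0, OF H1 H2 para_solution_G])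
     (use assms in \<open>auto intro: G_nonneg\<close>)

lemma G_compose:
  assumes "s \<le> r" "r \<le> t" shows "G t r (G r s \<phi>) = G t s \<phi>"
  by (rule bcontfun_eqI, rule G_unique[OF para_solution_mono[OF para_solution_G assms(1)]]) (auto simp: assms)

text \<open>A solution started at \<open>s + T\<close> and shifted back by one period solves the
  equation from \<open>s\<close>, because the coefficients repeat.\<close>

lemma G_periodic:
  assumes "s \<le> t" shows "G (t + T) (s + T) = G t s"
proof (rule ext)
  fix \<phi>
  let ?u = "\<lambda>t x. apply_bcontfun (G (t + T) (s + T) \<phi>) x"
  have u: "para_solution Q b (s + T) (\<lambda>t x. apply_bcontfun (G t (s + T) \<phi>) x)" by (rule para_solution_G)
  have "para_solution Q b s ?u"
    unfolding para_solution_def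
  proof (intro conjI allI impI)
    show "bounded ((\<lambda>(t, x). ?u t x) ` ({s..} \<times> UNIV))"
      using u unfolding para_solution_def
      by (elim conjE, elim bounded_subset) (force simp: image_iff)
    have "continuous_on ({s + T..} \<times> UNIV) (\<lambda>p. apply_bcontfun (G (fst p) (s + T) \<phi>) (snd p))"
      using u by (simp add: para_solution_def case_prod_beta)
    then have "continuous_on ({s..} \<times> UNIV)
        (\<lambda>q. (\<lambda>p. apply_bcontfun (G (fst p) (s + T) \<phi>) (snd p)) (fst q + T, snd q))"
      by (rule continuous_on_compose2) (auto intro!: continuous_intros)
    then show "continuous_on ({s..} \<times> UNIV) (\<lambda>(t, x). ?u t x)"
      by (simp add: case_prod_beta)
    fix t assume t: "s < t"
    then show "C2_fun (?u t)" using u by (auto simp: para_solution_def)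
    have "Q (t + T) = Q t" "b (t + T) = b t" using Q_periodic b_periodic by (auto simp: time_periodic_def)
    then have "elliptic_op Q b (t + T) f x = elliptic_op Q b t f x" for f x
      by (simp add: elliptic_op_def)
    then show "((\<lambda>\<tau>. ?u \<tau> x) has_real_derivative elliptic_op Q b t (?u t) x) (at t)" for x
      using u t unfolding para_solution_def
      by (subst DERIV_shift[of "\<lambda>\<tau>. apply_bcontfun (G \<tau> (s + T) \<phi>) x", symmetric]) (metis add_less_cancel_right)
  qed
  then show "G (t + T) (s + T) \<phi> = G t s \<phi>"
    by (intro bcontfun_eqI, subst (2) G_unique) (auto simp: assms)
qed

lemma G_periodic_nat:
  assumes "s \<le> t" shows "G (t + of_nat n * T) (s + of_nat n * T) = G t s"
proof (induction n)
  case (Suc n)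
  have "G (t + of_nat n * T + T) (s + of_nat n * T + T) = G (t + of_nat n * T) (s + of_nat n * T)"
    by (rule G_periodic) (use assms in simp)
  then show ?case using Suc by (simp add: algebra_simps)
qed simp

lemma C2_fun_G: "s < t \<Longrightarrow> C2_fun (apply_bcontfun (G t s \<phi>))"
  using para_solution_G[of s \<phi>] by (auto simp: para_solution_def)

section \<open>Integration against the evolution system of measures\<close>

lemma prob_space_\<mu>: "prob_space (\<mu> s)" and sets_\<mu> [simp, measurable_cong]: "sets (\<mu> s) = sets borel"
  using measures by (auto simp: evolution_system_of_measures_def)

lemma space_\<mu> [simp]: "space (\<mu> s) = UNIV"
  using sets_eq_imp_space_eq[OF sets_\<mu>] by simp

lemma integral_G: "s \<le> t \<Longrightarrow> (\<integral>x. apply_bcontfun (G t s \<phi>) x \<partial>\<mu> t) = (\<integral>x. apply_bcontfun \<phi> x \<partial>\<mu> s)"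
  using measures unfolding evolution_system_of_measures_def by (cases "s = t") auto

lemma measurable_bcontfun [measurable]: "apply_bcontfun (\<phi> :: (real^'n) \<Rightarrow>\<^sub>C real) \<in> borel_measurable borel"
  by (intro borel_measurable_continuous_onI) simp

lemma integrable_bcontfun [simp, intro]:
  fixes \<phi> :: "(real^'n) \<Rightarrow>\<^sub>C real"
  shows "integrable (\<mu> s) (apply_bcontfun \<phi>)"
proof -
  interpret prob_space "\<mu> s" by (rule prob_space_\<mu>)
  show ?thesis
    by (rule finite_measure.integrable_const_bound[where B = "norm \<phi>"])
       (auto simp: abs_bcontfun_le intro: finite_measure_axioms)
qed

lemma \<mu>_not_AE_False: "\<not> (AE x in \<mu> s. False)"
proof -
  interpret prob_space "\<mu> s" by (rule prob_space_\<mu>)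
  show ?thesis by simp
qed

lemma integral_pos_of_pos:
  fixes \<phi> :: "(real^'n) \<Rightarrow>\<^sub>C real"
  assumes "\<And>x. 0 < apply_bcontfun \<phi> x"
  shows "0 < (\<integral>x. apply_bcontfun \<phi> x \<partial>\<mu> s)"
proof -
  have ne: "(\<integral>x. apply_bcontfun \<phi> x \<partial>\<mu> s) \<noteq> 0"
  proof
    assume "(\<integral>x. apply_bcontfun \<phi> x \<partial>\<mu> s) = 0"
    then have "AE x in \<mu> s. apply_bcontfun \<phi> x = 0"
      using assms by (subst (asm) integral_nonneg_eq_0_iff_AE) (auto intro: less_imp_le)
    then have "AE x in \<mu> s. False" by eventually_elim (metis assms less_irrefl)
    then show False using \<mu>_not_AE_False by blast
  qed
  moreover have "0 \<le> (\<integral>x. apply_bcontfun \<phi> x \<partial>\<mu> s)" using assms by (intro Bochner_Integration.integral_nonneg) (auto intro: less_imp_le)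
  ultimately show ?thesis by simp
qed

text \<open>This says that every \<open>\<mu> s\<close> has full support: evolving for one time unit
  makes the function positive everywhere and leaves the integral unchanged.\<close>

lemma integral_pos:
  fixes \<phi> :: "(real^'n) \<Rightarrow>\<^sub>C real"
  assumes "\<And>x. 0 \<le> apply_bcontfun \<phi> x" "0 < apply_bcontfun \<phi> x0"
  shows "0 < (\<integral>x. apply_bcontfun \<phi> x \<partial>\<mu> s)"
  using integral_pos_of_pos[of "G (s + 1) s \<phi>" "s + 1"] G_pos[of s "s + 1", OF _ assms] integral_G[of s "s + 1" \<phi>]
  by simp

definition mean :: "real \<Rightarrow> ((real^'n) \<Rightarrow>\<^sub>C real) \<Rightarrow> real" where
  "mean s \<phi> = (\<integral>x. apply_bcontfun \<phi> x \<partial>\<mu> s)"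

lemma mean_add: "mean s (\<phi> + \<psi>) = mean s \<phi> + mean s \<psi>"
  and mean_diff: "mean s (\<phi> - \<psi>) = mean s \<phi> - mean s \<psi>"
  and mean_scaleR: "mean s (c *\<^sub>R \<phi>) = c * mean s \<phi>"
  by (simp_all add: mean_def)

lemma mean_const [simp]: "mean s (const_bcontfun c) = c"
proof -
  interpret prob_space "\<mu> s" by (rule prob_space_\<mu>)
  show ?thesis by (simp add: mean_def prob_space[unfolded space_\<mu>])
qed

lemma mean_G: "s \<le> t \<Longrightarrow> mean t (G t s \<phi>) = mean s \<phi>"
  by (simp add: mean_def integral_G)

lemma mean_periodic: "mean (s + T) = mean s"
  using \<mu>_periodic by (simp add: mean_def time_periodic_def fun_eq_iff)

lemma mean_mono: "(\<And>x. apply_bcontfun \<phi> x \<le> apply_bcontfun \<psi> x) \<Longrightarrow> mean s \<phi> \<le> mean s \<psi>"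
  unfolding mean_def by (intro integral_mono) auto

lemma abs_mean_le: "\<bar>mean s \<phi>\<bar> \<le> norm \<phi>"
  using mean_mono[of \<phi> "const_bcontfun (norm \<phi>)" s] mean_mono[of "const_bcontfun (- norm \<phi>)" \<phi> s]
    abs_bcontfun_le[of \<phi>] by (auto simp: abs_le_iff minus_le_iff)

end

section \<open>Compact operators\<close>

lemma compact_operator_subsequence:
  fixes x :: "nat \<Rightarrow> 'a::real_normed_vector"
  assumes "compact_operator K" "bounded (range x)"
  obtains l r where "strict_mono (r :: nat \<Rightarrow> nat)" "(\<lambda>n. K (x (r n))) \<longlonglongrightarrow> l"
proof -
  have "seq_compact (closure (K ` range x))"
    using assms unfolding compact_operator_def by (intro compact_imp_seq_compact) blast
  moreover have "\<forall>n. K (x n) \<in> closure (K ` range x)"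
    using closure_subset[of "K ` range x"] by blast
  ultimately show thesis
    using that by (elim seq_compactE) (auto simp: comp_def)
qed

lemma compact_operator_comp_bounded_linear:
  assumes A: "bounded_linear A" and K: "compact_operator K"
  shows "compact_operator (\<lambda>x. A (K x))"
  unfolding compact_operator_def
proof (intro allI impI)
  fix S :: "'c set" assume "bounded S"
  then have "compact (A ` closure (K ` S))"
    using K A by (intro compact_continuous_image linear_continuous_on) (auto simp: compact_operator_def)
  moreover have "closure ((\<lambda>x. A (K x)) ` S) \<subseteq> A ` closure (K ` S)"
    using calculation closure_subset[of "K ` S"] by (intro closure_minimal compact_imp_closed) auto
  ultimately show "compact (closure ((\<lambda>x. A (K x)) ` S))"
    by (metis closed_closure compact_Int_closed inf.absorb_iff2)
qed

text \<open>Riesz's argument for \<open>A = 1 - K\<close>. The lower bound makes the ranges of the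
  powers of \<open>A\<close> closed and, once \<open>A\<close> misses a point, strictly decreasing.
  Unit vectors chosen in each range at distance at least 1/2 from the next have images under
  \<open>K\<close> that stay 1/2 apart, which compactness forbids.\<close>

theorem fredholm_surj:
  fixes K :: "'a::banach \<Rightarrow> 'a"
  assumes K: "bounded_linear K" and cpt: "compact_operator K"
    and c: "c > 0" "\<And>x. c * norm x \<le> norm (x - K x)"
  shows "surj (\<lambda>x. x - K x)"
proof (rule ccontr)
  define A where "A = (\<lambda>x. x - K x)"
  assume "\<not> surj (\<lambda>x. x - K x)"
  then obtain y0 where y0: "y0 \<notin> range A" by (auto simp: A_def)
  have A: "bounded_linear A" unfolding A_def by (intro bounded_linear_sub bounded_linear_ident K)
  have An: "bounded_linear (A ^^ n) \<and> (\<forall>x. c ^ n * norm x \<le> norm ((A ^^ n) x))" for n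
  proof (induction n)
    case (Suc n)
    have "bounded_linear (\<lambda>x. A ((A ^^ n) x))"
      using bounded_linear_compose[OF A] Suc by blast
    moreover have "c ^ Suc n * norm x \<le> norm (A ((A ^^ n) x))" for x
    proof -
      have "c * (c ^ n * norm x) \<le> c * norm ((A ^^ n) x)" using Suc c by (intro mult_left_mono) auto
      also have "\<dots> \<le> norm (A ((A ^^ n) x))" using c(2) by (simp add: A_def)
      finally show ?thesis by simp
    qed
    ultimately show ?case by (simp add: comp_def)
  qed (simp add: bounded_linear_ident id_def)
  define M where "M n = range (A ^^ n)" for n
  have subM: "subspace (M n)" for n
    unfolding M_def using An[of n] by (intro linear_subspace_image subspace_UNIV) (auto simp: bounded_linear.linear)
  have closedM: "closed (M n)" for n
    unfolding M_def using An[of n] c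
    by (intro complete_imp_closed complete_isometric_image[where e = "c ^ n"]) (auto simp: complete_UNIV)
  have M_anti: "M n \<subseteq> M m" if "m \<le> n" for m n
    using that by (induction n rule: dec_induct) (auto simp: M_def funpow_Suc_right simp del: funpow.simps)
  have A_M: "A x \<in> M (Suc n)" if "x \<in> M n" for x n using that by (auto simp: M_def)
  have injAn: "(A ^^ n) x = (A ^^ n) y \<Longrightarrow> x = y" for n x y
  proof -
    assume eq: "(A ^^ n) x = (A ^^ n) y"
    interpret An: bounded_linear "A ^^ n" using An by blast
    have "c ^ n * norm (x - y) \<le> 0" using An[of n] eq by (metis An.diff norm_zero right_minus_eq)
    then show "x = y" using zero_less_power[OF c(1), of n] by (simp add: mult_le_0_iff)
  qed
  have "\<exists>x. x \<in> M n \<and> norm x = 1 \<and> (\<forall>w\<in>M (Suc n). 1 / 2 \<le> norm (x - w))" for n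
  proof -
    \<comment> \<open>If this vector lay in the next range, injectivity of \<open>A ^^ n\<close>
      would put \<open>y0\<close> into the range of \<open>A\<close>.\<close>
    define u where "u = (A ^^ n) y0"
    have u: "u \<in> M n" by (auto simp: u_def M_def)
    have "u \<notin> M (Suc n)"
      using y0 injAn[of n] by (auto simp: u_def M_def funpow_Suc_right simp del: funpow.simps)
    moreover have ne: "M (Suc n) \<noteq> {}" by (auto simp: M_def)
    ultimately have d: "infdist u (M (Suc n)) > 0"
      using in_closed_iff_infdist_zero[OF closedM ne] infdist_nonneg[of u "M (Suc n)"] by force
    then have "Inf (dist u ` M (Suc n)) < 2 * infdist u (M (Suc n))"
      using ne by (simp add: infdist_notempty)
    \<comment> \<open>Being within twice the distance to the subspace is what leaves distance 1/2
      after \<open>u - w\<close> has been normalised.\<close>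
    then obtain w where w: "w \<in> M (Suc n)" "dist u w < 2 * infdist u (M (Suc n))"
      using cInf_lessD[of "dist u ` M (Suc n)"] ne by blast
    define q where "q = norm (u - w)"
    have q: "q > 0" using w(1) \<open>u \<notin> M (Suc n)\<close> by (auto simp: q_def)
    define x where "x = (1 / q) *\<^sub>R (u - w)"
    have "x \<in> M n" unfolding x_def
      using u w(1) M_anti[of n "Suc n"] subM[of n] by (intro subspace_scale subspace_diff) auto
    moreover have "norm x = 1" using q by (simp add: x_def q_def)
    moreover have "1 / 2 \<le> norm (x - v)" if "v \<in> M (Suc n)" for v
    proof -
      have "w + q *\<^sub>R v \<in> M (Suc n)" using w(1) that subM by (intro subspace_add subspace_scale) auto
      then have "infdist u (M (Suc n)) \<le> norm (u - (w + q *\<^sub>R v))"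
        using infdist_le by (metis dist_norm)
      also have "u - (w + q *\<^sub>R v) = q *\<^sub>R (x - v)" using q by (simp add: x_def algebra_simps)
      finally have "infdist u (M (Suc n)) \<le> q * norm (x - v)" using q by simp
      moreover have "q < 2 * infdist u (M (Suc n))" using w(2) by (simp add: q_def dist_norm)
      ultimately have "q * (1 / 2) < q * norm (x - v)" by simp
      then show ?thesis using q by simp
    qed
    ultimately show ?thesis by blast
  qed
  then obtain x where x: "\<And>n. x n \<in> M n" "\<And>n. norm (x n) = 1"
      "\<And>n w. w \<in> M (Suc n) \<Longrightarrow> 1 / 2 \<le> norm (x n - w)" by metis
  have sep: "1 / 2 \<le> norm (K (x n) - K (x m))" if "n < m" for n m
  proof -
    \<comment> \<open>The difference \<open>K (x n) - K (x m)\<close> is \<open>x n\<close> minus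
      this vector, which belongs to the next smaller range because \<open>n < m\<close>.\<close>
    have "A (x n) + x m - A (x m) \<in> M (Suc n)"
      using A_M[OF x(1)[of n]] A_M[OF x(1)[of m]] x(1)[of m] that
        M_anti[of "Suc n" m] M_anti[of "Suc n" "Suc m"] subM[of "Suc n"]
      by (intro subspace_diff subspace_add) auto
    from x(3)[OF this] show ?thesis by (simp add: A_def algebra_simps)
  qed
  have "bounded (range x)" using x(2) by (auto simp: bounded_iff)
  then obtain l r where r: "strict_mono r" "(\<lambda>n. K (x (r n))) \<longlonglongrightarrow> l"
    using compact_operator_subsequence[OF cpt] by blast
  then have "Cauchy (\<lambda>n. K (x (r n)))" by (intro LIMSEQ_imp_Cauchy)
  then obtain N where N: "\<And>m n. m \<ge> N \<Longrightarrow> n \<ge> N \<Longrightarrow> norm (K (x (r m)) - K (x (r n))) < 1 / 2"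
    using CauchyD[of _ "1 / 2"] by force
  have "r N < r (Suc N)" using r(1) by (simp add: strict_mono_Suc_iff)
  then show False using sep N[of N "Suc N"] by fastforce
qed

section \<open>Complexification and the Fredholm alternative\<close>

text \<open>Pairs are only a real normed space for the type system; bounded bilinearity supplies the
  algebraic and limit rules for multiplication by complex scalars.\<close>

lemma bounded_bilinear_complex_scale:
  "bounded_bilinear (complex_scale :: complex \<Rightarrow> 'a::real_normed_vector \<times> 'a \<Rightarrow> _)"
proof
  show "\<exists>K. \<forall>c (z :: 'a \<times> 'a). norm (complex_scale c z) \<le> norm c * norm z * K"
  proof (intro exI allI)
    fix c and z :: "'a \<times> 'a"
    obtain x y where z: "z = (x, y)" by (cases z)
    have xy: "norm x \<le> norm z" "norm y \<le> norm z"
      by (simp_all add: z norm_fst_le norm_snd_le)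
    have *: "norm (a *\<^sub>R u) \<le> cmod c * norm z" if "\<bar>a\<bar> \<le> cmod c" "norm u \<le> norm z" for a and u :: 'a
      using mult_mono[OF that] by simp
    have "norm (complex_scale c z) \<le> norm (Re c *\<^sub>R x - Im c *\<^sub>R y) + norm (Re c *\<^sub>R y + Im c *\<^sub>R x)"
      unfolding complex_scale_def z by (simp add: norm_Pair_le)
    also have "\<dots> \<le> (norm (Re c *\<^sub>R x) + norm (Im c *\<^sub>R y)) + (norm (Re c *\<^sub>R y) + norm (Im c *\<^sub>R x))"
      by (intro add_mono norm_triangle_ineq norm_triangle_ineq4)
    also have "\<dots> \<le> (cmod c * norm z + cmod c * norm z) + (cmod c * norm z + cmod c * norm z)"
      by (intro add_mono * xy abs_Re_le_cmod abs_Im_le_cmod)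
    finally show "norm (complex_scale c z) \<le> norm c * norm z * 4" by simp
  qed
qed (auto simp: complex_scale_def algebra_simps split: prod.splits)

lemma complex_scale_scale: "complex_scale a (complex_scale c z) = complex_scale (a * c) z"
  by (cases z) (simp add: complex_scale_def algebra_simps)

lemma complex_scale_1 [simp]: "complex_scale 1 z = z"
  by (cases z) (simp add: complex_scale_def)

interpretation complex_scale: bounded_bilinear
  "complex_scale :: complex \<Rightarrow> 'a::real_normed_vector \<times> 'a \<Rightarrow> 'a \<times> 'a"
  by (rule bounded_bilinear_complex_scale)

lemma complexified_scale:
  assumes "linear N" shows "complexified N (complex_scale c z) = complex_scale c (complexified N z)"
proof -
  interpret linear N by (rule assms)
  show ?thesis by (cases z) (simp add: complex_scale_def complexified_def add diff scaleR)
qed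

lemma bounded_linear_complexified:
  assumes "bounded_linear N" shows "bounded_linear (complexified N)"
  unfolding complexified_def case_prod_beta
  by (intro bounded_linear_Pair bounded_linear_compose[OF assms] bounded_linear_fst bounded_linear_snd)

lemma compact_operator_complexified:
  assumes "compact_operator N" shows "compact_operator (complexified N)"
  unfolding compact_operator_def
proof (intro allI impI)
  fix S :: "('a \<times> 'a) set" assume S: "bounded S"
  let ?C = "closure (N ` fst ` S) \<times> closure (N ` snd ` S)"
  have "compact ?C"
    using assms bounded_fst[OF S] bounded_snd[OF S] by (intro compact_Times) (auto simp: compact_operator_def)
  moreover have "closure (complexified N ` S) \<subseteq> ?C"
    using closure_subset[of "N ` fst ` S"] closure_subset[of "N ` snd ` S"]
    by (intro closure_minimal closed_Times closed_closure) (force simp: complexified_def)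
  ultimately show "compact (closure (complexified N ` S))"
    by (metis closed_closure compact_Int_closed inf.absorb_iff2)
qed

text \<open>Invertibility of \<open>1 - \<zeta> N\<close> is studied instead of that of \<open>\<lambda> - N\<close>, since it is
  this family that is holomorphic near \<open>0\<close>.\<close>

lemma resolvent_bounded_below:
  fixes N :: "'a::real_normed_vector \<Rightarrow> 'a"
  assumes N: "bounded_linear N" "compact_operator N" and Z: "compact Z"
    and inj: "\<And>\<zeta> f. \<zeta> \<in> Z \<Longrightarrow> f = complex_scale \<zeta> (complexified N f) \<Longrightarrow> f = 0"
  shows "\<exists>c>0. \<forall>\<zeta>\<in>Z. \<forall>f. c * norm f \<le> norm (f - complex_scale \<zeta> (complexified N f))"
proof (rule ccontr)
  interpret N: bounded_linear "complexified N" by (rule bounded_linear_complexified[OF N(1)])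
  assume "\<not> ?thesis"
  then have ex: "\<exists>\<zeta> f. \<zeta> \<in> Z \<and> norm (f - complex_scale \<zeta> (complexified N f)) < c * norm f" if "c > 0" for c
    using that by (meson not_le)
  have "\<exists>\<zeta> f. \<zeta> \<in> Z \<and> norm f = 1 \<and> norm (f - complex_scale \<zeta> (complexified N f)) < 1 / real (Suc n)" for n
  proof -
    obtain \<zeta> f where f: "\<zeta> \<in> Z" "norm (f - complex_scale \<zeta> (complexified N f)) < 1 / real (Suc n) * norm f"
      using ex[of "1 / real (Suc n)"] by auto
    then have f0: "norm f > 0" by (metis mult_zero_right norm_ge_zero not_less zero_less_norm_iff norm_zero)
    define g where "g = (1 / norm f) *\<^sub>R f"
    have "g - complex_scale \<zeta> (complexified N g) = (1 / norm f) *\<^sub>R (f - complex_scale \<zeta> (complexified N f))"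
      unfolding g_def by (simp add: N.scaleR complex_scale.scaleR_right scaleR_diff_right)
    then have "norm (g - complex_scale \<zeta> (complexified N g))
        = (1 / norm f) * norm (f - complex_scale \<zeta> (complexified N f))" by simp
    also have "\<dots> < 1 / real (Suc n)" using f(2) f0 by (simp add: field_simps)
    finally have "norm (g - complex_scale \<zeta> (complexified N g)) < 1 / real (Suc n)" .
    moreover have "norm g = 1" using f0 by (simp add: g_def)
    ultimately show ?thesis using f(1) by blast
  qed
  then obtain \<zeta> f where f: "\<And>n. \<zeta> n \<in> Z" "\<And>n. norm (f n) = 1"
      "\<And>n. norm (f n - complex_scale (\<zeta> n) (complexified N (f n))) < 1 / real (Suc n)" by metis
  \<comment> \<open>Two extractions: the parameters converge to \<open>\<zeta>0\<close> in the
    compact set \<open>Z\<close>, then the images under \<open>N\<close> converge to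
    \<open>l\<close>. The unit vectors therefore converge to \<open>\<zeta>0\<close> times
    \<open>l\<close>, which is fixed by \<open>\<zeta>0\<close> times \<open>N\<close> and so
    contradicts \<open>inj\<close>.\<close>
  obtain \<zeta>0 r1 where r1: "\<zeta>0 \<in> Z" "strict_mono r1" "(\<zeta> \<circ> r1) \<longlonglongrightarrow> \<zeta>0"
    using Z f(1) by (metis compact_imp_seq_compact seq_compactE)
  have "bounded (range (f \<circ> r1))" using f(2) by (auto simp: bounded_iff)
  then obtain l r2 where r2: "strict_mono r2" "(\<lambda>n. complexified N ((f \<circ> r1) (r2 n))) \<longlonglongrightarrow> l"
    using compact_operator_subsequence[OF compact_operator_complexified[OF N(2)]] by blast
  define r where "r = r1 \<circ> r2"
  have r: "strict_mono r" using r1(2) r2(1) by (simp add: r_def strict_mono_o)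
  have Nl: "(\<lambda>n. complexified N (f (r n))) \<longlonglongrightarrow> l" using r2(2) by (simp add: r_def)
  have \<zeta>l: "(\<lambda>n. \<zeta> (r n)) \<longlonglongrightarrow> \<zeta>0"
    using LIMSEQ_subseq_LIMSEQ[OF r1(3) r2(1)] by (simp add: r_def comp_def)
  have "(\<lambda>n. f n - complex_scale (\<zeta> n) (complexified N (f n))) \<longlonglongrightarrow> 0"
    by (rule tendsto_norm_zero_cancel, rule real_tendsto_sandwich[OF _ _ tendsto_const LIMSEQ_inverse_real_of_nat])
       (use f(3) in \<open>auto intro!: eventuallyI less_imp_le simp: inverse_eq_divide\<close>)
  from LIMSEQ_subseq_LIMSEQ[OF this r]
  have "(\<lambda>n. f (r n) - complex_scale (\<zeta> (r n)) (complexified N (f (r n)))) \<longlonglongrightarrow> 0" by (simp add: comp_def)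
  from tendsto_add[OF this complex_scale.tendsto[OF \<zeta>l Nl]]
  have fl: "(\<lambda>n. f (r n)) \<longlonglongrightarrow> complex_scale \<zeta>0 l" by simp
  then have "(\<lambda>n. complexified N (f (r n))) \<longlonglongrightarrow> complexified N (complex_scale \<zeta>0 l)" by (rule N.tendsto)
  then have "l = complexified N (complex_scale \<zeta>0 l)" using Nl LIMSEQ_unique by blast
  then have "complex_scale \<zeta>0 l = 0" using inj[OF r1(1)] by metis
  moreover have "norm (complex_scale \<zeta>0 l) = 1"
    using tendsto_norm[OF fl] f(2) by (simp add: LIMSEQ_const_iff)
  ultimately show False by simp
qed

lemma resolvent_surj:
  fixes N :: "'a::banach \<Rightarrow> 'a"
  assumes N: "bounded_linear N" "compact_operator N"
    and "c > 0" "\<And>f. c * norm f \<le> norm (f - complex_scale \<zeta> (complexified N f))"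
  shows "surj (\<lambda>f. f - complex_scale \<zeta> (complexified N f))"
  by (rule fredholm_surj[OF _ _ assms(3,4)])
     (rule bounded_linear_compose[OF complex_scale.bounded_linear_right bounded_linear_complexified[OF N(1)]]
       compact_operator_comp_bounded_linear[OF complex_scale.bounded_linear_right compact_operator_complexified[OF N(2)]])+

text \<open>If \<open>c\<close> were no eigenvalue, \<open>1 - N / c\<close> would be injective,
  hence bounded below by compactness, hence onto; the lower bound turns its inverse into a bounded
  one, and \<open>c\<close> would lie outside the spectrum.\<close>

lemma op_spectrum_eigenvector:
  fixes N :: "'a::banach \<Rightarrow> 'a"
  assumes N: "bounded_linear N" "compact_operator N" and c: "c \<in> op_spectrum N" "c \<noteq> 0"
  shows "\<exists>f. f \<noteq> 0 \<and> complexified N f = complex_scale c f"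
proof (rule ccontr)
  assume "\<not> ?thesis"
  then have none: "f = 0" if "complexified N f = complex_scale c f" for f using that by blast
  define \<zeta> where "\<zeta> = 1 / c"
  have \<zeta>: "\<zeta> * c = 1" "c * \<zeta> = 1" using c by (auto simp: \<zeta>_def)
  have inj: "f = 0" if "f = complex_scale \<zeta> (complexified N f)" for f
    using arg_cong[OF that, of "complex_scale c"] by (intro none) (simp add: complex_scale_scale \<zeta>)
  obtain e where e: "e > 0" "\<And>f. e * norm f \<le> norm (f - complex_scale \<zeta> (complexified N f))"
    using resolvent_bounded_below[OF N, of "{\<zeta>}"] inj by (metis finite.emptyI finite_insert finite_imp_compact singletonD singletonI)
  let ?L = "\<lambda>f. f - complex_scale \<zeta> (complexified N f)"
  have surjL: "surj ?L" using resolvent_surj[OF N e] .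
  interpret N: bounded_linear "complexified N" by (rule bounded_linear_complexified[OF N(1)])
  interpret L: bounded_linear ?L
    by (rule bounded_linear_sub[OF bounded_linear_ident
          bounded_linear_compose[OF complex_scale.bounded_linear_right N.bounded_linear_axioms]])
  have injL: "inj ?L"
  proof (rule injI)
    fix x y assume "?L x = ?L y"
    then have "?L (x - y) = 0" by (simp add: L.diff)
    then have "e * norm (x - y) \<le> 0" using e(2)[of "x - y"] by simp
    then show "x = y" using e(1) by (simp add: mult_le_0_iff)
  qed
  define S where "S = inv ?L"
  have LS: "?L (S f) = f" and SL: "S (?L f) = f" for f
    unfolding S_def by (rule surj_f_inv_f[OF surjL], rule inv_f_f[OF injL])
  have "bounded_linear S"
  proof (rule bounded_linear_intro[where K = "1 / e"])
    show "S (x + y) = S x + S y" for x y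
      by (rule injD[OF injL]) (simp only: LS L.add)
    show "S (a *\<^sub>R x) = a *\<^sub>R S x" for a x
      by (rule injD[OF injL]) (simp only: LS L.scaleR)
    show "norm (S x) \<le> norm x * (1 / e)" for x
      using e(2)[of "S x"] e(1) by (simp only: LS) (simp add: field_simps)
  qed
  define B where "B = (\<lambda>f. S (complex_scale \<zeta> f))"
  have Leq: "complex_scale c z - complexified N z = complex_scale c (?L z)" for z
    by (simp add: complex_scale.diff_right complex_scale_scale \<zeta>)
  have "bounded_linear B" unfolding B_def
    by (rule bounded_linear_compose[OF \<open>bounded_linear S\<close> complex_scale.bounded_linear_right])
  moreover have "B \<circ> (\<lambda>z. complex_scale c z - complexified N z) = id"
    unfolding Leq by (rule ext) (simp add: B_def complex_scale_scale \<zeta> SL)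
  moreover have "(\<lambda>z. complex_scale c z - complexified N z) \<circ> B = id"
    unfolding Leq by (rule ext) (simp only: B_def comp_def LS complex_scale_scale \<zeta> complex_scale_1 id_apply)
  ultimately show False using c(1) unfolding op_spectrum_def by blast
qed

instance bcontfun :: (metric_space, banach) banach ..

text \<open>The operators \<open>N ^^ m\<close> are the Taylor coefficients of the inverse of
  \<open>1 - \<zeta> N\<close>, which is bounded by \<open>1 / c\<close> on the closed disc of
  radius \<open>R\<close>; Cauchy's estimate yields the factor \<open>(1 / R) ^ m\<close>.
  Holomorphy is needed for scalar functions only, because the sup norm is recovered from evaluations
  at points, with a bound uniform in the point.\<close>

theorem compact_operator_power_decay:
  fixes N :: "('a::metric_space \<Rightarrow>\<^sub>C real) \<Rightarrow> ('a \<Rightarrow>\<^sub>C real)"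
  assumes N: "bounded_linear N" "compact_operator N" and R: "R > 0"
    and inj: "\<And>\<zeta> f. cmod \<zeta> \<le> R \<Longrightarrow> f = complex_scale \<zeta> (complexified N f) \<Longrightarrow> f = 0"
  shows "\<exists>C. \<forall>m \<phi>. norm ((N ^^ m) \<phi>) \<le> C * (1 / R) ^ m * norm \<phi>"
proof -
  obtain c where c: "c > 0" "\<And>\<zeta> f. cmod \<zeta> \<le> R \<Longrightarrow> c * norm f \<le> norm (f - complex_scale \<zeta> (complexified N f))"
    using resolvent_bounded_below[OF N, of "cball 0 R"] inj by auto
  interpret N: bounded_linear "complexified N" by (rule bounded_linear_complexified[OF N(1)])
  define L where "L \<zeta> f = f - complex_scale \<zeta> (complexified N f)" for \<zeta> f
  have L: "bounded_linear (L \<zeta>)" for \<zeta>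
    unfolding L_def by (rule bounded_linear_sub[OF bounded_linear_ident
          bounded_linear_compose[OF complex_scale.bounded_linear_right N.bounded_linear_axioms]])
  have below: "c * norm f \<le> norm (L \<zeta> f)" if "cmod \<zeta> \<le> R" for \<zeta> f using c(2)[OF that] by (simp add: L_def)
  have injL: "f = g" if "cmod \<zeta> \<le> R" "L \<zeta> f = L \<zeta> g" for \<zeta> f g
  proof -
    have "c * norm (f - g) \<le> 0" using below[OF that(1), of "f - g"] that(2)
      by (simp add: bounded_linear.linear[OF L] linear_diff)
    then show ?thesis using c(1) by (simp add: mult_le_0_iff)
  qed
  define S where "S \<zeta> = inv (L \<zeta>)" for \<zeta>
  have LS: "L \<zeta> (S \<zeta> f) = f" if "cmod \<zeta> \<le> R" for \<zeta> f
    using resolvent_surj[OF N c(1) c(2)[OF that]] unfolding S_def L_def by (rule surj_f_inv_f)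
  have S_bound: "norm (S \<zeta> f) \<le> norm f / c" if "cmod \<zeta> \<le> R" for \<zeta> f
    using below[OF that, of "S \<zeta> f"] c(1) by (simp add: LS[OF that] field_simps)
  have S_add: "S \<zeta> (f + g) = S \<zeta> f + S \<zeta> g" if "cmod \<zeta> \<le> R" for \<zeta> f g
    by (rule injL[OF that]) (simp add: LS that linear_add[OF bounded_linear.linear[OF L]])
  have S_scale: "S \<zeta> (complex_scale a f) = complex_scale a (S \<zeta> f)" if "cmod \<zeta> \<le> R" for \<zeta> a f
  proof (rule injL[OF that])
    have "L \<zeta> (complex_scale a g) = complex_scale a (L \<zeta> g)" for g
      by (simp add: L_def complexified_scale[OF bounded_linear.linear[OF N(1)]] complex_scale_scale
          complex_scale.diff_right mult.commute)
    then show "L \<zeta> (S \<zeta> (complex_scale a f)) = L \<zeta> (complex_scale a (S \<zeta> f))" by (simp add: LS that)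
  qed
  \<comment> \<open>The resolvent identity serves twice: it rewrites the difference quotient in
    \<open>\<zeta>\<close>, and applied once more it gives the convergence of that quotient.\<close>
  have resolvent: "S \<zeta>' f - S \<zeta> f = complex_scale (\<zeta>' - \<zeta>) (S \<zeta>' (complexified N (S \<zeta> f)))"
    if "cmod \<zeta> \<le> R" "cmod \<zeta>' \<le> R" for \<zeta> \<zeta>' f
  proof (rule injL[OF that(2)])
    have "L \<zeta>' (S \<zeta>' f - S \<zeta> f) = f - L \<zeta>' (S \<zeta> f)"
      using linear_diff[OF bounded_linear.linear[OF L]] LS that by simp
    also have "L \<zeta>' (S \<zeta> f) = L \<zeta> (S \<zeta> f) - complex_scale (\<zeta>' - \<zeta>) (complexified N (S \<zeta> f))"
      by (simp add: L_def complex_scale.diff_left)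
    finally show "L \<zeta>' (S \<zeta>' f - S \<zeta> f)
        = L \<zeta>' (complex_scale (\<zeta>' - \<zeta>) (S \<zeta>' (complexified N (S \<zeta> f))))"
      using that by (simp add: LS S_scale[symmetric])
  qed
  define ev where "ev x f = Complex (apply_bcontfun (fst f) x) (apply_bcontfun (snd f) x)"
    for x :: 'a and f :: "('a \<Rightarrow>\<^sub>C real) \<times> ('a \<Rightarrow>\<^sub>C real)"
  have ev_add: "ev x (f + g) = ev x f + ev x g" and ev_diff: "ev x (f - g) = ev x f - ev x g"
    for x f g by (simp_all add: ev_def complex_eq_iff)
  have ev_scale: "ev x (complex_scale a f) = a * ev x f" for x a f
    by (cases f) (simp add: ev_def complex_scale_def complex_eq_iff)
  have ev_bound: "cmod (ev x f) \<le> norm f" for x f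
  proof -
    have "(apply_bcontfun g x)\<^sup>2 \<le> (norm g)\<^sup>2" for g :: "'a \<Rightarrow>\<^sub>C real"
      using abs_bcontfun_le[of g x] by (metis abs_ge_zero power2_abs power_mono)
    then show ?thesis by (auto simp: ev_def cmod_def norm_prod_def intro!: real_sqrt_le_mono add_mono)
  qed
  define g where "g x f \<zeta> = ev x (S \<zeta> f)" for x f \<zeta>
  \<comment> \<open>Differentiating relative to the closed disc gives, besides holomorphy inside,
    the continuity up to the circle that Cauchy's estimate uses.\<close>
  have g_deriv: "(g x f has_field_derivative ev x (S \<zeta> (complexified N (S \<zeta> f)))) (at \<zeta> within cball 0 R)"
    if \<zeta>: "cmod \<zeta> \<le> R" for x f \<zeta>
    unfolding has_field_derivative_iff
  proof (rule Lim_transform_within)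
    define h where "h = complexified N (S \<zeta> f)"
    have bd: "cmod (ev x (S \<zeta>' h) - ev x (S \<zeta> h)) \<le> cmod (\<zeta>' - \<zeta>) * (norm (complexified N (S \<zeta> h)) / c)"
      if \<zeta>': "cmod \<zeta>' \<le> R" for \<zeta>'
    proof -
      have "cmod (ev x (S \<zeta>' h) - ev x (S \<zeta> h)) = cmod (\<zeta>' - \<zeta>) * cmod (ev x (S \<zeta>' (complexified N (S \<zeta> h))))"
        by (simp add: ev_diff[symmetric] resolvent[OF \<zeta> \<zeta>'] ev_scale norm_mult)
      also have "\<dots> \<le> cmod (\<zeta>' - \<zeta>) * (norm (complexified N (S \<zeta> h)) / c)"
        by (intro mult_left_mono order_trans[OF ev_bound S_bound[OF \<zeta>']]) auto
      finally show ?thesis .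
    qed
    have "((\<lambda>\<zeta>'. ev x (S \<zeta>' h) - ev x (S \<zeta> h)) \<longlongrightarrow> 0) (at \<zeta> within cball 0 R)"
    proof (rule Lim_null_comparison)
      show "\<forall>\<^sub>F \<zeta>' in at \<zeta> within cball 0 R. cmod (ev x (S \<zeta>' h) - ev x (S \<zeta> h))
          \<le> cmod (\<zeta>' - \<zeta>) * (norm (complexified N (S \<zeta> h)) / c)"
        using bd by (auto simp: eventually_at_filter intro!: always_eventually)
      show "((\<lambda>\<zeta>'. cmod (\<zeta>' - \<zeta>) * (norm (complexified N (S \<zeta> h)) / c)) \<longlongrightarrow> 0) (at \<zeta> within cball 0 R)"
        by (rule tendsto_eq_intros | simp)+
    qed
    then show "((\<lambda>\<zeta>'. ev x (S \<zeta>' h)) \<longlongrightarrow> ev x (S \<zeta> (complexified N (S \<zeta> f)))) (at \<zeta> within cball 0 R)"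
      by (simp add: Lim_null[symmetric] h_def)
    show "ev x (S \<zeta>' h) = (g x f \<zeta>' - g x f \<zeta>) / (\<zeta>' - \<zeta>)"
      if "\<zeta>' \<in> cball 0 R" "0 < dist \<zeta>' \<zeta>" for \<zeta>'
      using that by (simp add: g_def ev_diff[symmetric] resolvent[OF \<zeta>] ev_scale h_def)
  qed (rule zero_less_one)
  have g_hol: "g x f holomorphic_on cball 0 R" for x f
    unfolding holomorphic_on_def field_differentiable_def using g_deriv by (metis mem_cball_0)
  then have g_hol': "g x f holomorphic_on ball 0 R" for x f
    by (rule holomorphic_on_subset) auto
  have g_rec: "g x f \<zeta> = ev x f + \<zeta> * g x (complexified N f) \<zeta>" if \<zeta>: "cmod \<zeta> \<le> R" for x f \<zeta>
  proof -
    have "S \<zeta> f = f + complex_scale \<zeta> (S \<zeta> (complexified N f))"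
    proof (rule injL[OF \<zeta>])
      have "L \<zeta> (f + complex_scale \<zeta> (S \<zeta> (complexified N f))) = L \<zeta> f + L \<zeta> (S \<zeta> (complex_scale \<zeta> (complexified N f)))"
        using linear_add[OF bounded_linear.linear[OF L]] S_scale[OF \<zeta>] by simp
      then show "L \<zeta> (S \<zeta> f) = L \<zeta> (f + complex_scale \<zeta> (S \<zeta> (complexified N f)))"
        by (simp add: LS \<zeta>) (simp add: L_def)
    qed
    then show ?thesis unfolding g_def by (metis ev_add ev_scale)
  qed
  \<comment> \<open>Differentiating \<open>g_rec\<close> at 0 lowers the order by one and replaces
    \<open>f\<close> by its image under \<open>N\<close>: in Leibniz's rule only the first
    derivative of the factor \<open>\<zeta>\<close> survives at 0. The coefficients thus appear
    without a series expansion.\<close>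
  have coeff: "(deriv ^^ m) (g x f) 0 = fact m * ev x ((complexified N ^^ m) f)" for m x f
  proof (induction m arbitrary: f)
    case 0
    then show ?case using g_rec[of 0 x f] R by simp
  next
    case (Suc m)
    have hol: "(\<lambda>\<zeta>. \<zeta> * g x (complexified N f) \<zeta>) holomorphic_on ball 0 R"
      "(\<lambda>\<zeta>. ev x f + \<zeta> * g x (complexified N f) \<zeta>) holomorphic_on ball 0 R"
      by (intro holomorphic_intros g_hol')+
    have R0: "0 \<in> ball (0::complex) R" using R by simp
    have "(deriv ^^ Suc m) (g x f) 0 = (deriv ^^ Suc m) (\<lambda>\<zeta>. ev x f + \<zeta> * g x (complexified N f) \<zeta>) 0"
      by (rule higher_deriv_transform_within_open[OF g_hol' hol(2) open_ball R0]) (rule g_rec, simp)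
    also have "\<dots> = (deriv ^^ Suc m) (\<lambda>\<zeta>. ev x f) 0 + (deriv ^^ Suc m) (\<lambda>\<zeta>. \<zeta> * g x (complexified N f) \<zeta>) 0"
      by (rule higher_deriv_add[OF holomorphic_on_const hol(1) open_ball R0])
    also have "(deriv ^^ Suc m) (\<lambda>\<zeta>. ev x f) 0 = 0" by (subst higher_deriv_const) simp
    also have "(deriv ^^ Suc m) (\<lambda>\<zeta>. \<zeta> * g x (complexified N f) \<zeta>) 0
        = (\<Sum>i = 0..Suc m. of_nat (Suc m choose i) * (deriv ^^ i) (\<lambda>\<zeta>. \<zeta>) 0 * (deriv ^^ (Suc m - i)) (g x (complexified N f)) 0)"
      by (rule higher_deriv_mult[OF holomorphic_on_ident g_hol' open_ball R0])
    also have "\<dots> = (\<Sum>i = 0..Suc m. if i = 1 then of_nat (Suc m) * (deriv ^^ m) (g x (complexified N f)) 0 else 0)"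
      by (intro sum.cong refl) (simp del: funpow.simps)
    also have "\<dots> = of_nat (Suc m) * (deriv ^^ m) (g x (complexified N f)) 0"
      by (subst sum.delta) auto
    finally show ?case using Suc[of "complexified N f"]
      by (simp add: funpow_Suc_right del: funpow.simps)
  qed
  show ?thesis
  proof (intro exI allI)
    fix m \<phi>
    show "norm ((N ^^ m) \<phi>) \<le> 1 / c * (1 / R) ^ m * norm \<phi>"
    proof (rule norm_bcontfun_leI)
      fix x
      have "cmod ((deriv ^^ m) (g x (\<phi>, 0)) 0) \<le> fact m * (norm \<phi> / c) / R ^ m"
      proof (rule Cauchy_inequality[OF g_hol' _ R])
        show "continuous_on (cball 0 R) (g x (\<phi>, 0))" using g_hol by (rule holomorphic_on_imp_continuous_on)
        show "cmod (g x (\<phi>, 0) \<zeta>) \<le> norm \<phi> / c" if "cmod (0 - \<zeta>) = R" for \<zeta>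
          using order_trans[OF ev_bound S_bound, of \<zeta> x "(\<phi>, 0)"] that by (simp add: g_def)
      qed
      then have "fact m * cmod (ev x ((complexified N ^^ m) (\<phi>, 0))) \<le> fact m * (norm \<phi> / c / R ^ m)"
        unfolding coeff by (simp add: norm_mult)
      then have "cmod (ev x ((complexified N ^^ m) (\<phi>, 0))) \<le> norm \<phi> / c / R ^ m"
        by (rule mult_left_le_imp_le) simp
      moreover have "(complexified N ^^ m) (\<phi>, 0) = ((N ^^ m) \<phi>, 0)"
        by (induction m) (auto simp: complexified_def linear_simps N)
      ultimately show "\<bar>apply_bcontfun ((N ^^ m) \<phi>) x\<bar> \<le> 1 / c * (1 / R) ^ m * norm \<phi>"
        by (simp add: ev_def cmod_def field_simps)
    qed
  qed
qed

section \<open>The spectrum of the monodromy operator\<close>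

lemma compact_operator_precomp_bounded_linear:
  fixes A :: "'a::real_normed_vector \<Rightarrow> 'b::real_normed_vector"
  assumes A: "bounded_linear A" and K: "compact_operator K"
  shows "compact_operator (\<lambda>x. K (A x))"
  unfolding compact_operator_def
proof (intro allI impI)
  fix S :: "'a set" assume "bounded S"
  then have "bounded (A ` S)" by (rule bounded_linear_image[OF _ A])
  then show "compact (closure ((\<lambda>x. K (A x)) ` S))"
    using K unfolding compact_operator_def by (metis image_image)
qed

lemma eigenvector_in_op_spectrum:
  assumes "linear N" "f \<noteq> 0" "complexified N f = complex_scale c f"
  shows "c \<in> op_spectrum N"
proof (rule ccontr)
  assume "c \<notin> op_spectrum N"
  then obtain B where B: "bounded_linear B" "B \<circ> (\<lambda>z. complex_scale c z - complexified N z) = id"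
    unfolding op_spectrum_def by blast
  have "f = B (complex_scale c f - complexified N f)" using fun_cong[OF B(2), of f] by simp
  also have "\<dots> = 0" using assms(3) linear_0[OF bounded_linear.linear[OF B(1)]] by simp
  finally show False using assms(2) by simp
qed

lemma complexified_funpow_eigenvector:
  assumes "linear N" "complexified N f = complex_scale c f"
  shows "(complexified N ^^ n) f = complex_scale (c ^ n) f"
proof (induction n)
  case (Suc n)
  have "(complexified N ^^ Suc n) f = complex_scale (c ^ n) (complexified N f)"
    by (simp add: Suc complexified_scale[OF assms(1)])
  then show ?case by (simp add: assms(2) complex_scale_scale mult.commute)
qed simp

lemma complexified_funpow: "(complexified N ^^ n) (p, q) = ((N ^^ n) p, (N ^^ n) q)"
  by (induction n) (simp_all add: complexified_def)

context periodic_evolution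
begin

section \<open>Eigenvectors of the monodromy operators\<close>

lemma G_power: "(G (s + T) s ^^ n) \<phi> = G (s + of_nat n * T) s \<phi>"
proof (induction n)
  case (Suc n)
  have shift: "G (s + T) s = G (s + T + of_nat n * T) (s + of_nat n * T)"
    using G_periodic_nat[of s "s + T" n] T_pos by simp
  have "(G (s + T) s ^^ Suc n) \<phi> = G (s + T) s (G (s + of_nat n * T) s \<phi>)" by (simp add: Suc)
  also have "\<dots> = G (s + T + of_nat n * T) (s + of_nat n * T) (G (s + of_nat n * T) s \<phi>)"
    unfolding shift[symmetric] ..
  also have "\<dots> = G (s + T + of_nat n * T) s \<phi>" using T_pos by (intro G_compose) auto
  finally show ?case by (simp add: algebra_simps)
qed simp

lemma linear_G: "s \<le> t \<Longrightarrow> linear (G t s)"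
  using bounded_linear_G bounded_linear.linear by blast

text \<open>If \<open>|c| \<ge> 1\<close>, the conditional variance \<open>V |f|\<^sup>2 - |V f|\<^sup>2\<close> is at most \<open>V |f|\<^sup>2 - |f|\<^sup>2\<close>, whose
  mean vanishes; so it is zero at some point, and strict positivity makes \<open>f\<close> constant.\<close>

lemma unimodular_eigenvector_const:
  assumes ev: "complexified (G (s + T) s) f = complex_scale c f" and c: "1 \<le> cmod c"
  shows "\<exists>a b. f = (const_bcontfun a, const_bcontfun b)"
proof -
  have sT: "s < s + T" "s \<le> s + T" using T_pos by auto
  obtain p q where f: "f = (p, q)" by (cases f)
  let ?V = "G (s + T) s"
  let ?v = "apply_bcontfun"
  have Vp: "?V p = Re c *\<^sub>R p - Im c *\<^sub>R q" and Vq: "?V q = Re c *\<^sub>R q + Im c *\<^sub>R p"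
    using ev by (auto simp: f complexified_def complex_scale_def)
  define h where "h = Bcontfun (\<lambda>x. (?v p x)\<^sup>2) + Bcontfun (\<lambda>x. (?v q x)\<^sup>2)"
  have h: "?v h x = (?v p x)\<^sup>2 + (?v q x)\<^sup>2" for x
    using bcontfun_compose[of "\<lambda>t. t\<^sup>2" p] bcontfun_compose[of "\<lambda>t. t\<^sup>2" q]
    by (simp add: h_def continuous_on_power[OF continuous_on_id])
  have cc: "(?v (?V p) x)\<^sup>2 + (?v (?V q) x)\<^sup>2 = (cmod c)\<^sup>2 * ?v h x" for x
    unfolding Vp Vq h cmod_power2 by (simp add: power2_eq_square algebra_simps)
  \<comment> \<open>With \<open>x\<close> frozen, \<open>k x\<close> is the function sending
    \<open>y\<close> to \<open>|f(y) - (V f)(x)|^2\<close>, expanded so that \<open>V\<close> acts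
    on it linearly. Evaluated at the same \<open>x\<close>, its image under \<open>V\<close> is the
    conditional variance.\<close>
  define k where "k x = h - (2 * ?v (?V p) x) *\<^sub>R p - (2 * ?v (?V q) x) *\<^sub>R q
      + const_bcontfun ((cmod c)\<^sup>2 * ?v h x)" for x
  have k: "?v (k x) y = (?v p y - ?v (?V p) x)\<^sup>2 + (?v q y - ?v (?V q) x)\<^sup>2" for x y
    unfolding k_def cc[symmetric] by (simp add: h power2_eq_square algebra_simps)
  have Vk: "?v (?V (k x)) x = ?v (?V h) x - (cmod c)\<^sup>2 * ?v h x" for x
  proof -
    have "?v (?V (k x)) x = ?v (?V h) x - 2 * ((?v (?V p) x)\<^sup>2 + (?v (?V q) x)\<^sup>2) + (cmod c)\<^sup>2 * ?v h x"
      unfolding k_def using sT by (simp add: G_add G_diff G_scaleR G_const power2_eq_square)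
    then show ?thesis by (simp add: cc)
  qed
  have Vk0: "0 \<le> ?v (?V (k x)) x" for x using sT by (intro G_nonneg) (auto simp: k)
  have h0: "0 \<le> ?v h x" for x by (simp add: h)
  have c2: "?v h x \<le> (cmod c)\<^sup>2 * ?v h x" for x
    using mult_right_mono[OF _ h0[of x], of 1 "(cmod c)\<^sup>2"] c by (simp add: one_le_power)
  have "\<exists>x. ?v (?V h) x \<le> ?v h x"
  proof (rule ccontr)
    assume "\<not> ?thesis"
    then have "0 < mean s (?V h - h)" unfolding mean_def by (intro integral_pos_of_pos) (simp add: not_le)
    moreover have "mean s (?V h) = mean s h" using mean_G[OF sT(2)] mean_periodic by metis
    ultimately show False by (simp add: mean_diff)
  qed
  then obtain x where x: "?v (?V h) x \<le> ?v h x" by blast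
  have "?v (k x) y = 0" for y
  proof (rule ccontr)
    assume "?v (k x) y \<noteq> 0"
    then have "0 < ?v (k x) y" using k[of x y] by (smt (verit) zero_le_power2)
    then have "0 < ?v (?V (k x)) x" using sT by (intro G_pos) (auto simp: k)
    then show False using Vk[of x] x c2[of x] by simp
  qed
  then have "?v p y = ?v (?V p) x \<and> ?v q y = ?v (?V q) x" for y
    using k[of x y] by (simp add: add_nonneg_eq_0_iff)
  then have "p = const_bcontfun (?v (?V p) x)" "q = const_bcontfun (?v (?V q) x)"
    by (auto intro!: bcontfun_eqI)
  then show ?thesis using f by blast
qed

text \<open>The monodromy operator preserves the mean, so averaging the eigenvalue equation shows
  that the complex mean equals \<open>c\<close> times itself.\<close>

lemma eigenvector_mean_zero:
  assumes ev: "complexified (G (s + T) s) (p, q) = complex_scale c (p, q)" and c: "c \<noteq> 1"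
  shows "mean s p = 0" "mean s q = 0"
proof -
  have VV: "mean s (G (s + T) s \<phi>) = mean s \<phi>" for \<phi>
    using mean_G[of s "s + T"] mean_periodic T_pos by (metis less_eq_real_def less_add_same_cancel1)
  have "Complex (mean s p) (mean s q) = c * Complex (mean s p) (mean s q)"
    using ev VV[of p] VV[of q]
    by (auto simp: complexified_def complex_scale_def complex_eq_iff mean_add mean_diff mean_scaleR)
  then have "Complex (mean s p) (mean s q) = 0" using c by simp
  then show "mean s p = 0" "mean s q = 0" by (auto simp: complex_eq_iff)
qed

lemma eigenvector_ge_1:
  assumes ev: "complexified (G (s + T) s) f = complex_scale c f" and c: "1 \<le> cmod c"
    and "mean s (fst f) = 0" "mean s (snd f) = 0"
  shows "f = 0"
  using unimodular_eigenvector_const[OF ev c] assms(3,4) by (auto simp: zero_prod_def)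

section \<open>Decay of the monodromy operator on functions of mean zero\<close>

text \<open>The projection along the constants onto the functions of mean zero, followed by the
  monodromy operator. It annihilates the constants and acts like the monodromy operator on functions
  of mean zero, while being defined on all bounded continuous functions, so that the results on
  compact operators apply without passing to a subspace.\<close>

definition centered_monodromy :: "((real^'n) \<Rightarrow>\<^sub>C real) \<Rightarrow> ((real^'n) \<Rightarrow>\<^sub>C real)" where
  "centered_monodromy \<phi> = G T 0 (\<phi> - const_bcontfun (mean 0 \<phi>))"

lemma mean_monodromy: "mean 0 (G T 0 \<phi>) = mean 0 \<phi>"
  using mean_G[of 0 T \<phi>] mean_periodic[of 0] T_pos by simp

lemma mean_centered_monodromy: "mean 0 (centered_monodromy \<phi>) = 0"
  by (simp add: centered_monodromy_def mean_monodromy mean_diff)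

lemma bounded_linear_center: "bounded_linear (\<lambda>\<phi>. \<phi> - const_bcontfun (mean s \<phi>))"
proof (rule bounded_linear_intro[where K = 2])
  show "norm (\<phi> - const_bcontfun (mean s \<phi>)) \<le> norm \<phi> * 2" for \<phi>
  proof (rule norm_bcontfun_leI)
    show "\<bar>apply_bcontfun (\<phi> - const_bcontfun (mean s \<phi>)) x\<bar> \<le> norm \<phi> * 2" for x
      using abs_mean_le[of s \<phi>] abs_bcontfun_le[of \<phi> x] by simp
  qed
qed (auto intro!: bcontfun_eqI simp: mean_add mean_scaleR algebra_simps)

lemma bounded_linear_centered_monodromy: "bounded_linear centered_monodromy"
  unfolding centered_monodromy_def
  using T_pos by (intro bounded_linear_compose[OF bounded_linear_G bounded_linear_center]) simp

lemma compact_centered_monodromy: "compact_operator centered_monodromy"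
  unfolding centered_monodromy_def
  using T_pos by (intro compact_operator_precomp_bounded_linear[OF bounded_linear_center] compact)

text \<open>The range of \<open>centered_monodromy\<close> has mean zero, hence so does every
  eigenvector for \<open>c \<noteq> 0\<close>; on such functions the centering does nothing.\<close>

lemma centered_eigenvector:
  assumes ev: "complexified centered_monodromy f = complex_scale c f" and c: "c \<noteq> 0"
  shows "complexified (G (0 + T) 0) f = complex_scale c f" "mean 0 (fst f) = 0" "mean 0 (snd f) = 0"
proof -
  obtain p q where f: "f = (p, q)" by (cases f)
  have eqs: "centered_monodromy p = Re c *\<^sub>R p - Im c *\<^sub>R q" "centered_monodromy q = Re c *\<^sub>R q + Im c *\<^sub>R p"
    using ev by (auto simp: f complexified_def complex_scale_def)
  have "c * Complex (mean 0 p) (mean 0 q) = 0"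
    using mean_centered_monodromy[of p] mean_centered_monodromy[of q]
    by (auto simp: eqs complex_eq_iff mean_add mean_diff mean_scaleR)
  then have "Complex (mean 0 p) (mean 0 q) = 0" using c by simp
  then have m: "mean 0 p = 0" "mean 0 q = 0" by (auto simp: complex_eq_iff)
  then show "mean 0 (fst f) = 0" "mean 0 (snd f) = 0" by (auto simp: f)
  show "complexified (G (0 + T) 0) f = complex_scale c f"
    using ev m by (simp add: f complexified_def centered_monodromy_def)
qed

lemma centered_eigenvector_conv:
  assumes "complexified (G (0 + T) 0) f = complex_scale c f" "c \<noteq> 1"
  shows "complexified centered_monodromy f = complex_scale c f"
proof -
  obtain p q where f: "f = (p, q)" by (cases f)
  show ?thesis
    using eigenvector_mean_zero[of 0 p q c] assms by (simp add: f complexified_def centered_monodromy_def)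
qed

text \<open>The supremum defining \<open>r\<close> runs over all \<open>s\<close>, and this moves
  everything to time 0. For a multiple \<open>t\<close> of \<open>T\<close> beyond \<open>s\<close>,
  the operator \<open>G t s\<close> intertwines the monodromy operators at \<open>s\<close> and
  \<open>t\<close>, and the latter is the one at 0. It does not annihilate \<open>f\<close>, because
  continuing to \<open>s + n T\<close> gives the \<open>n\<close>-th monodromy power, which
  multiplies \<open>f\<close> by \<open>c ^ n\<close>.\<close>

lemma eigenvector_transport:
  assumes c: "c \<in> op_spectrum (G (s + T) s)" "c \<noteq> 0"
  shows "\<exists>f. f \<noteq> 0 \<and> complexified (G (0 + T) 0) f = complex_scale c f"
proof -
  have sT: "s < s + T" "s \<le> s + T" using T_pos by auto
  obtain f where f: "f \<noteq> 0" "complexified (G (s + T) s) f = complex_scale c f"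
    using op_spectrum_eigenvector[OF bounded_linear_G[OF sT(2)] compact[OF sT(1)] c] by blast
  obtain k :: nat where "s / T \<le> of_nat k" using real_arch_simple by blast
  then have k: "s \<le> of_nat k * T" using T_pos by (simp add: field_simps)
  define t where "t = of_nat k * T"
  obtain n :: nat where "(t - s) / T \<le> of_nat n" using real_arch_simple by blast
  then have n: "t \<le> s + of_nat n * T" using T_pos by (simp add: field_simps)
  have st: "s \<le> t" using k by (simp add: t_def)
  define g where "g = complexified (G t s) f"
  have "G (0 + T) 0 = G (t + T) t"
    using G_periodic_nat[of 0 T k] T_pos by (simp add: t_def add.commute)
  then have "G (0 + T) 0 (G t s \<phi>) = G (t + T) s \<phi>" for \<phi> using st T_pos by (simp add: G_compose)
  moreover have "G t s (G (s + T) s \<phi>) = G (t + T) s \<phi>" for \<phi>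
  proof -
    have "G t s = G (t + T) (s + T)" using st by (simp add: G_periodic)
    then show ?thesis using sT st by (simp add: G_compose)
  qed
  ultimately have "complexified (G (0 + T) 0) g = complexified (G t s) (complexified (G (s + T) s) f)"
    by (cases f) (simp add: g_def complexified_def)
  also have "\<dots> = complex_scale c g"
    by (simp add: f(2) g_def complexified_scale[OF linear_G[OF st]])
  finally have gc: "complexified (G (0 + T) 0) g = complex_scale c g" .
  have "g \<noteq> 0"
  proof
    assume "g = 0"
    obtain p q where pq: "f = (p, q)" by (cases f)
    have "G t s p = 0" "G t s q = 0" using \<open>g = 0\<close> by (auto simp: g_def pq complexified_def zero_prod_def)
    moreover have "G (s + of_nat n * T) s \<phi> = G (s + of_nat n * T) t (G t s \<phi>)" for \<phi>
      using st n by (simp add: G_compose)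
    ultimately have "G (s + of_nat n * T) s p = 0" "G (s + of_nat n * T) s q = 0"
      using linear_0[OF linear_G[OF n]] by simp_all
    then have "complex_scale (c ^ n) f = 0"
      unfolding complexified_funpow_eigenvector[OF linear_G[OF sT(2)] f(2), symmetric]
      by (simp add: pq complexified_funpow G_power zero_prod_def)
    then have "complex_scale (1 / c ^ n) (complex_scale (c ^ n) f) = 0"
      by (simp add: complex_scale.zero_right)
    then show False using f(1) c by (simp add: complex_scale_scale)
  qed
  then show ?thesis using gc by blast
qed

text \<open>Smoothing prevents surjectivity: \<open>G t s\<close> has only twice differentiable
  functions in its range, and \<open>min 1 (norm x)\<close> has a kink at 0. Its gradient there
  would vanish, since 0 is a minimum, whereas its difference quotients along an axis have modulus
  1.\<close>

lemma zero_in_op_spectrum: "s < t \<Longrightarrow> 0 \<in> op_spectrum (G t s)"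
proof (rule ccontr)
  assume st: "s < t" and "0 \<notin> op_spectrum (G t s)"
  then obtain B where B: "(\<lambda>z. complex_scale 0 z - complexified (G t s) z) \<circ> B = id"
    unfolding op_spectrum_def by blast
  define \<psi> :: "(real^'n) \<Rightarrow>\<^sub>C real" where "\<psi> = Bcontfun (\<lambda>x. min 1 (norm x))"
  have \<psi>: "apply_bcontfun \<psi> x = min 1 (norm x)" for x
  proof -
    have "(\<lambda>x :: real^'n. min 1 (norm x)) \<in> bcontfun"
      by (rule bcontfun_normI[where b = 1]) (auto intro!: continuous_intros)
    then show ?thesis by (simp add: \<psi>_def Bcontfun_inverse)
  qed
  obtain p q where pq: "B (\<psi>, 0) = (p, q)" by (cases "B (\<psi>, 0)")
  have "\<psi> = - G t s p" using fun_cong[OF B, of "(\<psi>, 0)"]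
    by (simp add: pq complexified_def complex_scale.zero_left zero_prod_def)
  also have "\<dots> = G t s (- p)" using linear_neg[OF linear_G, of s t p] st by simp
  finally have C2: "C2_fun (apply_bcontfun \<psi>)" using C2_fun_G[OF st] by metis
  have "partial_D i (apply_bcontfun \<psi>) 0 = 0" for i
    by (rule C2_local_min(1)[OF C2 zero_less_one]) (simp add: \<psi>)
  moreover have "((\<lambda>h. apply_bcontfun \<psi> (0 + h *\<^sub>R axis i 1)) has_real_derivative
      (\<Sum>j\<in>UNIV. axis i 1 $ j * partial_D j (apply_bcontfun \<psi>) (0 + 0 *\<^sub>R axis i 1))) (at 0)"
    using C2 by (intro DERIV_along_line) (auto simp: C2_fun_def C1_fun_def)
  ultimately have "((\<lambda>h. min 1 \<bar>h\<bar>) has_real_derivative 0) (at 0)"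
    by (simp add: \<psi>)
  then have "(\<lambda>h. min 1 \<bar>h\<bar> / h) \<midarrow>0\<rightarrow> (0::real)" by (simp add: DERIV_def)
  then obtain d where d: "d > 0" "\<And>h. h \<noteq> 0 \<Longrightarrow> \<bar>h\<bar> < d \<Longrightarrow> \<bar>min 1 \<bar>h\<bar> / h\<bar> < (1::real)"
    unfolding LIM_def by (metis dist_real_def diff_zero zero_less_one)
  define h where "h = min 1 d / 2"
  have "h > 0" "h < d" "h < 1" using d(1) by (auto simp: h_def)
  then show False using d(2)[of h] by simp
qed

lemma spectral_set:
  defines "A \<equiv> {cmod c | c s. c \<in> op_spectrum (G (s + T) s) \<and> cmod c < 1}"
  shows "bdd_above A" "0 \<in> A" "subunit_radius T G = Sup A"
proof -
  show "bdd_above A" unfolding A_def by (rule bdd_aboveI[of _ 1]) auto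
  show "0 \<in> A" unfolding A_def using zero_in_op_spectrum[of 0 "0 + T"] T_pos
    by (intro CollectI exI[of _ 0]) auto
  show "subunit_radius T G = Sup A" by (simp add: A_def subunit_radius_def)
qed

lemma subunit_radius_nonneg: "0 \<le> subunit_radius T G"
  using cSup_upper[OF spectral_set(2,1)] spectral_set(3) by simp

text \<open>Strict positivity excludes eigenvectors of the centered operator \<open>N\<close> on the
  unit circle, so compactness bounds \<open>1 - \<zeta> N\<close> below by some \<open>e > 0\<close>
  uniformly there. An eigenvector for \<open>c\<close> with \<open>0 < |c| < 1\<close> is rotated by
  \<open>\<zeta> = |c| / c\<close>: then \<open>1 - \<zeta> N\<close> multiplies it by
  \<open>1 - |c|\<close>, which forces \<open>|c| \<le> 1 - e\<close>.\<close>

lemma subunit_radius_less_1: "subunit_radius T G < 1"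
proof -
  have "f = 0" if "\<zeta> \<in> sphere 0 1" "f = complex_scale \<zeta> (complexified centered_monodromy f)" for \<zeta> f
  proof -
    have \<zeta>: "cmod \<zeta> = 1" "\<zeta> \<noteq> 0" using that(1) by auto
    have "complex_scale (1 / \<zeta>) f = complexified centered_monodromy f"
      using arg_cong[OF that(2), of "complex_scale (1 / \<zeta>)"] \<zeta> by (simp add: complex_scale_scale)
    from centered_eigenvector[OF this[symmetric]] \<zeta>
    show "f = 0" by (intro eigenvector_ge_1[of 0 f "1 / \<zeta>"]) (auto simp: norm_divide)
  qed
  then obtain e where e: "e > 0"
    "\<And>\<zeta> f. \<zeta> \<in> sphere 0 1 \<Longrightarrow> e * norm f \<le> norm (f - complex_scale \<zeta> (complexified centered_monodromy f))"
    using resolvent_bounded_below[OF bounded_linear_centered_monodromy compact_centered_monodromy, of "sphere 0 1"]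
    by (metis compact_sphere)
  have "x \<le> max 0 (1 - e)" if x: "x \<in> {cmod c | c s. c \<in> op_spectrum (G (s + T) s) \<and> cmod c < 1}" for x
  proof -
    obtain c s where c: "x = cmod c" "c \<in> op_spectrum (G (s + T) s)" "cmod c < 1" using x by auto
    show ?thesis
    proof (cases "c = 0")
      case False
      obtain f where f: "f \<noteq> 0" "complexified (G (0 + T) 0) f = complex_scale c f"
        using eigenvector_transport[OF c(2) False] by blast
      have fc: "complexified centered_monodromy f = complex_scale c f"
        using centered_eigenvector_conv[OF f(2)] c(3) by fastforce
      define \<zeta> where "\<zeta> = of_real (cmod c) / c"
      have "\<zeta> \<in> sphere 0 1" using False by (simp add: \<zeta>_def norm_divide)
      from e(2)[OF this, of f] have "e * norm f \<le> norm (f - complex_scale (of_real (cmod c)) f)"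
        using False by (simp add: fc complex_scale_scale \<zeta>_def)
      also have "complex_scale (of_real (cmod c)) f = cmod c *\<^sub>R f" by (cases f) (simp add: complex_scale_def)
      also have "norm (f - cmod c *\<^sub>R f) = (1 - cmod c) * norm f"
        using c(3) norm_scaleR[of "1 - cmod c" f] by (simp add: scaleR_diff_left)
      finally show ?thesis using f(1) c(1) by simp
    qed (simp add: c)
  qed
  then have "subunit_radius T G \<le> max 0 (1 - e)"
    unfolding spectral_set(3) using spectral_set(2) by (intro cSup_least) blast+
  then show ?thesis using e(1) by simp
qed

text \<open>A nonzero vector fixed by \<open>\<zeta>\<close> times the centered operator, with
  \<open>|\<zeta>| \<le> 1 / \<rho>\<close>, would be an eigenvector for
  \<open>c = 1 / \<zeta>\<close> of modulus at least \<open>\<rho>\<close>. Moduli between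
  \<open>\<rho>\<close> and 1 are excluded by the choice of \<open>\<rho>\<close> above
  \<open>r\<close>, those from 1 on by strict positivity.\<close>

theorem monodromy_power_decay:
  assumes \<rho>: "subunit_radius T G < \<rho>"
  shows "\<exists>C. \<forall>m \<phi>. mean 0 \<phi> = 0 \<longrightarrow> norm ((G T 0 ^^ m) \<phi>) \<le> C * \<rho> ^ m * norm \<phi>"
proof -
  have \<rho>0: "\<rho> > 0" using \<rho> subunit_radius_nonneg by simp
  have "f = 0" if "cmod \<zeta> \<le> 1 / \<rho>" "f = complex_scale \<zeta> (complexified centered_monodromy f)" for \<zeta> f
  proof (rule ccontr)
    assume f0: "f \<noteq> 0"
    then have \<zeta>: "\<zeta> \<noteq> 0" using that(2) by (metis complex_scale.zero_left)
    define c where "c = 1 / \<zeta>"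
    have c: "c \<noteq> 0" "cmod c \<ge> \<rho>" using \<zeta> that(1) \<rho>0 by (auto simp: c_def norm_divide field_simps)
    have "complex_scale c f = complexified centered_monodromy f"
      using arg_cong[OF that(2), of "complex_scale c"] \<zeta> by (simp add: complex_scale_scale c_def)
    note ev = centered_eigenvector[OF this[symmetric] c(1)]
    show False
    proof (cases "cmod c < 1")
      case True
      have "c \<in> op_spectrum (G (0 + T) 0)"
        using T_pos by (intro eigenvector_in_op_spectrum[OF linear_G f0 ev(1)]) simp
      then have "cmod c \<le> subunit_radius T G"
        unfolding spectral_set(3) using True by (intro cSup_upper[OF _ spectral_set(1)]) blast
      then show False using c(2) \<rho> by simp
    next
      case False
      then show False using eigenvector_ge_1[OF ev(1) _ ev(2,3)] f0 by simp
    qed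
  qed
  then obtain C where C: "\<And>m \<phi>. norm ((centered_monodromy ^^ m) \<phi>) \<le> C * (1 / (1 / \<rho>)) ^ m * norm \<phi>"
    using compact_operator_power_decay[OF bounded_linear_centered_monodromy compact_centered_monodromy, of "1 / \<rho>"] \<rho>0
    by auto
  have "(centered_monodromy ^^ m) \<phi> = (G T 0 ^^ m) \<phi> \<and> mean 0 ((G T 0 ^^ m) \<phi>) = 0" if "mean 0 \<phi> = 0" for m \<phi>
    by (induction m) (auto simp: that centered_monodromy_def mean_monodromy)
  then show ?thesis using C by (metis div_by_1 divide_divide_eq_right mult_1)
qed

end

section \<open>$L^p$ spaces\<close>

text \<open>The convex function \<open>|.|^p\<close> lies above its tangents, by Young's inequality
  with exponents \<open>p\<close> and \<open>p / (p - 1)\<close>. The tangent form gives the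
  triangle inequality, the bound of an integral by the L^p norm and Jensen's inequality for
  \<open>G\<close>.\<close>

lemma abs_powr_tangent:
  fixes a c p :: real
  assumes p: "1 < p"
  shows "\<bar>c\<bar> powr p + p * \<bar>c\<bar> powr (p - 1) * sgn c * (a - c) \<le> \<bar>a\<bar> powr p"
proof -
  have "\<bar>a\<bar> * \<bar>c\<bar> powr (p - 1) \<le> \<bar>a\<bar> powr p / p + (\<bar>c\<bar> powr (p - 1)) powr (p / (p - 1)) / (p / (p - 1))"
    using p by (intro Youngs_inequality) (auto simp: field_simps)
  also have "(\<bar>c\<bar> powr (p - 1)) powr (p / (p - 1)) = \<bar>c\<bar> powr p" using p by (simp add: powr_powr)
  finally have "p * (\<bar>a\<bar> * \<bar>c\<bar> powr (p - 1)) \<le> p * (\<bar>a\<bar> powr p / p + \<bar>c\<bar> powr p / (p / (p - 1)))"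
    using p by (intro mult_left_mono) auto
  then have young: "p * (\<bar>a\<bar> * \<bar>c\<bar> powr (p - 1)) \<le> \<bar>a\<bar> powr p + (p - 1) * \<bar>c\<bar> powr p"
    using p by (simp add: distrib_left mult.commute)
  have "sgn c * a \<le> \<bar>a\<bar>" by (cases "c > 0"; cases "c = 0") (auto simp: sgn_if)
  then have "(p * \<bar>c\<bar> powr (p - 1)) * (sgn c * a) \<le> (p * \<bar>c\<bar> powr (p - 1)) * \<bar>a\<bar>"
    using p by (intro mult_left_mono) auto
  moreover have "\<bar>c\<bar> powr (p - 1) * (sgn c * c) = \<bar>c\<bar> powr p"
  proof (cases "c = 0")
    case False
    then have "\<bar>c\<bar> powr (p - 1) * \<bar>c\<bar> powr 1 = \<bar>c\<bar> powr p" unfolding powr_add[symmetric] by simp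
    moreover have "sgn c * c = \<bar>c\<bar>" by (simp add: sgn_if)
    ultimately show ?thesis by simp
  qed simp
  moreover have "p * \<bar>c\<bar> powr (p - 1) * sgn c * (a - c)
      = p * \<bar>c\<bar> powr (p - 1) * (sgn c * a) - p * (\<bar>c\<bar> powr (p - 1) * (sgn c * c))"
    by (simp add: algebra_simps)
  ultimately show ?thesis using young by (simp add: algebra_simps)
qed

lemma abs_powr_convex:
  fixes a b u v p :: real
  assumes p: "1 < p" and uv: "0 \<le> u" "0 \<le> v" "u + v = 1"
  shows "\<bar>u * a + v * b\<bar> powr p \<le> u * \<bar>a\<bar> powr p + v * \<bar>b\<bar> powr p"
proof -
  define c where "c = u * a + v * b"
  define k where "k = p * \<bar>c\<bar> powr (p - 1) * sgn c"
  have "u * (\<bar>c\<bar> powr p + k * (a - c)) + v * (\<bar>c\<bar> powr p + k * (b - c))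
      \<le> u * \<bar>a\<bar> powr p + v * \<bar>b\<bar> powr p"
    unfolding k_def by (intro add_mono mult_left_mono abs_powr_tangent p uv)
  moreover have "u * (\<bar>c\<bar> powr p + k * (a - c)) + v * (\<bar>c\<bar> powr p + k * (b - c))
      = (u + v) * (\<bar>c\<bar> powr p - k * c) + k * (u * a + v * b)" by (simp add: algebra_simps)
  ultimately show ?thesis using uv(3) by (simp add: c_def[symmetric])
qed

lemma abs_powr_add_le:
  fixes a b p :: real
  assumes p: "1 < p"
  shows "\<bar>a + b\<bar> powr p \<le> 2 powr p * (\<bar>a\<bar> powr p + \<bar>b\<bar> powr p)"
proof -
  have "\<bar>1/2 * (2 * a) + 1/2 * (2 * b)\<bar> powr p \<le> 1/2 * \<bar>2 * a\<bar> powr p + 1/2 * \<bar>2 * b\<bar> powr p"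
    by (rule abs_powr_convex[OF p]) auto
  also have "\<dots> \<le> \<bar>2 * a\<bar> powr p + \<bar>2 * b\<bar> powr p"
    using powr_ge_zero[of "\<bar>2 * a\<bar>" p] powr_ge_zero[of "\<bar>2 * b\<bar>" p] by linarith
  also have "\<dots> = 2 powr p * (\<bar>a\<bar> powr p + \<bar>b\<bar> powr p)"
    by (simp add: abs_mult powr_mult distrib_left)
  finally show ?thesis by simp
qed

section \<open>Seminorm properties and completeness of L^p\<close>

lemma Lp_spaceD [dest]:
  assumes "f \<in> Lp_space p M"
  shows "f \<in> borel_measurable M" "integrable M (\<lambda>x. \<bar>f x\<bar> powr p)"
  using assms by (auto simp: Lp_space_def)

lemma Lp_norm_nonneg [simp]: "0 \<le> Lp_norm p M f"
  by (simp add: Lp_norm_def)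

lemma Lp_norm_powr:
  assumes "1 < p" shows "Lp_norm p M f powr p = (\<integral>x. \<bar>f x\<bar> powr p \<partial>M)"
  using assms by (simp add: Lp_norm_def powr_powr)

lemma Lp_norm_le_iff:
  assumes "1 < p" "0 \<le> a"
  shows "Lp_norm p M f \<le> a \<longleftrightarrow> (\<integral>x. \<bar>f x\<bar> powr p \<partial>M) \<le> a powr p"
  unfolding Lp_norm_powr[OF assms(1), symmetric]
  using assms powr_mono2[of p "Lp_norm p M f" a] powr_less_mono2[of p a "Lp_norm p M f"]
  by (auto simp: not_le[symmetric])

lemma Lp_space_add:
  assumes p: "1 < p" and f: "f \<in> Lp_space p M" and g: "g \<in> Lp_space p M"
  shows "(\<lambda>x. f x + g x) \<in> Lp_space p M"
proof -
  note [measurable] = Lp_spaceD(1)[OF f] Lp_spaceD(1)[OF g]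
  have "integrable M (\<lambda>x. \<bar>f x + g x\<bar> powr p)"
  proof (rule Bochner_Integration.integrable_bound)
    show "integrable M (\<lambda>x. 2 powr p * (\<bar>f x\<bar> powr p + \<bar>g x\<bar> powr p))" using f g by auto
    show "AE x in M. norm (\<bar>f x + g x\<bar> powr p) \<le> norm (2 powr p * (\<bar>f x\<bar> powr p + \<bar>g x\<bar> powr p))"
      using abs_powr_add_le[OF p] by (auto intro!: AE_I2 simp: abs_mult)
  qed measurable
  then show ?thesis by (simp add: Lp_space_def)
qed

lemma Lp_space_cmult:
  assumes f: "f \<in> Lp_space p M" shows "(\<lambda>x. c * f x) \<in> Lp_space p M"
proof -
  note [measurable] = Lp_spaceD(1)[OF f]
  show ?thesis using f by (auto simp: Lp_space_def abs_mult powr_mult)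
qed

lemma Lp_space_diff:
  assumes "1 < p" "f \<in> Lp_space p M" "g \<in> Lp_space p M"
  shows "(\<lambda>x. f x - g x) \<in> Lp_space p M"
  using Lp_space_add[OF assms(1,2) Lp_space_cmult[OF assms(3), of "-1"]] by simp

lemma Lp_norm_cmult:
  assumes "1 < p" shows "Lp_norm p M (\<lambda>x. c * f x) = \<bar>c\<bar> * Lp_norm p M f"
  using assms by (simp add: Lp_norm_def abs_mult powr_mult powr_powr)

text \<open>Minkowski's inequality from convexity, applied to \<open>f / a\<close> and
  \<open>g / b\<close> with weights \<open>a / (a + b)\<close> and \<open>b / (a + b)\<close>.
  Adding \<open>e / 2\<close> to each norm keeps \<open>a\<close> and \<open>b\<close> positive, so
  vanishing norms need no separate case.\<close>

lemma Lp_norm_triangle: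
  assumes p: "1 < p" and f: "f \<in> Lp_space p M" and g: "g \<in> Lp_space p M"
  shows "Lp_norm p M (\<lambda>x. f x + g x) \<le> Lp_norm p M f + Lp_norm p M g"
proof (rule field_le_epsilon)
  fix e :: real assume e: "e > 0"
  define a where "a = Lp_norm p M f + e / 2"
  define b where "b = Lp_norm p M g + e / 2"
  have ab: "a > 0" "b > 0" using e by (auto simp: a_def b_def add_nonneg_pos)
  define u where "u = a / (a + b)"
  define v where "v = b / (a + b)"
  have "a + b \<noteq> 0" using ab by linarith
  then have uv: "0 \<le> u" "0 \<le> v" "u + v = 1" and uv': "(a + b) * u = a" "(a + b) * v = b"
    using ab by (simp_all add: u_def v_def add_divide_distrib[symmetric])
  have fa: "(\<integral>x. \<bar>f x\<bar> powr p \<partial>M) \<le> a powr p" and gb: "(\<integral>x. \<bar>g x\<bar> powr p \<partial>M) \<le> b powr p"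
    using ab e p by (simp_all add: Lp_norm_le_iff[symmetric] a_def b_def)
  have ptw: "\<bar>f x + g x\<bar> powr p \<le> (a + b) powr p * (u * (\<bar>f x\<bar> powr p / a powr p) + v * (\<bar>g x\<bar> powr p / b powr p))" for x
  proof -
    have "(a + b) * (u * (f x / a) + v * (g x / b)) = ((a + b) * u) * (f x / a) + ((a + b) * v) * (g x / b)"
      by (simp only: distrib_left mult.assoc)
    then have "f x + g x = (a + b) * (u * (f x / a) + v * (g x / b))"
      using ab by (simp add: uv')
    then have "\<bar>f x + g x\<bar> powr p = (a + b) powr p * \<bar>u * (f x / a) + v * (g x / b)\<bar> powr p"
      using ab by (simp add: abs_mult powr_mult)
    also have "\<dots> \<le> (a + b) powr p * (u * \<bar>f x / a\<bar> powr p + v * \<bar>g x / b\<bar> powr p)"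
      by (intro mult_left_mono abs_powr_convex p uv) simp
    finally show ?thesis using ab by (simp add: abs_divide powr_divide)
  qed
  have "(\<integral>x. \<bar>f x + g x\<bar> powr p \<partial>M)
      \<le> (\<integral>x. (a + b) powr p * (u * (\<bar>f x\<bar> powr p / a powr p) + v * (\<bar>g x\<bar> powr p / b powr p)) \<partial>M)"
    by (intro integral_mono ptw Lp_spaceD(2)[OF Lp_space_add[OF p f g]] integrable_mult_right
        Bochner_Integration.integrable_add integrable_divide_zero Lp_spaceD(2)[OF f] Lp_spaceD(2)[OF g])
  also have "\<dots> = (a + b) powr p * (u * ((\<integral>x. \<bar>f x\<bar> powr p \<partial>M) / a powr p) + v * ((\<integral>x. \<bar>g x\<bar> powr p \<partial>M) / b powr p))"
    using Lp_spaceD(2)[OF f] Lp_spaceD(2)[OF g] by simp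
  also have "\<dots> \<le> (a + b) powr p * (u * 1 + v * 1)"
    using fa gb ab uv by (intro mult_left_mono add_mono) (auto simp: divide_le_eq_1)
  finally have "Lp_norm p M (\<lambda>x. f x + g x) \<le> a + b" using ab p uv(3) by (simp add: Lp_norm_le_iff)
  then show "Lp_norm p M (\<lambda>x. f x + g x) \<le> Lp_norm p M f + Lp_norm p M g + e"
    by (simp add: a_def b_def)
qed

lemma Lp_norm_minus_commute: "Lp_norm p M (\<lambda>x. f x - g x) = Lp_norm p M (\<lambda>x. g x - f x)"
  by (simp add: Lp_norm_def abs_minus_commute)

lemma Lp_norm_triangle_diff:
  assumes p: "1 < p" and f: "f \<in> Lp_space p M" and g: "g \<in> Lp_space p M" and h: "h \<in> Lp_space p M"
  shows "Lp_norm p M (\<lambda>x. f x - h x) \<le> Lp_norm p M (\<lambda>x. f x - g x) + Lp_norm p M (\<lambda>x. g x - h x)"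
  using Lp_norm_triangle[OF p Lp_space_diff[OF p f g] Lp_space_diff[OF p g h]] by simp

lemma Lp_norm_le_add_diff:
  assumes p: "1 < p" and f: "f \<in> Lp_space p M" and g: "g \<in> Lp_space p M"
  shows "Lp_norm p M f \<le> Lp_norm p M g + Lp_norm p M (\<lambda>x. f x - g x)"
  using Lp_norm_triangle[OF p g Lp_space_diff[OF p f g]] by simp

lemma Lp_norm_mono:
  assumes p: "1 < p" and f: "f \<in> borel_measurable M" and g: "g \<in> Lp_space p M" and le: "AE x in M. \<bar>f x\<bar> \<le> \<bar>g x\<bar>"
  shows "f \<in> Lp_space p M" "Lp_norm p M f \<le> Lp_norm p M g"
proof -
  note [measurable] = f
  have le': "AE x in M. \<bar>f x\<bar> powr p \<le> \<bar>g x\<bar> powr p"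
    using le by eventually_elim (use p in \<open>auto intro!: powr_mono2\<close>)
  have int: "integrable M (\<lambda>x. \<bar>f x\<bar> powr p)"
    by (rule Bochner_Integration.integrable_bound[OF Lp_spaceD(2)[OF g]]) (use le' in auto)
  then show "f \<in> Lp_space p M" using f by (simp add: Lp_space_def)
  show "Lp_norm p M f \<le> Lp_norm p M g"
    unfolding Lp_norm_def using p g int le'
    by (intro powr_mono2 Bochner_Integration.integral_nonneg integral_mono_AE) auto
qed

context prob_space
begin

lemma Lp_const: "(\<lambda>x. c) \<in> Lp_space p M"
  by (simp add: Lp_space_def)

lemma Lp_norm_const: "1 < p \<Longrightarrow> Lp_norm p M (\<lambda>x. c) = \<bar>c\<bar>"
  by (simp add: Lp_norm_def prob_space powr_powr)

lemma Lp_bounded: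
  assumes "1 < p" "f \<in> borel_measurable M" "AE x in M. \<bar>f x\<bar> \<le> B" "0 \<le> B"
  shows "f \<in> Lp_space p M" "Lp_norm p M f \<le> B"
  using Lp_norm_mono[OF assms(1,2) Lp_const[of B]] assms(3,4) by (simp_all add: Lp_norm_const assms(1))

lemma Lp_integrable:
  assumes p: "1 < p" and f: "f \<in> Lp_space p M" shows "integrable M f"
proof (rule Bochner_Integration.integrable_bound)
  show "integrable M (\<lambda>x. 1 + \<bar>f x\<bar> powr p)" using f by auto
  have "\<bar>a\<bar> \<le> 1 + \<bar>a\<bar> powr p" for a :: real
  proof (cases "\<bar>a\<bar> \<le> 1")
    case False
    then have "\<bar>a\<bar> powr 1 \<le> \<bar>a\<bar> powr p" using p by (intro powr_mono) auto
    then show ?thesis using False by simp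
  qed (simp add: add_increasing2)
  then show "AE x in M. norm (f x) \<le> norm (1 + \<bar>f x\<bar> powr p)" by auto
qed (use f in auto)

lemma abs_integral_le_Lp_norm:
  assumes p: "1 < p" and f: "f \<in> Lp_space p M"
  shows "\<bar>\<integral>x. f x \<partial>M\<bar> \<le> Lp_norm p M f"
proof -
  define c where "c = (\<integral>x. f x \<partial>M)"
  note int = Lp_integrable[OF p f] Lp_spaceD(2)[OF f]
  have "\<bar>c\<bar> powr p = (\<integral>x. \<bar>c\<bar> powr p + p * \<bar>c\<bar> powr (p - 1) * sgn c * (f x - c) \<partial>M)"
    using int by (simp add: prob_space c_def)
  also have "\<dots> \<le> (\<integral>x. \<bar>f x\<bar> powr p \<partial>M)"
    using int by (intro integral_mono abs_powr_tangent p) auto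
  finally have "\<bar>c\<bar> powr p \<le> Lp_norm p M f powr p" by (simp add: Lp_norm_powr p)
  then show ?thesis using p powr_less_mono2[of p "Lp_norm p M f" "\<bar>c\<bar>"] by (force simp: c_def not_le[symmetric])
qed

text \<open>Along a subsequence the increments have norm at most \<open>(1/2) ^ k\<close>. On a
  probability space the L^p norm dominates the integral, so the sum of the increments is finite
  almost everywhere and the subsequence converges there; Fatou's lemma carries the Cauchy bounds
  over to the limit.\<close>

theorem Lp_complete:
  fixes f :: "nat \<Rightarrow> 'a \<Rightarrow> real"
  assumes p: "1 < p" and f: "\<And>n. f n \<in> Lp_space p M"
    and cauchy: "\<And>e. e > 0 \<Longrightarrow> \<exists>N. \<forall>m\<ge>N. \<forall>n\<ge>N. Lp_norm p M (\<lambda>x. f m x - f n x) \<le> e"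
  obtains g where "g \<in> Lp_space p M" "(\<lambda>n. Lp_norm p M (\<lambda>x. f n x - g x)) \<longlonglongrightarrow> 0"
proof -
  note [measurable] = Lp_spaceD(1)[OF f]
  obtain N where N: "\<And>k m n. m \<ge> N k \<Longrightarrow> n \<ge> N k \<Longrightarrow> Lp_norm p M (\<lambda>x. f m x - f n x) \<le> (1/2) ^ k"
    using cauchy[of "(1/2) ^ k" for k] by (metis zero_less_power zero_less_divide_1_iff zero_less_numeral)
  \<comment> \<open>Partial sums of the \<open>N i\<close> give a nondecreasing sequence that lies
    beyond \<open>N k\<close> from index \<open>k\<close> on.\<close>
  define r where "r k = (\<Sum>i\<le>k. N i)" for k
  have rN: "N k \<le> r k" for k unfolding r_def by (rule member_le_sum) auto
  have r_mono: "r k \<le> r (Suc k)" for k by (simp add: r_def)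
  have rinf: "r l \<ge> N k" if "k \<le> l" for k l
    using lift_Suc_mono_le[of r, OF r_mono that] rN[of k] by simp
  define d where "d k x = \<bar>f (r (Suc k)) x - f (r k) x\<bar>" for k x
  have d0: "0 \<le> d k x" for k x by (simp add: d_def)
  have [measurable]: "d k \<in> borel_measurable M" for k unfolding d_def by measurable
  have dLp: "d k \<in> Lp_space p M" "Lp_norm p M (d k) \<le> (1/2) ^ k" for k
  proof -
    have "(\<lambda>x. f (r (Suc k)) x - f (r k) x) \<in> Lp_space p M" by (rule Lp_space_diff[OF p f f])
    then show "d k \<in> Lp_space p M" by (simp add: Lp_space_def d_def)
    have "Lp_norm p M (\<lambda>x. f (r (Suc k)) x - f (r k) x) \<le> (1/2) ^ k" by (rule N) (simp_all add: rinf)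
    then show "Lp_norm p M (d k) \<le> (1/2) ^ k" by (simp add: Lp_norm_def d_def)
  qed
  have "(\<integral>\<^sup>+x. (\<Sum>k. ennreal (d k x)) \<partial>M) = (\<Sum>k. \<integral>\<^sup>+x. ennreal (d k x) \<partial>M)"
    by (rule nn_integral_suminf) measurable
  also have "\<dots> \<le> (\<Sum>k. ennreal ((1/2) ^ k))"
  proof (rule suminf_le)
    fix k
    have "(\<integral>\<^sup>+x. ennreal (d k x) \<partial>M) = ennreal (\<integral>x. d k x \<partial>M)"
      by (rule nn_integral_eq_integral[OF Lp_integrable[OF p dLp(1)]]) (simp add: d0)
    also have "\<dots> \<le> ennreal ((1/2) ^ k)"
      using abs_integral_le_Lp_norm[OF p dLp(1), of k] dLp(2)[of k] by (intro ennreal_leI) auto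
    finally show "(\<integral>\<^sup>+x. ennreal (d k x) \<partial>M) \<le> ennreal ((1/2) ^ k)" .
  qed auto
  also have "\<dots> = ennreal (\<Sum>k. (1/2) ^ k)" by (rule suminf_ennreal2) (auto intro: summable_geometric)
  finally have "(\<integral>\<^sup>+x. (\<Sum>k. ennreal (d k x)) \<partial>M) \<noteq> \<infinity>"
    by (auto simp: top_unique)
  then have "AE x in M. (\<Sum>k. ennreal (d k x)) \<noteq> \<infinity>" by (intro nn_integral_PInf_AE) measurable
  then have AE_lim: "AE x in M. (\<lambda>k. f (r k) x) \<longlonglongrightarrow> lim (\<lambda>k. f (r k) x)"
  proof eventually_elim
    fix x assume "(\<Sum>k. ennreal (d k x)) \<noteq> \<infinity>"
    then have "summable (\<lambda>k. d k x)"
      unfolding infinity_ennreal_def by (rule summable_suminf_not_top[OF d0])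
    then have "summable (\<lambda>k. f (r (Suc k)) x - f (r k) x)"
      unfolding d_def by (rule summable_rabs_cancel)
    then have "convergent (\<lambda>k. f (r k) x)"
    proof -
      assume "summable (\<lambda>k. f (r (Suc k)) x - f (r k) x)"
      from summable_LIMSEQ[OF this]
      have "(\<lambda>k. f (r k) x - f (r 0) x) \<longlonglongrightarrow> (\<Sum>k. f (r (Suc k)) x - f (r k) x)"
        using sum_lessThan_telescope[of "\<lambda>k. f (r k) x"] by simp
      from tendsto_add[OF this tendsto_const[of "f (r 0) x"]] show ?thesis by (auto simp: convergent_def)
    qed
    then show "(\<lambda>k. f (r k) x) \<longlonglongrightarrow> lim (\<lambda>k. f (r k) x)" by (simp add: convergent_LIMSEQ_iff)
  qed
  define g where "g x = lim (\<lambda>k. f (r k) x)" for x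
  have gm [measurable]: "g \<in> borel_measurable M" unfolding g_def by measurable
  have key: "integrable M (\<lambda>x. \<bar>f n x - g x\<bar> powr p) \<and> Lp_norm p M (\<lambda>x. f n x - g x) \<le> (1/2) ^ j"
    if n: "n \<ge> N j" for n j
  proof -
    have AE: "AE x in M. liminf (\<lambda>k. ennreal (\<bar>f n x - f (r k) x\<bar> powr p)) = ennreal (\<bar>f n x - g x\<bar> powr p)"
      using AE_lim
    proof eventually_elim
      fix x assume lim: "(\<lambda>k. f (r k) x) \<longlonglongrightarrow> lim (\<lambda>k. f (r k) x)"
      have "(\<lambda>k. ennreal (\<bar>f n x - f (r k) x\<bar> powr p)) \<longlonglongrightarrow> ennreal (\<bar>f n x - g x\<bar> powr p)"
        using p by (intro tendsto_intros tendsto_powr' lim[folded g_def]) auto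
      then show "liminf (\<lambda>k. ennreal (\<bar>f n x - f (r k) x\<bar> powr p)) = ennreal (\<bar>f n x - g x\<bar> powr p)"
        by (intro lim_imp_Liminf) auto
    qed
    have "(\<integral>\<^sup>+x. ennreal (\<bar>f n x - g x\<bar> powr p) \<partial>M) = (\<integral>\<^sup>+x. liminf (\<lambda>k. ennreal (\<bar>f n x - f (r k) x\<bar> powr p)) \<partial>M)"
      by (rule nn_integral_cong_AE) (use AE in eventually_elim, simp)
    also have "\<dots> \<le> liminf (\<lambda>k. \<integral>\<^sup>+x. ennreal (\<bar>f n x - f (r k) x\<bar> powr p) \<partial>M)"
      by (rule nn_integral_liminf) measurable
    also have "\<dots> \<le> ennreal (((1/2) ^ j) powr p)"
    proof (rule Liminf_le)
      show "\<forall>\<^sub>F k in sequentially. (\<integral>\<^sup>+x. ennreal (\<bar>f n x - f (r k) x\<bar> powr p) \<partial>M) \<le> ennreal (((1/2) ^ j) powr p)"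
        using eventually_ge_at_top[of j]
      proof eventually_elim
        fix k assume k: "j \<le> k"
        have "Lp_norm p M (\<lambda>x. f n x - f (r k) x) \<le> (1/2) ^ j" using N[OF n rinf[OF k]] .
        then have "(\<integral>x. \<bar>f n x - f (r k) x\<bar> powr p \<partial>M) \<le> ((1/2) ^ j) powr p" using p by (simp add: Lp_norm_le_iff)
        then show "(\<integral>\<^sup>+x. ennreal (\<bar>f n x - f (r k) x\<bar> powr p) \<partial>M) \<le> ennreal (((1/2) ^ j) powr p)"
          using Lp_space_diff[OF p f f] by (subst nn_integral_eq_integral) (auto intro: ennreal_leI)
      qed
    qed simp
    finally have le: "(\<integral>\<^sup>+x. ennreal (\<bar>f n x - g x\<bar> powr p) \<partial>M) \<le> ennreal (((1/2) ^ j) powr p)" .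
    have int: "integrable M (\<lambda>x. \<bar>f n x - g x\<bar> powr p)"
      by (rule integrableI_nonneg) (use le in \<open>auto simp: top.extremum_strict intro: le_less_trans\<close>)
    then have "ennreal (\<integral>x. \<bar>f n x - g x\<bar> powr p \<partial>M) \<le> ennreal (((1/2) ^ j) powr p)"
      using le by (subst nn_integral_eq_integral[symmetric]) auto
    then have "(\<integral>x. \<bar>f n x - g x\<bar> powr p \<partial>M) \<le> ((1/2) ^ j) powr p" by (simp add: ennreal_le_iff)
    then show ?thesis using int p by (simp add: Lp_norm_le_iff)
  qed
  have "(\<lambda>x. f (N 0) x - g x) \<in> Lp_space p M" using key[of 0 "N 0"] by (simp add: Lp_space_def)
  from Lp_space_diff[OF p f[of "N 0"] this] have "g \<in> Lp_space p M" by simp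
  moreover have "(\<lambda>n. Lp_norm p M (\<lambda>x. f n x - g x)) \<longlonglongrightarrow> 0"
  proof (rule LIMSEQ_I)
    fix e :: real assume "e > 0"
    then obtain j where "(1/2) ^ j < e" using real_arch_pow_inv[of e "1/2"] by auto
    then show "\<exists>no. \<forall>n\<ge>no. norm (Lp_norm p M (\<lambda>x. f n x - g x) - 0) < e"
      using key[of j] by (intro exI[of _ "N j"]) (auto intro: le_less_trans)
  qed
  ultimately show thesis using that by blast
qed

end

section \<open>Total boundedness and density of bounded continuous functions\<close>

text \<open>Stated for a pseudodistance on indices, since the L^p seminorm puts no metric on
  functions. At level \<open>n\<close> infinitely many terms lie within \<open>1 / (n + 1)\<close>
  of one of finitely many indices; a diagonal sequence combines the levels.\<close>

lemma totally_bounded_Cauchy_subsequence: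
  fixes d :: "nat \<Rightarrow> nat \<Rightarrow> real"
  assumes sym: "\<And>m n. d m n = d n m" and tri: "\<And>m n k. d m n \<le> d m k + d k n"
    and tb: "\<And>e. e > 0 \<Longrightarrow> \<exists>F. finite F \<and> (\<forall>n. \<exists>m\<in>F. d n m \<le> e)"
  obtains k :: "nat \<Rightarrow> nat" where "strict_mono k" "\<And>e. e > 0 \<Longrightarrow> \<exists>N. \<forall>m\<ge>N. \<forall>n\<ge>N. d (k m) (k n) \<le> e"
proof -
  define P where "P n s \<longleftrightarrow> (\<forall>i j. d (s i) (s j) \<le> 2 / real (Suc n))" for n and s :: "nat \<Rightarrow> nat"
  interpret subseqs P
  proof
    fix n and s :: "nat \<Rightarrow> nat"
    obtain F where F: "finite F" "\<And>n'. \<exists>m\<in>F. d n' m \<le> 1 / real (Suc n)"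
      using tb[of "1 / real (Suc n)"] by auto
    then have "\<forall>i. \<exists>m. m \<in> F \<and> d (s i) m \<le> 1 / real (Suc n)" by blast
    then obtain c where c: "\<And>i. c i \<in> F" "\<And>i. d (s i) (c i) \<le> 1 / real (Suc n)" by metis
    have "finite (c ` UNIV)" using c(1) F(1) by (meson finite_subset image_subsetI)
    then obtain i0 where "infinite {i \<in> UNIV. c i = c i0}"
      using pigeonhole_infinite[of "UNIV :: nat set" c] by auto
    then obtain r :: "nat \<Rightarrow> nat" where "strict_mono r \<and> (\<forall>i. r i \<in> {i \<in> UNIV. c i = c i0})"
      using infinite_enumerate by meson
    then have r: "strict_mono r" "\<And>i. c (r i) = c i0" by auto
    have "2 / real (Suc n) = 1 / real (Suc n) + 1 / real (Suc n)" by (simp add: add_divide_distrib[symmetric])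
    then have "d (s (r i)) (s (r j)) \<le> 2 / real (Suc n)" for i j
      using tri[of "s (r i)" "s (r j)" "c i0"] c(2)[of "r i"] c(2)[of "r j"] sym[of "c i0" "s (r j)"]
      unfolding r(2) by linarith
    then show "\<exists>r. strict_mono r \<and> P n (s \<circ> r)" using r(1) by (auto simp: P_def)
  qed
  \<comment> \<open>The diagonal sequence is a subsequence of the one at level \<open>k\<close> only
    from index \<open>Suc k\<close> on, hence the shift.\<close>
  have holds: "P k (diagseq \<circ> ((+) (Suc k)))" for k
    by (rule diagseq_holds) (auto simp: P_def)
  show thesis
  proof (rule that[OF subseq_diagseq])
    fix e :: real assume e: "e > 0"
    obtain K where "1 / real (Suc K) < e / 2" using e reals_Archimedean[of "e / 2"] by (auto simp: inverse_eq_divide)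
    then have K: "2 / real (Suc K) \<le> e" by (simp add: field_simps)
    show "\<exists>N. \<forall>m\<ge>N. \<forall>n\<ge>N. d (diagseq m) (diagseq n) \<le> e"
    proof (intro exI[of _ "Suc K"] allI impI)
      fix m n assume "Suc K \<le> m" "Suc K \<le> n"
      then have mn: "m = Suc K + (m - Suc K)" "n = Suc K + (n - Suc K)" by simp_all
      have "d (diagseq (Suc K + (m - Suc K))) (diagseq (Suc K + (n - Suc K))) \<le> 2 / real (Suc K)"
        using holds[of K] unfolding P_def comp_def by blast
      then show "d (diagseq m) (diagseq n) \<le> e"
        unfolding mn[symmetric] using K by linarith
    qed
  qed
qed

text \<open>Regularity of \<open>M\<close> places \<open>A\<close> between a compact
  \<open>K\<close> and an open \<open>U\<close>, each within \<open>e powr p / 2\<close> of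
  \<open>A\<close> in measure. A Urysohn function differs from the indicator of \<open>A\<close> by
  at most 1, and only on \<open>U - K\<close>.\<close>

lemma indicator_approx_bcontfun:
  fixes M :: "'a::euclidean_space measure"
  assumes prob: "prob_space M" and M: "sets M = sets borel" and A: "A \<in> sets borel" and p: "1 < p" and e: "e > 0"
  shows "\<exists>\<phi> :: 'a \<Rightarrow>\<^sub>C real. Lp_norm p M (\<lambda>x. apply_bcontfun \<phi> x - indicator A x) \<le> e"
proof -
  interpret prob_space M by (rule prob)
  have [measurable]: "A \<in> sets M" using M A by simp
  have sp: "space M = UNIV" using sets_eq_imp_space_eq[OF M] by simp
  define d where "d = e powr p / 2"
  have d: "d > 0" using e by (simp add: d_def)
  have ne: "{K. K \<subseteq> A \<and> compact K} \<noteq> {}" using compact_empty by blast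
  obtain K where K: "K \<subseteq> A" "compact K" "emeasure M A < emeasure M K + ennreal d"
    using SUP_approx_ennreal[OF d ne inner_regular[OF M _ A]] by auto
  obtain U where U: "A \<subseteq> U" "open U" "emeasure M U < emeasure M A + ennreal d"
    using INF_approx_ennreal[OF d outer_regular[OF M _ A]] by auto
  have [measurable]: "K \<in> sets M" "U \<in> sets M" using K(2) U(2) M by (auto simp: borel_compact)
  have mUK: "measure M (U - K) \<le> e powr p"
  proof -
    have "measure M A < measure M K + d" "measure M U < measure M A + d"
      using K(3) U(3) d by (simp_all add: emeasure_eq_measure ennreal_plus[symmetric] ennreal_less_iff del: ennreal_plus)
    moreover have "measure M (U - K) = measure M U - measure M K"
      using K(1) U(1) by (intro finite_measure_Diff) auto
    ultimately show ?thesis by (simp add: d_def)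
  qed
  obtain f :: "'a \<Rightarrow> real" where f: "continuous_on UNIV f" "\<And>x. f x \<in> closed_segment 1 0"
      "\<And>x. x \<in> K \<Longrightarrow> f x = 1" "\<And>x. x \<in> - U \<Longrightarrow> f x = 0"
    using Urysohn[of K "- U" "1::real" 0] K U by (auto simp: compact_imp_closed)
  have f01: "0 \<le> f x" "f x \<le> 1" for x using f(2)[of x] by (auto simp: closed_segment_eq_real_ivl)
  have "f \<in> bcontfun" by (rule bcontfun_normI[OF f(1), of 1]) (use f01 in auto)
  then have ap: "apply_bcontfun (Bcontfun f) = f" by (rule Bcontfun_inverse)
  have [measurable]: "f \<in> borel_measurable M"
    using f(1) by (simp add: measurable_cong_sets[OF M refl] borel_measurable_continuous_onI)
  have le: "\<bar>f x - indicator A x\<bar> powr p \<le> indicator (U - K) x" for x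
  proof (cases "x \<in> U - K")
    case True
    have "\<bar>f x - indicator A x\<bar> powr p \<le> 1 powr p"
      using f01[of x] p by (intro powr_mono2) (auto simp: indicator_def)
    then show ?thesis using True by simp
  next
    case False
    then have "f x = indicator A x" using f(3,4)[of x] K(1) U(1) by (auto simp: indicator_def)
    then show ?thesis by simp
  qed
  have "(\<integral>x. \<bar>f x - indicator A x\<bar> powr p \<partial>M) \<le> (\<integral>x. indicator (U - K) x \<partial>M)"
  proof (rule integral_mono)
    show "integrable M (\<lambda>x. \<bar>f x - indicator A x\<bar> powr p)"
      by (rule integrable_const_bound[of _ 1]) (use le in \<open>auto intro!: AE_I2 order_trans[OF le] simp: indicator_le_1\<close>)
    show "integrable M (indicator (U - K) :: 'a \<Rightarrow> real)"
      by (rule integrable_real_indicator) (auto simp: emeasure_eq_measure)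
  qed (rule le)
  also have "\<dots> \<le> e powr p" using mUK by simp
  finally show ?thesis using p e ap by (intro exI[of _ "Bcontfun f"]) (simp add: Lp_norm_le_iff)
qed

theorem bcontfun_dense_Lp:
  fixes M :: "'a::euclidean_space measure"
  assumes prob: "prob_space M" and M: "sets M = sets borel" and p: "1 < p" and f: "f \<in> Lp_space p M" and e: "e > 0"
  shows "\<exists>\<phi>. Lp_norm p M (\<lambda>x. apply_bcontfun \<phi> x - f x) \<le> e"
proof -
  interpret prob_space M by (rule prob)
  have sp: "space M = UNIV" using sets_eq_imp_space_eq[OF M] by simp
  have bc: "apply_bcontfun \<phi> \<in> Lp_space p M" for \<phi> :: "'a \<Rightarrow>\<^sub>C real"
    by (rule Lp_bounded(1)[OF p, of _ "norm \<phi>"])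
       (auto simp: abs_bcontfun_le measurable_cong_sets[OF M refl] intro!: borel_measurable_continuous_onI)
  define D where "D g \<longleftrightarrow> g \<in> Lp_space p M \<and>
    (\<forall>e>0. \<exists>\<phi>. Lp_norm p M (\<lambda>x. apply_bcontfun \<phi> x - g x) \<le> e)" for g :: "'a \<Rightarrow> real"
  have D_add: "D (\<lambda>x. g x + h x)" if g: "D g" and h: "D h" for g h
    unfolding D_def
  proof (intro conjI allI impI)
    show gh: "(\<lambda>x. g x + h x) \<in> Lp_space p M" using g h p by (auto simp: D_def intro: Lp_space_add)
    fix e :: real assume "e > 0"
    then obtain \<phi> \<psi> where \<phi>: "Lp_norm p M (\<lambda>x. apply_bcontfun \<phi> x - g x) \<le> e / 2"
        and \<psi>: "Lp_norm p M (\<lambda>x. apply_bcontfun \<psi> x - h x) \<le> e / 2"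
      using g h unfolding D_def by (meson half_gt_zero)
    have "Lp_norm p M (\<lambda>x. (apply_bcontfun \<phi> x - g x) + (apply_bcontfun \<psi> x - h x)) \<le> e"
      using Lp_norm_triangle[OF p Lp_space_diff[OF p bc] Lp_space_diff[OF p bc], of g h \<phi> \<psi>] g h \<phi> \<psi> by (simp add: D_def)
    then show "\<exists>\<phi>. Lp_norm p M (\<lambda>x. apply_bcontfun \<phi> x - (g x + h x)) \<le> e"
      by (intro exI[of _ "\<phi> + \<psi>"]) (simp add: algebra_simps)
  qed
  have D_cmult: "D (\<lambda>x. c * g x)" if g: "D g" for c g
    unfolding D_def
  proof (intro conjI allI impI)
    show "(\<lambda>x. c * g x) \<in> Lp_space p M" using g by (auto simp: D_def intro: Lp_space_cmult)
    fix e :: real assume e: "e > 0"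
    then obtain \<phi> where \<phi>: "Lp_norm p M (\<lambda>x. apply_bcontfun \<phi> x - g x) \<le> e / (\<bar>c\<bar> + 1)"
      using g unfolding D_def by (meson abs_ge_zero add_nonneg_pos divide_pos_pos zero_less_one)
    have "Lp_norm p M (\<lambda>x. c * (apply_bcontfun \<phi> x - g x)) = \<bar>c\<bar> * Lp_norm p M (\<lambda>x. apply_bcontfun \<phi> x - g x)"
      by (rule Lp_norm_cmult[OF p])
    also have "\<dots> \<le> (\<bar>c\<bar> + 1) * (e / (\<bar>c\<bar> + 1))" using \<phi> e by (intro mult_mono) auto
    also have "\<dots> = e" by (metis abs_ge_zero add_nonneg_pos less_irrefl nonzero_mult_div_cancel_left times_divide_eq_right zero_less_one)
    finally show "\<exists>\<phi>. Lp_norm p M (\<lambda>x. apply_bcontfun \<phi> x - c * g x) \<le> e"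
      by (intro exI[of _ "c *\<^sub>R \<phi>"]) (simp add: algebra_simps)
  qed
  have D_ind: "D (indicator A)" if "A \<in> sets borel" for A
    unfolding D_def using indicator_approx_bcontfun[OF prob M that p] that M
    by (auto intro!: Lp_bounded(1)[OF p, of _ 1])
  have D_sum: "finite S \<Longrightarrow> (\<And>y. A y \<in> sets borel) \<Longrightarrow> D (\<lambda>x. \<Sum>y\<in>S. y * indicator (A y) x)" for S :: "real set" and A
  proof (induction S rule: finite_induct)
    case empty
    then show ?case using D_cmult[OF D_ind[of "{}"], of 0] by simp
  next
    case (insert y S)
    show ?case
      unfolding sum.insert[OF insert.hyps]
      by (rule D_add[OF D_cmult[OF D_ind[OF insert.prems]] insert.IH[OF insert.prems]])
  qed
  have D_simple: "D g" if g: "simple_function M g" for g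
  proof -
    have "D (\<lambda>x. \<Sum>y\<in>range g. y * indicator (g -` {y}) x)"
      using g simple_functionD[OF g] by (intro D_sum) (auto simp: sp M)
    moreover have "(\<Sum>y\<in>range g. y * indicator (g -` {y}) x) = g x" for x
    proof -
      have "(\<Sum>y\<in>range g. y * indicator (g -` {y}) x) = (\<Sum>y\<in>range g. if y = g x then y else 0)"
        by (intro sum.cong refl) (auto simp: indicator_def)
      then show ?thesis using simple_functionD(1)[OF g] by (simp add: sp)
    qed
    ultimately show ?thesis by simp
  qed
  obtain F where F: "\<And>i. simple_function M (F i)" "\<And>x. (\<lambda>i. F i x) \<longlonglongrightarrow> f x" "\<And>i x. \<bar>F i x\<bar> \<le> 2 * \<bar>f x\<bar>"
    using borel_measurable_implies_sequence_metric[OF Lp_spaceD(1)[OF f], of 0] by (auto simp: sp)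
  note [measurable] = Lp_spaceD(1)[OF f] borel_measurable_simple_function[OF F(1)]
  have "(\<lambda>i. \<integral>x. \<bar>F i x - f x\<bar> powr p \<partial>M) \<longlonglongrightarrow> (\<integral>x. 0 \<partial>M)"
  proof (rule integral_dominated_convergence)
    \<comment> \<open>The simple functions are bounded by \<open>2 * |f|\<close>, so their distance
      to \<open>f\<close> is at most \<open>3 * |f|\<close>.\<close>
    show "integrable M (\<lambda>x. \<bar>3 * f x\<bar> powr p)" using Lp_space_cmult[OF f, of 3] by auto
    show "AE x in M. (\<lambda>i. \<bar>F i x - f x\<bar> powr p) \<longlonglongrightarrow> 0"
    proof (rule AE_I2)
      fix x
      have "(\<lambda>i. \<bar>F i x - f x\<bar> powr p) \<longlonglongrightarrow> \<bar>f x - f x\<bar> powr p"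
        using p by (intro tendsto_powr' tendsto_intros F(2)) auto
      then show "(\<lambda>i. \<bar>F i x - f x\<bar> powr p) \<longlonglongrightarrow> 0" by simp
    qed
    show "AE x in M. norm (\<bar>F i x - f x\<bar> powr p) \<le> \<bar>3 * f x\<bar> powr p" for i
    proof (rule AE_I2)
      fix x show "norm (\<bar>F i x - f x\<bar> powr p) \<le> \<bar>3 * f x\<bar> powr p"
        using F(3)[of i x] p by (simp add: abs_mult) (intro powr_mono2, auto)
    qed
  qed measurable
  then have "(\<lambda>i. \<integral>x. \<bar>F i x - f x\<bar> powr p \<partial>M) \<longlonglongrightarrow> 0" by simp
  then obtain i where "\<bar>\<integral>x. \<bar>F i x - f x\<bar> powr p \<partial>M\<bar> < (e / 2) powr p"
    using e LIMSEQ_D[of _ 0 "(e / 2) powr p"] by fastforce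
  then have i: "Lp_norm p M (\<lambda>x. F i x - f x) \<le> e / 2" using e p by (subst Lp_norm_le_iff) auto
  obtain \<phi> where "Lp_norm p M (\<lambda>x. apply_bcontfun \<phi> x - F i x) \<le> e / 2"
    using D_simple[OF F(1)[of i]] e unfolding D_def by (meson half_gt_zero)
  then have "Lp_norm p M (\<lambda>x. apply_bcontfun \<phi> x - f x) \<le> e"
    using Lp_norm_triangle_diff[OF p bc _ f, of "F i" \<phi>] D_simple[OF F(1)[of i]] i by (simp add: D_def)
  then show ?thesis by blast
qed

section \<open>The evolution operator in $L^p$\<close>

context periodic_evolution
begin

section \<open>Contractivity in L^p and the oscillation estimate\<close>

lemma bcontfun_in_Lp: "1 < p \<Longrightarrow> apply_bcontfun \<phi> \<in> Lp_space p (\<mu> s)"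
  and Lp_norm_bcontfun_le: "1 < p \<Longrightarrow> Lp_norm p (\<mu> s) (apply_bcontfun \<phi>) \<le> norm \<phi>"
  for \<phi> :: "(real^'n) \<Rightarrow>\<^sub>C real"
proof -
  interpret prob_space "\<mu> s" by (rule prob_space_\<mu>)
  show "1 < p \<Longrightarrow> apply_bcontfun \<phi> \<in> Lp_space p (\<mu> s)"
    and "1 < p \<Longrightarrow> Lp_norm p (\<mu> s) (apply_bcontfun \<phi>) \<le> norm \<phi>"
    by (rule Lp_bounded[of p _ "norm \<phi>"]; simp add: abs_bcontfun_le)+
qed

definition abs_powr_bcontfun :: "real \<Rightarrow> ((real^'n) \<Rightarrow>\<^sub>C real) \<Rightarrow> ((real^'n) \<Rightarrow>\<^sub>C real)" where
  "abs_powr_bcontfun p \<phi> = Bcontfun (\<lambda>x. \<bar>apply_bcontfun \<phi> x\<bar> powr p)"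

lemma apply_abs_powr_bcontfun:
  "1 < p \<Longrightarrow> apply_bcontfun (abs_powr_bcontfun p \<phi>) x = \<bar>apply_bcontfun \<phi> x\<bar> powr p"
  unfolding abs_powr_bcontfun_def
  by (subst bcontfun_compose[where f = "\<lambda>t. \<bar>t\<bar> powr p"])
     (auto intro!: continuous_on_powr' continuous_on_rabs continuous_on_id continuous_on_const)

lemma mean_abs_powr_bcontfun: "1 < p \<Longrightarrow> mean s (abs_powr_bcontfun p \<phi>) = Lp_norm p (\<mu> s) (apply_bcontfun \<phi>) powr p"
  by (simp add: mean_def apply_abs_powr_bcontfun Lp_norm_powr)

text \<open>Instead of a representing kernel, the tangent of \<open>|.|^p\<close> at
  \<open>c = (G \<phi>)(x)\<close> is used. Positivity, linearity and preservation of constants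
  carry the tangent inequality through \<open>G\<close>, and at the point \<open>x\<close> itself
  the linear term cancels.\<close>

lemma G_jensen:
  assumes p: "1 < p" and st: "s \<le> t"
  shows "\<bar>apply_bcontfun (G t s \<phi>) x\<bar> powr p \<le> apply_bcontfun (G t s (abs_powr_bcontfun p \<phi>)) x"
proof -
  define c where "c = apply_bcontfun (G t s \<phi>) x"
  define k where "k = p * \<bar>c\<bar> powr (p - 1) * sgn c"
  have "apply_bcontfun (G t s (const_bcontfun (\<bar>c\<bar> powr p - k * c) + k *\<^sub>R \<phi>)) x
      \<le> apply_bcontfun (G t s (abs_powr_bcontfun p \<phi>)) x"
  proof (rule G_mono[OF st])
    fix y
    show "apply_bcontfun (const_bcontfun (\<bar>c\<bar> powr p - k * c) + k *\<^sub>R \<phi>) y \<le> apply_bcontfun (abs_powr_bcontfun p \<phi>) y"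
      using abs_powr_tangent[OF p, of c "apply_bcontfun \<phi> y"]
      unfolding k_def[symmetric] by (simp add: apply_abs_powr_bcontfun p algebra_simps)
  qed
  then show ?thesis using st by (simp add: G_add G_scaleR G_const c_def)
qed

lemma G_Lp_contraction:
  assumes p: "1 < p" and st: "s \<le> t"
  shows "Lp_norm p (\<mu> t) (apply_bcontfun (G t s \<phi>)) \<le> Lp_norm p (\<mu> s) (apply_bcontfun \<phi>)"
proof -
  have "mean t (abs_powr_bcontfun p (G t s \<phi>)) \<le> mean t (G t s (abs_powr_bcontfun p \<phi>))"
    using G_jensen[OF p st] by (intro mean_mono) (simp add: apply_abs_powr_bcontfun p)
  also have "\<dots> = mean s (abs_powr_bcontfun p \<phi>)" by (rule mean_G[OF st])
  finally show ?thesis using p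
    by (subst Lp_norm_le_iff) (auto simp: mean_abs_powr_bcontfun Lp_norm_powr)
qed

text \<open>The functional \<open>\<ell> = (G \<cdot>)(x) - (G \<cdot>)(y)\<close> is small in the sup norm and dominated by
  \<open>L = (G \<cdot>)(x) + (G \<cdot>)(y)\<close>. Truncating \<open>\<phi>\<close> at height \<open>h\<close> gives \<open>|\<ell> \<phi>| \<le> \<epsilon> h + h\<^bsup>1-p\<^esup> L |\<phi>|\<^sup>p\<close>,
  and \<open>h\<close> is chosen so that both terms agree.\<close>

lemma G_oscillation:
  assumes p: "1 < p" and st: "s \<le> t" and e: "\<epsilon> > 0"
    and osc: "\<And>\<psi>. \<bar>apply_bcontfun (G t s \<psi>) x - apply_bcontfun (G t s \<psi>) y\<bar> \<le> \<epsilon> * norm \<psi>"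
  shows "\<bar>apply_bcontfun (G t s \<phi>) x - apply_bcontfun (G t s \<phi>) y\<bar> powr p
    \<le> 2 powr p * \<epsilon> powr (p - 1) *
      (apply_bcontfun (G t s (abs_powr_bcontfun p \<phi>)) x + apply_bcontfun (G t s (abs_powr_bcontfun p \<phi>)) y)"
proof -
  let ?v = apply_bcontfun
  define l where "l = \<bar>?v (G t s \<phi>) x - ?v (G t s \<phi>) y\<bar>"
  define L where "L = ?v (G t s (abs_powr_bcontfun p \<phi>)) x + ?v (G t s (abs_powr_bcontfun p \<phi>)) y"
  have L0: "0 \<le> L" unfolding L_def
    by (intro add_nonneg_nonneg G_nonneg[OF st]) (simp_all add: apply_abs_powr_bcontfun p)
  have trunc: "l \<le> \<epsilon> * h + h powr (1 - p) * L" if h: "h > 0" for h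
  proof -
    define \<psi> where "\<psi> = Bcontfun (\<lambda>x. max (- h) (min h (?v \<phi> x)))"
    have \<psi>: "?v \<psi> x = max (- h) (min h (?v \<phi> x))" for x
      unfolding \<psi>_def by (subst bcontfun_compose[where f = "\<lambda>t. max (- h) (min h t)"]) (auto intro!: continuous_intros)
    have n\<psi>: "norm \<psi> \<le> h" using h by (intro norm_bcontfun_leI) (auto simp: \<psi>)
    have diff: "\<bar>?v \<phi> z - ?v \<psi> z\<bar> \<le> h powr (1 - p) * \<bar>?v \<phi> z\<bar> powr p" for z
    proof (cases "\<bar>?v \<phi> z\<bar> \<le> h")
      case True
      then have "?v \<psi> z = ?v \<phi> z" by (auto simp: \<psi>)
      then show ?thesis by simp
    next
      case False
      then have "\<bar>?v \<phi> z - ?v \<psi> z\<bar> \<le> \<bar>?v \<phi> z\<bar>" using h by (auto simp: \<psi> max_def min_def)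
      also have "\<dots> = \<bar>?v \<phi> z\<bar> powr (1 - p) * \<bar>?v \<phi> z\<bar> powr p"
        using False h by (simp add: powr_add[symmetric])
      also have "\<dots> \<le> h powr (1 - p) * \<bar>?v \<phi> z\<bar> powr p"
        using False h p by (intro mult_right_mono powr_mono2') auto
      finally show ?thesis .
    qed
    have rest: "\<bar>?v (G t s \<phi>) z - ?v (G t s \<psi>) z\<bar> \<le> h powr (1 - p) * ?v (G t s (abs_powr_bcontfun p \<phi>)) z" for z
    proof -
      have "?v (G t s (\<phi> - \<psi>)) z \<le> ?v (G t s (h powr (1 - p) *\<^sub>R abs_powr_bcontfun p \<phi>)) z"
        using diff by (intro G_mono[OF st]) (auto simp: apply_abs_powr_bcontfun p abs_le_iff)
      moreover have "?v (G t s (\<psi> - \<phi>)) z \<le> ?v (G t s (h powr (1 - p) *\<^sub>R abs_powr_bcontfun p \<phi>)) z"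
        using diff by (intro G_mono[OF st]) (auto simp: apply_abs_powr_bcontfun p abs_le_iff)
      ultimately show ?thesis using st by (simp add: G_diff G_scaleR abs_le_iff)
    qed
    have "\<bar>?v (G t s \<psi>) x - ?v (G t s \<psi>) y\<bar> \<le> \<epsilon> * h"
      using osc[of \<psi>] mult_left_mono[OF n\<psi>, of \<epsilon>] e by linarith
    then show ?thesis using rest[of x] rest[of y] unfolding l_def L_def distrib_left by linarith
  qed
  \<comment> \<open>The balancing height needs a positive quantity and \<open>L\<close> may vanish;
    the estimate is therefore proved for any positive \<open>L' \<ge> L\<close>, and the slack is
    removed afterwards.\<close>
  have bound: "l powr p \<le> 2 powr p * \<epsilon> powr (p - 1) * L'" if L': "L \<le> L'" "0 < L'" for L'
  proof -
    define h where "h = (L' / \<epsilon>) powr (1 / p)"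
    have h: "h > 0" using L' e by (simp add: h_def)
    have hp: "h powr p = L' / \<epsilon>" using p L' e by (simp add: h_def powr_powr)
    have "h powr (1 - p) * L' = h * (L' / h powr p)" using h by (simp add: powr_diff)
    also have "\<dots> = \<epsilon> * h" using L' e by (simp add: hp)
    finally have "h powr (1 - p) * L' = \<epsilon> * h" .
    moreover have "h powr (1 - p) * L \<le> h powr (1 - p) * L'" using L' by (intro mult_left_mono) auto
    ultimately have "l \<le> 2 * (\<epsilon> * h)" using trunc[OF h] by simp
    then have "l powr p \<le> (2 * (\<epsilon> * h)) powr p" using p by (intro powr_mono2) (auto simp: l_def)
    also have "\<dots> = 2 powr p * (\<epsilon> powr p * (L' / \<epsilon>))" using e h by (simp add: powr_mult hp)
    also have "\<epsilon> powr p * (L' / \<epsilon>) = \<epsilon> powr (p - 1) * L'" using e by (simp add: powr_diff)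
    finally show ?thesis by (simp add: mult.assoc)
  qed
  have "l powr p \<le> 2 powr p * \<epsilon> powr (p - 1) * L"
  proof (rule field_le_epsilon)
    fix d :: real assume d: "d > 0"
    define A where "A = 2 powr p * \<epsilon> powr (p - 1)"
    have A: "A > 0" using e by (simp add: A_def)
    have "l powr p \<le> A * (L + d / A)"
      unfolding A_def by (rule bound) (use L0 d A in \<open>auto simp: A_def[symmetric] add_nonneg_pos\<close>)
    then show "l powr p \<le> 2 powr p * \<epsilon> powr (p - 1) * L + d"
      using A by (simp add: A_def[symmetric] distrib_left)
  qed
  then show ?thesis by (simp add: l_def L_def)
qed

section \<open>Total boundedness of images of L^p bounded sets\<close>

text \<open>A point is labelled by the values at it of a finite \<open>\<delta>\<close>-net of the
  image of the unit ball, rounded down in units of \<open>\<delta> = \<epsilon> / 3\<close>. At two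
  points with the same label each net function differs by at most \<open>\<delta>\<close>, and
  replacing \<open>G \<psi>\<close> by a net function costs \<open>\<delta>\<close> at each
  point.\<close>

lemma oscillation_partition:
  assumes st: "s < t" and e: "\<epsilon> > 0"
  obtains \<kappa> :: "real^'n \<Rightarrow> ((real^'n) \<Rightarrow>\<^sub>C real) \<Rightarrow> int" where
    "finite (range \<kappa>)" "\<And>i. \<kappa> -` {i} \<in> sets borel"
    "\<And>x y \<psi>. \<kappa> x = \<kappa> y \<Longrightarrow> \<bar>apply_bcontfun (G t s \<psi>) x - apply_bcontfun (G t s \<psi>) y\<bar> \<le> \<epsilon> * norm \<psi>"
proof -
  let ?v = apply_bcontfun
  define \<delta> where "\<delta> = \<epsilon> / 3"
  have \<delta>: "\<delta> > 0" using e by (simp add: \<delta>_def)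
  have "compact (closure (G t s ` cball 0 1))" using compact[OF st] by (auto simp: compact_operator_def)
  then obtain F where F: "finite F" "closure (G t s ` cball 0 1) \<subseteq> (\<Union>g\<in>F. ball g \<delta>)"
    using \<delta> unfolding compact_eq_totally_bounded by blast
  define \<kappa> where "\<kappa> x = (\<lambda>g\<in>F. \<lfloor>?v g x / \<delta>\<rfloor>)" for x
  have "range \<kappa> \<subseteq> PiE F (\<lambda>g. {\<lfloor>- norm g / \<delta>\<rfloor>..\<lfloor>norm g / \<delta>\<rfloor>})"
  proof (intro subsetI PiE_I)
    fix k g assume k: "k \<in> range \<kappa>" and g: "g \<in> F"
    then obtain x where x: "k = \<kappa> x" by blast
    have "- norm g / \<delta> \<le> ?v g x / \<delta>" "?v g x / \<delta> \<le> norm g / \<delta>"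
      using abs_bcontfun_le[of g x] \<delta> by (intro divide_right_mono; linarith)+
    then show "k g \<in> {\<lfloor>- norm g / \<delta>\<rfloor>..\<lfloor>norm g / \<delta>\<rfloor>}" using g by (auto simp: x \<kappa>_def intro: floor_mono)
  qed (auto simp: \<kappa>_def)
  then have fin: "finite (range \<kappa>)" by (rule finite_subset) (intro finite_PiE F(1) finite_atLeastAtMost_int)
  have meas: "\<kappa> -` {i} \<in> sets borel" for i
  proof (cases "i \<in> extensional F")
    case True
    then have "\<kappa> -` {i} = {x. \<forall>g\<in>F. \<lfloor>?v g x / \<delta>\<rfloor> = i g}"
      by (auto simp: \<kappa>_def fun_eq_iff extensional_def)
    also have "\<dots> \<in> sets borel"
    proof -
      have "{x \<in> space borel. \<forall>g\<in>F. \<lfloor>?v g x / \<delta>\<rfloor> = i g} \<in> sets borel"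
      proof (rule sets.sets_Collect_finite_All[OF _ F(1)])
        fix g
        have "{x \<in> space borel. \<lfloor>?v g x / \<delta>\<rfloor> = i g}
            = {x \<in> space borel. of_int (i g) \<le> ?v g x / \<delta> \<and> ?v g x / \<delta> < of_int (i g) + 1}"
          by (auto simp: floor_eq_iff)
        also have "\<dots> \<in> sets borel" by measurable
        finally show "{x \<in> space borel. \<lfloor>?v g x / \<delta>\<rfloor> = i g} \<in> sets borel" .
      qed
      then show ?thesis by simp
    qed
    finally show ?thesis .
  next
    case False
    then have "\<kappa> -` {i} = {}" by (auto simp: \<kappa>_def)
    then show ?thesis by simp
  qed
  have osc: "\<bar>?v (G t s \<psi>) x - ?v (G t s \<psi>) y\<bar> \<le> \<epsilon> * norm \<psi>" if xy: "\<kappa> x = \<kappa> y" for x y \<psi>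
  proof -
    have unit: "\<bar>?v (G t s \<psi>) x - ?v (G t s \<psi>) y\<bar> \<le> \<epsilon>" if "norm \<psi> \<le> 1" for \<psi>
    proof -
      have "G t s \<psi> \<in> closure (G t s ` cball 0 1)"
        using that closure_subset[of "G t s ` cball 0 1"] by auto
      then obtain g where g: "g \<in> F" "dist g (G t s \<psi>) < \<delta>" using F(2) by auto
      have near: "\<bar>?v g z - ?v (G t s \<psi>) z\<bar> \<le> \<delta>" for z
        using dist_bounded[of g z "G t s \<psi>"] g(2) by (simp add: dist_real_def)
      have "\<lfloor>?v g x / \<delta>\<rfloor> = \<lfloor>?v g y / \<delta>\<rfloor>"
        using fun_cong[OF xy, of g] g(1) by (simp add: \<kappa>_def)
      then have "\<bar>?v g x / \<delta> - ?v g y / \<delta>\<bar> \<le> 1" by linarith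
      then have "\<bar>?v g x - ?v g y\<bar> \<le> \<delta>" using \<delta> by (simp add: diff_divide_distrib[symmetric] abs_divide)
      then show ?thesis using near[of x] near[of y] \<delta>_def by linarith
    qed
    show ?thesis
    proof (cases "\<psi> = 0")
      case True
      then show ?thesis using linear_0[OF linear_G[of s t]] st by simp
    next
      case False
      have "\<bar>?v (G t s ((1 / norm \<psi>) *\<^sub>R \<psi>)) x - ?v (G t s ((1 / norm \<psi>) *\<^sub>R \<psi>)) y\<bar> \<le> \<epsilon>"
        by (rule unit) (use False in simp)
      then have "\<bar>(?v (G t s \<psi>) x - ?v (G t s \<psi>) y) / norm \<psi>\<bar> \<le> \<epsilon>"
        using st by (simp add: G_scaleR diff_divide_distrib)
      then show ?thesis using False by (simp add: abs_divide divide_le_eq mult.commute)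
    qed
  qed
  show thesis by (rule that[OF fin meas osc])
qed

text \<open>A sampling point at which \<open>h\<close> does not exceed its mean over
  \<open>A\<close>; multiplying by the measure of \<open>A\<close> instead of dividing lets null
  sets be included.\<close>

lemma exists_le_average:
  assumes A: "A \<in> sets (\<mu> t)" "A \<noteq> {}" and h: "integrable (\<mu> t) h"
  shows "\<exists>y\<in>A. measure (\<mu> t) A * h y \<le> (\<integral>x. indicator A x * h x \<partial>\<mu> t)"
proof (rule ccontr)
  interpret prob_space "\<mu> t" by (rule prob_space_\<mu>)
  define I where "I = (\<integral>x. indicator A x * h x \<partial>\<mu> t)"
  define a where "a = measure (\<mu> t) A"
  have int: "integrable (\<mu> t) (\<lambda>x. indicator A x * h x)"
    using integrable_mult_indicator[OF A(1) h] by simp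
  have intA: "integrable (\<mu> t) (indicator A :: _ \<Rightarrow> real)"
    by (rule integrable_real_indicator[OF A(1)]) (simp add: emeasure_eq_measure)
  assume "\<not> ?thesis"
  then have gt: "\<And>y. y \<in> A \<Longrightarrow> I < a * h y" by (auto simp: not_le I_def a_def)
  show False
  proof (cases "a = 0")
    case True
    then have "AE x in \<mu> t. x \<notin> A"
      using A(1) by (intro AE_not_in) (simp add: null_sets_def emeasure_eq_measure a_def)
    then have "I = (\<integral>x. 0 \<partial>\<mu> t)" unfolding I_def
      using A(1) h by (intro integral_cong_AE) (auto elim!: eventually_mono)
    then show False using gt A(2) True by auto
  next
    case False
    then have a: "a > 0" by (simp add: a_def zero_less_measure_iff)
    have int2: "integrable (\<mu> t) (\<lambda>x. indicator A x * (a * h x - I))"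
    proof -
      have "integrable (\<mu> t) (\<lambda>x. a * (indicator A x * h x) - I * indicator A x)"
        by (intro Bochner_Integration.integrable_diff integrable_mult_right int intA)
      then show ?thesis by (simp add: algebra_simps)
    qed
    have "(\<integral>x. indicator A x * (a * h x - I) \<partial>\<mu> t) = (\<integral>x. a * (indicator A x * h x) - I * indicator A x \<partial>\<mu> t)"
      by (simp add: algebra_simps)
    also have "\<dots> = a * I - I * a"
      using int intA A(1) by (simp add: I_def[symmetric] a_def)
    finally have "(\<integral>x. indicator A x * (a * h x - I) \<partial>\<mu> t) = 0" by simp
    then have "AE x in \<mu> t. indicator A x * (a * h x - I) = 0"
      using int2 gt by (subst (asm) integral_nonneg_eq_0_iff_AE) (auto simp: indicator_def less_imp_le)
    then have "AE x in \<mu> t. x \<notin> A"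
      by eventually_elim (use gt in \<open>auto simp: indicator_def split: if_splits\<close>)
    then have "a = 0" unfolding a_def
      using A(1) by (subst (asm) AE_iff_null) (auto simp: null_sets_def measure_def)
    then show False using False by simp
  qed
qed


text \<open>On a partition with small oscillation, \<open>G \<phi>\<close> is within
  \<open>\<delta>\<close> in L^p of the step function sampling one value per cell, uniformly over
  \<open>S\<close>. The sampled values are bounded on cells of positive measure, so rounding them
  leaves finitely many codes, and one element of \<open>S\<close> is kept for each code. That the
  net lies in \<open>S\<close> lets the decay argument use the mean-zero condition for its
  elements.\<close>

theorem G_Lp_totally_bounded:
  assumes p: "1 < p" and st: "s < t"
    and S: "\<And>\<phi>. \<phi> \<in> S \<Longrightarrow> Lp_norm p (\<mu> s) (apply_bcontfun \<phi>) \<le> B" and e: "e > 0"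
  obtains F where "finite F" "F \<subseteq> S"
    "\<And>\<phi>. \<phi> \<in> S \<Longrightarrow> \<exists>\<psi>\<in>F. Lp_norm p (\<mu> t) (apply_bcontfun (G t s \<phi> - G t s \<psi>)) \<le> e"
proof -
  let ?v = apply_bcontfun
  interpret prob_space "\<mu> t" by (rule prob_space_\<mu>)
  have st': "s \<le> t" using st by simp
  define b where "b = max B 1"
  have b: "b > 0" "B \<le> b" by (auto simp: b_def)
  define H where "H \<phi> = G t s (abs_powr_bcontfun p \<phi>)" for \<phi>
  have H0: "0 \<le> ?v (H \<phi>) x" for \<phi> x
    unfolding H_def by (intro G_nonneg[OF st']) (simp add: apply_abs_powr_bcontfun p)
  have HB: "mean t (H \<phi>) \<le> b powr p" if "\<phi> \<in> S" for \<phi>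
    unfolding H_def mean_G[OF st'] mean_abs_powr_bcontfun[OF p]
    using S[OF that] b(2) p by (intro powr_mono2) auto
  define \<delta> where "\<delta> = e / 3"
  have \<delta>: "\<delta> > 0" using e by (simp add: \<delta>_def)
  \<comment> \<open>Solves \<open>2 powr p * q * (b powr p + b powr p) = \<delta> powr p\<close>,
    the bound reached in \<open>approx\<close>; the oscillation estimate carries the factor
    \<open>\<epsilon> powr (p - 1)\<close>, which is to be \<open>q\<close>.\<close>
  define q where "q = \<delta> powr p / (2 powr p * (2 * b powr p))"
  have q: "q > 0" using \<delta> b by (simp add: q_def)
  define \<epsilon> where "\<epsilon> = q powr (1 / (p - 1))"
  have \<epsilon>: "\<epsilon> > 0" using q by (simp add: \<epsilon>_def)
  have \<epsilon>p: "\<epsilon> powr (p - 1) = q" using q p by (simp add: \<epsilon>_def powr_powr)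
  obtain \<kappa> :: "real^'n \<Rightarrow> ((real^'n) \<Rightarrow>\<^sub>C real) \<Rightarrow> int" where
    \<kappa>: "finite (range \<kappa>)" "\<And>i. \<kappa> -` {i} \<in> sets borel"
    and osc: "\<And>x y \<psi>. \<kappa> x = \<kappa> y \<Longrightarrow> \<bar>?v (G t s \<psi>) x - ?v (G t s \<psi>) y\<bar> \<le> \<epsilon> * norm \<psi>"
    using oscillation_partition[OF st \<epsilon>] by blast
  define I where "I = range \<kappa>"
  have I: "finite I" using \<kappa>(1) by (simp add: I_def)
  define m where "m i = measure (\<mu> t) (\<kappa> -` {i})" for i
  have meas [measurable]: "\<kappa> -` {i} \<in> sets (\<mu> t)" for i using \<kappa>(2) by simp
  have sum_ind: "(\<Sum>i\<in>I. indicator (\<kappa> -` {i}) x * c i) = c (\<kappa> x)" for x and c :: "_ \<Rightarrow> real"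
  proof -
    have "(\<Sum>i\<in>I. indicator (\<kappa> -` {i}) x * c i) = (\<Sum>i\<in>I. if i = \<kappa> x then c i else 0)"
      by (intro sum.cong refl) (auto simp: indicator_def)
    then show ?thesis using I by (simp add: I_def)
  qed
  have step_meas [measurable]: "(\<lambda>x. c (\<kappa> x)) \<in> borel_measurable (\<mu> t)" for c :: "_ \<Rightarrow> real"
    unfolding sum_ind[symmetric] by measurable
  have step_bound: "\<bar>c (\<kappa> x)\<bar> \<le> (\<Sum>i\<in>I. \<bar>c i\<bar>)" for c :: "_ \<Rightarrow> real" and x
    using I by (intro member_le_sum[of "\<kappa> x" I "\<lambda>i. \<bar>c i\<bar>"]) (auto simp: I_def)
  have step_Lp: "(\<lambda>x. c (\<kappa> x)) \<in> Lp_space p (\<mu> t)" for c :: "_ \<Rightarrow> real"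
    by (rule Lp_bounded(1)[OF p step_meas, of _ "\<Sum>i\<in>I. \<bar>c i\<bar>"]) (auto simp: step_bound sum_nonneg)
  have int_ind: "integrable (\<mu> t) (indicator (\<kappa> -` {i}) :: _ \<Rightarrow> real)" for i
    by (rule integrable_real_indicator[OF meas]) (simp add: emeasure_eq_measure)
  have step_int: "integrable (\<mu> t) (\<lambda>x. c (\<kappa> x))" "(\<integral>x. c (\<kappa> x) \<partial>\<mu> t) = (\<Sum>i\<in>I. m i * c i)" for c :: "_ \<Rightarrow> real"
    unfolding sum_ind[symmetric] using int_ind by (auto simp: m_def)
  \<comment> \<open>The sampling points depend on \<open>\<phi>\<close>: \<open>H \<phi>\<close>
    does not exceed its cell average there, so the weighted sum of the sampled values of
    \<open>H \<phi>\<close> stays below \<open>mean t (H \<phi>)\<close>.\<close>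
  define y where "y \<phi> i = (SOME z. z \<in> \<kappa> -` {i} \<and>
      m i * ?v (H \<phi>) z \<le> (\<integral>x. indicator (\<kappa> -` {i}) x * ?v (H \<phi>) x \<partial>\<mu> t))" for \<phi> i
  have y: "y \<phi> i \<in> \<kappa> -` {i}"
    "m i * ?v (H \<phi>) (y \<phi> i) \<le> (\<integral>x. indicator (\<kappa> -` {i}) x * ?v (H \<phi>) x \<partial>\<mu> t)"
    if i: "i \<in> I" for \<phi> i
  proof -
    have "\<kappa> -` {i} \<noteq> {}" using i by (auto simp: I_def)
    then have "\<exists>z. z \<in> \<kappa> -` {i} \<and>
        m i * ?v (H \<phi>) z \<le> (\<integral>x. indicator (\<kappa> -` {i}) x * ?v (H \<phi>) x \<partial>\<mu> t)"
      using exists_le_average[OF meas _ integrable_bcontfun, of i "H \<phi>"] unfolding m_def by blast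
    from someI_ex[OF this]
    show "y \<phi> i \<in> \<kappa> -` {i}"
      "m i * ?v (H \<phi>) (y \<phi> i) \<le> (\<integral>x. indicator (\<kappa> -` {i}) x * ?v (H \<phi>) x \<partial>\<mu> t)"
      unfolding y_def by blast+
  qed
  define c where "c \<phi> i = ?v (G t s \<phi>) (y \<phi> i)" for \<phi> i
  define d where "d \<phi> i = ?v (H \<phi>) (y \<phi> i)" for \<phi> i
  have sum_d: "(\<Sum>i\<in>I. m i * d \<phi> i) \<le> mean t (H \<phi>)" for \<phi>
  proof -
    have "(\<Sum>i\<in>I. m i * d \<phi> i) \<le> (\<Sum>i\<in>I. \<integral>x. indicator (\<kappa> -` {i}) x * ?v (H \<phi>) x \<partial>\<mu> t)"
      using y(2) by (intro sum_mono) (auto simp: d_def)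
    also have "\<dots> = (\<integral>x. (\<Sum>i\<in>I. indicator (\<kappa> -` {i}) x * ?v (H \<phi>) x) \<partial>\<mu> t)"
      using integrable_mult_indicator[OF meas integrable_bcontfun[of t "H \<phi>"]]
      by (intro Bochner_Integration.integral_sum[symmetric]) simp
    also have "\<dots> = mean t (H \<phi>)" by (simp add: sum_ind mean_def)
    finally show ?thesis .
  qed
  have approx: "Lp_norm p (\<mu> t) (\<lambda>x. ?v (G t s \<phi>) x - c \<phi> (\<kappa> x)) \<le> \<delta>" if \<phi>: "\<phi> \<in> S" for \<phi>
  proof -
    have "(\<integral>x. \<bar>?v (G t s \<phi>) x - c \<phi> (\<kappa> x)\<bar> powr p \<partial>\<mu> t)
        \<le> (\<integral>x. 2 powr p * q * (?v (H \<phi>) x + d \<phi> (\<kappa> x)) \<partial>\<mu> t)"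
    proof (rule integral_mono)
      show "integrable (\<mu> t) (\<lambda>x. \<bar>?v (G t s \<phi>) x - c \<phi> (\<kappa> x)\<bar> powr p)"
        by (rule Lp_spaceD(2)[OF Lp_space_diff[OF p bcontfun_in_Lp[OF p] step_Lp]])
      show "integrable (\<mu> t) (\<lambda>x. 2 powr p * q * (?v (H \<phi>) x + d \<phi> (\<kappa> x)))"
        by (intro integrable_mult_right Bochner_Integration.integrable_add integrable_bcontfun step_int)
      fix x
      have "\<kappa> x = \<kappa> (y \<phi> (\<kappa> x))" using y(1)[of "\<kappa> x" \<phi>] by (auto simp: I_def)
      from G_oscillation[OF p st' \<epsilon> osc[OF this], of \<phi>]
      show "\<bar>?v (G t s \<phi>) x - c \<phi> (\<kappa> x)\<bar> powr p \<le> 2 powr p * q * (?v (H \<phi>) x + d \<phi> (\<kappa> x))"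
        by (simp add: c_def d_def H_def \<epsilon>p)
    qed
    also have "\<dots> = 2 powr p * q * (mean t (H \<phi>) + (\<Sum>i\<in>I. m i * d \<phi> i))"
      using step_int[of "d \<phi>"] by (simp add: mean_def)
    also have "\<dots> \<le> 2 powr p * q * (b powr p + b powr p)"
      using HB[OF \<phi>] sum_d[of \<phi>] q by (intro mult_left_mono add_mono) auto
    also have "\<dots> = \<delta> powr p" using b by (simp add: q_def)
    finally show ?thesis using \<delta> p by (simp add: Lp_norm_le_iff)
  qed
  \<comment> \<open>On a cell of measure \<open>m i > 0\<close>, Jensen's inequality and
    \<open>sum_d\<close> give \<open>m i * |c \<phi> i|^p \<le> b^p\<close>; this bounds the rounded
    values. On null cells the code is set to 0.\<close>
  define N where "N i = \<lceil>b / m i powr (1 / p) / \<delta>\<rceil> + 1" for i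
  define code where "code \<phi> = (\<lambda>i\<in>I. if m i > 0 then \<lfloor>c \<phi> i / \<delta>\<rfloor> else 0)" for \<phi>
  have cb: "\<bar>c \<phi> i\<bar> \<le> b / m i powr (1 / p)" if \<phi>: "\<phi> \<in> S" and i: "i \<in> I" "m i > 0" for \<phi> i
  proof -
    have "m i * d \<phi> i \<le> (\<Sum>i\<in>I. m i * d \<phi> i)"
      using I i(1) H0 by (intro member_le_sum) (auto simp: d_def m_def)
    also have "\<dots> \<le> b powr p" using sum_d[of \<phi>] HB[OF \<phi>] by simp
    finally have "d \<phi> i \<le> b powr p / m i" using i(2) by (simp add: field_simps)
    moreover have "\<bar>c \<phi> i\<bar> powr p \<le> d \<phi> i" unfolding c_def d_def H_def by (rule G_jensen[OF p st'])
    ultimately have "\<bar>c \<phi> i\<bar> powr p \<le> (b / m i powr (1 / p)) powr p"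
      using b i(2) p by (simp add: powr_divide powr_powr)
    then show ?thesis
      using powr_less_mono2[of p "b / m i powr (1 / p)" "\<bar>c \<phi> i\<bar>"] p b by (force simp: not_le[symmetric])
  qed
  have "code ` S \<subseteq> PiE I (\<lambda>i. {- N i..N i})"
  proof (intro subsetI PiE_I)
    fix k i assume "k \<in> code ` S" and i: "i \<in> I"
    then obtain \<phi> where \<phi>: "\<phi> \<in> S" "k = code \<phi>" by blast
    show "k i \<in> {- N i..N i}"
    proof (cases "m i > 0")
      case True
      have "\<bar>c \<phi> i / \<delta>\<bar> \<le> b / m i powr (1 / p) / \<delta>"
        unfolding abs_divide abs_of_pos[OF \<delta>]
        using cb[OF \<phi>(1) i True] \<delta> by (intro divide_right_mono) auto
      then have "- N i \<le> \<lfloor>c \<phi> i / \<delta>\<rfloor> \<and> \<lfloor>c \<phi> i / \<delta>\<rfloor> \<le> N i" unfolding N_def by linarith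
      then show ?thesis using i True by (simp add: \<phi>(2) code_def)
    next
      case False
      have "0 \<le> b / m i powr (1 / p) / \<delta>" using b \<delta> by simp
      then have "- N i \<le> 0 \<and> 0 \<le> N i" unfolding N_def by linarith
      then show ?thesis using i False by (simp add: \<phi>(2) code_def)
    qed
  qed (auto simp: code_def)
  then have fin: "finite (code ` S)" by (rule finite_subset) (intro finite_PiE I finite_atLeastAtMost_int)
  define R where "R = (\<lambda>k. SOME \<phi>. \<phi> \<in> S \<and> code \<phi> = k)"
  have R: "R k \<in> S" "code (R k) = k" if k: "k \<in> code ` S" for k
  proof -
    have "\<exists>\<phi>. \<phi> \<in> S \<and> code \<phi> = k" using k by blast
    from someI_ex[OF this] show "R k \<in> S" "code (R k) = k" by (auto simp: R_def)
  qed
  show thesis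
  proof (rule that[of "R ` code ` S"])
    show "finite (R ` code ` S)" using fin by simp
    show "R ` code ` S \<subseteq> S" using R(1) by blast
    fix \<phi> assume \<phi>: "\<phi> \<in> S"
    define \<psi> where "\<psi> = R (code \<phi>)"
    have \<psi>: "\<psi> \<in> S" "code \<psi> = code \<phi>" using R \<phi> by (auto simp: \<psi>_def)
    \<comment> \<open>Equal codes say nothing about cells of measure zero, so the two step functions
      are compared almost everywhere only.\<close>
    have "AE x in \<mu> t. m (\<kappa> x) > 0"
    proof -
      have "AE x in \<mu> t. \<forall>i\<in>I. m i = 0 \<longrightarrow> x \<notin> \<kappa> -` {i}"
      proof (rule AE_finite_allI[OF I])
        fix i
        show "AE x in \<mu> t. m i = 0 \<longrightarrow> x \<notin> \<kappa> -` {i}"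
        proof (cases "m i = 0")
          case True
          then have "AE x in \<mu> t. x \<notin> \<kappa> -` {i}"
            using meas[of i] by (intro AE_not_in) (simp add: null_sets_def emeasure_eq_measure m_def)
          then show ?thesis by eventually_elim simp
        qed simp
      qed
      then show ?thesis
        by eventually_elim (auto simp: I_def m_def zero_less_measure_iff)
    qed
    then have "AE x in \<mu> t. \<bar>c \<phi> (\<kappa> x) - c \<psi> (\<kappa> x)\<bar> \<le> \<delta>"
    proof eventually_elim
      fix x assume mx: "m (\<kappa> x) > 0"
      have "\<lfloor>c \<phi> (\<kappa> x) / \<delta>\<rfloor> = \<lfloor>c \<psi> (\<kappa> x) / \<delta>\<rfloor>"
        using fun_cong[OF \<psi>(2), of "\<kappa> x"] mx by (simp add: code_def I_def)
      then have "\<bar>c \<phi> (\<kappa> x) / \<delta> - c \<psi> (\<kappa> x) / \<delta>\<bar> \<le> 1" by linarith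
      then show "\<bar>c \<phi> (\<kappa> x) - c \<psi> (\<kappa> x)\<bar> \<le> \<delta>"
        using \<delta> by (simp add: diff_divide_distrib[symmetric] abs_divide)
    qed
    then have mid: "Lp_norm p (\<mu> t) (\<lambda>x. c \<phi> (\<kappa> x) - c \<psi> (\<kappa> x)) \<le> \<delta>"
      using \<delta> by (intro Lp_bounded(2)[OF p]) auto
    note bL = bcontfun_in_Lp[OF p, of _ t]
    have "Lp_norm p (\<mu> t) (\<lambda>x. ?v (G t s \<phi>) x - ?v (G t s \<psi>) x)
        \<le> Lp_norm p (\<mu> t) (\<lambda>x. ?v (G t s \<phi>) x - c \<phi> (\<kappa> x)) + Lp_norm p (\<mu> t) (\<lambda>x. c \<phi> (\<kappa> x) - ?v (G t s \<psi>) x)"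
      by (rule Lp_norm_triangle_diff[OF p bL step_Lp bL])
    also have "Lp_norm p (\<mu> t) (\<lambda>x. c \<phi> (\<kappa> x) - ?v (G t s \<psi>) x)
        \<le> Lp_norm p (\<mu> t) (\<lambda>x. c \<phi> (\<kappa> x) - c \<psi> (\<kappa> x)) + Lp_norm p (\<mu> t) (\<lambda>x. c \<psi> (\<kappa> x) - ?v (G t s \<psi>) x)"
      by (rule Lp_norm_triangle_diff[OF p step_Lp step_Lp bL])
    also have "Lp_norm p (\<mu> t) (\<lambda>x. c \<psi> (\<kappa> x) - ?v (G t s \<psi>) x) = Lp_norm p (\<mu> t) (\<lambda>x. ?v (G t s \<psi>) x - c \<psi> (\<kappa> x))"
      by (rule Lp_norm_minus_commute)
    finally have "Lp_norm p (\<mu> t) (apply_bcontfun (G t s \<phi> - G t s \<psi>)) \<le> e"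
      using approx[OF \<phi>] approx[OF \<psi>(1)] mid by (simp add: \<delta>_def)
    then show "\<exists>\<psi>\<in>R ` code ` S. Lp_norm p (\<mu> t) (apply_bcontfun (G t s \<phi> - G t s \<psi>)) \<le> e"
      using \<phi> unfolding \<psi>_def by blast
  qed
qed

section \<open>Decay in L^p for bounded continuous functions of mean zero\<close>

lemma Lp_norm_bcontfun_scaleR:
  "1 < p \<Longrightarrow> Lp_norm p (\<mu> s) (apply_bcontfun (c *\<^sub>R \<phi>)) = \<bar>c\<bar> * Lp_norm p (\<mu> s) (apply_bcontfun \<phi>)"
  for \<phi> :: "(real^'n) \<Rightarrow>\<^sub>C real"
  by (simp add: Lp_norm_cmult)

lemma Lp_norm_bcontfun_add:
  "1 < p \<Longrightarrow> Lp_norm p (\<mu> s) (apply_bcontfun (\<phi> + \<psi>))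
    \<le> Lp_norm p (\<mu> s) (apply_bcontfun \<phi>) + Lp_norm p (\<mu> s) (apply_bcontfun \<psi>)"
  for \<phi> \<psi> :: "(real^'n) \<Rightarrow>\<^sub>C real"
  using Lp_norm_triangle[OF _ bcontfun_in_Lp bcontfun_in_Lp] by simp

text \<open>No spectral theory in $L^p$ is needed: by total boundedness \<open>V \<phi> = V \<psi> + (\<rho>/2) \<phi>'\<close> with \<open>\<psi>\<close> from a
  finite set of bounded continuous functions, for which the sup norm decay applies, and \<open>\<phi>'\<close> in the
  unit ball again.\<close>

theorem monodromy_power_Lp_decay:
  assumes p: "1 < p" and \<rho>: "subunit_radius T G < \<rho>"
  shows "\<exists>C. \<forall>m \<phi>. mean 0 \<phi> = 0 \<longrightarrow>
    Lp_norm p (\<mu> 0) (apply_bcontfun ((G T 0 ^^ m) \<phi>)) \<le> C * \<rho> ^ m * Lp_norm p (\<mu> 0) (apply_bcontfun \<phi>)"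
proof -
  let ?v = apply_bcontfun
  let ?V = "G T 0"
  let ?n = "\<lambda>\<phi>. Lp_norm p (\<mu> 0) (?v \<phi>)"
  have \<rho>0: "\<rho> > 0" using \<rho> subunit_radius_nonneg by simp
  have T0: "0 \<le> T" "0 < T" using T_pos by auto
  have \<mu>T: "\<mu> T = \<mu> 0" using \<mu>_periodic unfolding time_periodic_def by (metis add_0)
  obtain C where C: "\<And>m \<phi>. mean 0 \<phi> = 0 \<Longrightarrow> norm ((?V ^^ m) \<phi>) \<le> C * \<rho> ^ m * norm \<phi>"
    using monodromy_power_decay[OF \<rho>] by blast
  have Vm: "(?V ^^ m) = G (of_nat m * T) 0" for m
    by (rule ext, rule G_power[where s = 0 and n = m, unfolded add_0])
  have linV: "linear (?V ^^ m)" for m unfolding Vm using T0 by (intro linear_G) simp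
  have contr: "?n ((?V ^^ m) \<phi>) \<le> ?n \<phi>" for m \<phi>
  proof (induction m)
    case (Suc m)
    then show ?case using G_Lp_contraction[OF p T0(1), of "(?V ^^ m) \<phi>"] by (simp add: \<mu>T)
  qed simp
  define S where "S = {\<phi>. mean 0 \<phi> = 0 \<and> ?n \<phi> \<le> 1}"
  obtain F where F: "finite F" "F \<subseteq> S" "\<And>\<phi>. \<phi> \<in> S \<Longrightarrow> \<exists>\<psi>\<in>F. Lp_norm p (\<mu> T) (?v (?V \<phi> - ?V \<psi>)) \<le> \<rho> / 2"
    using G_Lp_totally_bounded[OF p T0(2), of S 1 "\<rho> / 2"] \<rho>0 by (auto simp: S_def)
  define B where "B = \<bar>C\<bar> * (\<Sum>\<psi>\<in>F. norm \<psi>)"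
  have B0: "0 \<le> B" by (simp add: B_def sum_nonneg)
  have FB: "?n ((?V ^^ m) \<psi>) \<le> B * \<rho> ^ m" if \<psi>: "\<psi> \<in> F" for m \<psi>
  proof -
    have "?n ((?V ^^ m) \<psi>) \<le> norm ((?V ^^ m) \<psi>)" by (rule Lp_norm_bcontfun_le[OF p])
    also have "\<dots> \<le> C * \<rho> ^ m * norm \<psi>" using \<psi> F(2) by (intro C) (auto simp: S_def)
    also have "\<dots> \<le> \<bar>C\<bar> * \<rho> ^ m * (\<Sum>\<psi>\<in>F. norm \<psi>)"
      using \<rho>0 F(1) \<psi> by (intro mult_mono mult_right_mono member_le_sum) auto
    finally show ?thesis by (simp add: B_def ac_simps)
  qed
  \<comment> \<open>The value 1 starts the induction, and \<open>2 * B\<close> closes it: the net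
    element contributes \<open>B\<close> and the halved remainder \<open>D / 2\<close>, together at
    most \<open>D\<close>.\<close>
  define D where "D = max 1 (2 * B)"
  have unit: "?n ((?V ^^ m) \<phi>) \<le> D * \<rho> ^ m" if \<phi>: "\<phi> \<in> S" for m \<phi>
    using \<phi>
  proof (induction m arbitrary: \<phi>)
    case 0
    then show ?case by (auto simp: S_def D_def max_def)
  next
    case (Suc m)
    obtain \<psi> where \<psi>: "\<psi> \<in> F" "?n (?V \<phi> - ?V \<psi>) \<le> \<rho> / 2" using F(3)[OF Suc.prems] by (auto simp: \<mu>T)
    define \<phi>' where "\<phi>' = (2 / \<rho>) *\<^sub>R (?V \<phi> - ?V \<psi>)"
    have "mean 0 \<phi>' = 0" using Suc.prems \<psi>(1) F(2)
      by (auto simp: \<phi>'_def mean_scaleR mean_diff mean_monodromy S_def)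
    moreover have "?n \<phi>' \<le> 1"
      using \<psi>(2) \<rho>0 by (simp only: \<phi>'_def Lp_norm_bcontfun_scaleR[OF p]) (simp add: field_simps)
    ultimately have \<phi>'S: "\<phi>' \<in> S" by (simp add: S_def)
    have "?V \<phi> = ?V \<psi> + (\<rho> / 2) *\<^sub>R \<phi>'" using \<rho>0 by (simp add: \<phi>'_def)
    then have eq: "(?V ^^ Suc m) \<phi> = (?V ^^ Suc m) \<psi> + (\<rho> / 2) *\<^sub>R (?V ^^ m) \<phi>'"
      unfolding funpow_Suc_right comp_def by (simp add: linear_add[OF linV] linear_scale[OF linV])
    have "?n ((?V ^^ Suc m) \<phi>) \<le> ?n ((?V ^^ Suc m) \<psi>) + ?n ((\<rho> / 2) *\<^sub>R (?V ^^ m) \<phi>')"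
      unfolding eq by (rule Lp_norm_bcontfun_add[OF p])
    also have "\<dots> \<le> B * \<rho> ^ Suc m + (\<rho> / 2) * (D * \<rho> ^ m)"
      unfolding Lp_norm_bcontfun_scaleR[OF p]
      using FB[OF \<psi>(1), of "Suc m"] Suc.IH[OF \<phi>'S] \<rho>0 by (intro add_mono mult_mono) auto
    also have "\<dots> = (B + D / 2) * \<rho> ^ Suc m" by (simp add: algebra_simps)
    also have "\<dots> \<le> D * \<rho> ^ Suc m" using \<rho>0 by (intro mult_right_mono) (auto simp: D_def)
    finally show ?case .
  qed
  show ?thesis
  proof (intro exI allI impI)
    fix m \<phi> assume m0: "mean 0 \<phi> = 0"
    show "?n ((?V ^^ m) \<phi>) \<le> D * \<rho> ^ m * ?n \<phi>"
    proof (cases "?n \<phi> = 0")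
      case True
      then show ?thesis using contr[of m \<phi>] by simp
    next
      case False
      then have pos: "?n \<phi> > 0" by (simp add: less_le)
      have "(1 / ?n \<phi>) *\<^sub>R \<phi> \<in> S"
        using pos m0 by (simp add: S_def mean_scaleR Lp_norm_bcontfun_scaleR[OF p] del: scaleR_bcontfun.rep_eq)
      from unit[OF this, of m]
      have "(1 / ?n \<phi>) * ?n ((?V ^^ m) \<phi>) \<le> D * \<rho> ^ m"
        using pos by (simp add: linear_scale[OF linV] Lp_norm_bcontfun_scaleR[OF p] del: scaleR_bcontfun.rep_eq)
      then show ?thesis using pos by (simp add: field_simps)
    qed
  qed
qed


lemma \<mu>_periodic_nat: "\<mu> (s + of_nat n * T) = \<mu> s"
proof (induction n)
  case (Suc n)
  have "s + of_nat (Suc n) * T = (s + of_nat n * T) + T" by (simp add: algebra_simps)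
  also have "\<mu> \<dots> = \<mu> (s + of_nat n * T)" using \<mu>_periodic by (simp add: time_periodic_def)
  finally show ?case unfolding Suc .
qed simp

lemma mean_periodic_nat: "mean (s + of_nat n * T) = mean s"
  by (simp add: mean_def \<mu>_periodic_nat fun_eq_iff)

text \<open>After a shift by periods to nonnegative times, the interval consists of a piece shorter
  than \<open>T\<close>, then \<open>m\<close> whole periods starting at a multiple of
  \<open>T\<close>, then another piece shorter than \<open>T\<close>. Contractivity on the outer
  pieces loses time less than \<open>2 * T\<close>, whence the factor
  \<open>exp (- 2 * \<omega> * T)\<close>. For \<open>t - s < 2 * T\<close> the same factor makes
  plain contractivity sufficient.\<close>

lemma centered_Lp_decay:
  assumes p: "1 < p" and rate: "log_rate T (subunit_radius T G) < ereal \<omega>" and \<omega>: "\<omega> < 0"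
  obtains M where "M > 0" "\<And>s t \<phi>. s < t \<Longrightarrow> mean s \<phi> = 0 \<Longrightarrow>
    Lp_norm p (\<mu> t) (apply_bcontfun (G t s \<phi>)) \<le> M * exp (\<omega> * (t - s)) * Lp_norm p (\<mu> s) (apply_bcontfun \<phi>)"
proof -
  let ?n = "\<lambda>s \<phi>. Lp_norm p (\<mu> s) (apply_bcontfun \<phi>)"
  define \<rho> where "\<rho> = exp (\<omega> * T)"
  have "subunit_radius T G < \<rho>"
  proof (cases "subunit_radius T G = 0")
    case False
    then have "subunit_radius T G > 0" using subunit_radius_nonneg by simp
    moreover have "ln (subunit_radius T G) < \<omega> * T"
      using rate False T_pos by (simp add: log_rate_def pos_divide_less_eq)
    ultimately show ?thesis unfolding \<rho>_def by (metis exp_less_mono exp_ln)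
  qed (simp add: \<rho>_def)
  then obtain C where C: "\<And>m \<phi>. mean 0 \<phi> = 0 \<Longrightarrow> ?n 0 ((G T 0 ^^ m) \<phi>) \<le> C * \<rho> ^ m * ?n 0 \<phi>"
    using monodromy_power_Lp_decay[OF p] by blast
  define M where "M = max 1 C * exp (- 2 * \<omega> * T)"
  have "M > 0" by (simp add: M_def)
  moreover have "?n t (G t s \<phi>) \<le> M * exp (\<omega> * (t - s)) * ?n s \<phi>" if st: "s < t" and m0: "mean s \<phi> = 0" for s t \<phi>
  proof (cases "t - s < 2 * T")
    case True
    have "\<omega> * (2 * T) \<le> \<omega> * (t - s)" using True \<omega> by (intro mult_left_mono_neg) auto
    then have "1 \<le> exp (- 2 * \<omega> * T + \<omega> * (t - s))" by simp
    then have "1 * 1 \<le> max 1 C * exp (- 2 * \<omega> * T + \<omega> * (t - s))" by (intro mult_mono) auto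
    then have "1 \<le> M * exp (\<omega> * (t - s))" by (simp only: M_def mult_1 exp_add mult.assoc)
    then have "1 * ?n s \<phi> \<le> M * exp (\<omega> * (t - s)) * ?n s \<phi>" by (intro mult_right_mono) auto
    then show ?thesis using G_Lp_contraction[OF p, of s t \<phi>] st by simp
  next
    case False
    obtain n :: nat where "- s / T \<le> of_nat n" using real_arch_simple by blast
    then have n: "0 \<le> s + of_nat n * T" using T_pos by (simp add: field_simps)
    define s1 where "s1 = s + of_nat n * T"
    define t1 where "t1 = t + of_nat n * T"
    define k where "k = nat \<lceil>s1 / T\<rceil>"
    have "0 \<le> s1 / T" using n T_pos by (simp add: s1_def)
    then have "s1 / T \<le> of_nat k" "of_nat k < s1 / T + 1" unfolding k_def by linarith+
    then have k: "s1 \<le> of_nat k * T" "of_nat k * T < s1 + T" using T_pos by (simp_all add: field_simps)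
    define m where "m = nat \<lfloor>(t1 - of_nat k * T) / T\<rfloor>"
    have "0 \<le> (t1 - of_nat k * T) / T" using False k T_pos by (simp add: s1_def t1_def)
    then have "of_nat m \<le> (t1 - of_nat k * T) / T" "(t1 - of_nat k * T) / T < of_nat m + 1"
      unfolding m_def by linarith+
    then have m: "of_nat m * T + of_nat k * T \<le> t1" "t1 < of_nat m * T + of_nat k * T + T"
      using T_pos by (simp_all add: field_simps)
    define \<psi> where "\<psi> = G (of_nat k * T) s1 \<phi>"
    have mT: "0 \<le> of_nat m * T" using T_pos by simp
    have \<mu>k: "\<mu> (of_nat k * T) = \<mu> 0" "mean (of_nat k * T) = mean 0"
      using \<mu>_periodic_nat[of 0 k] mean_periodic_nat[of 0 k] by simp_all
    have \<mu>mk: "\<mu> (of_nat m * T + of_nat k * T) = \<mu> 0"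
      using \<mu>_periodic_nat[of 0 m] \<mu>_periodic_nat[of "of_nat m * T" k] by simp
    have \<psi>0: "mean 0 \<psi> = 0"
      using mean_G[OF k(1), of \<phi>] m0 mean_periodic_nat[of s n] by (simp add: \<psi>_def \<mu>k s1_def)
    have "G (of_nat m * T + of_nat k * T) (of_nat k * T) = (G T 0 ^^ m)"
      using G_periodic_nat[OF mT, of k] G_power[where s = 0 and n = m] by (auto simp: fun_eq_iff)
    then have "G t s \<phi> = G t1 (of_nat m * T + of_nat k * T) ((G T 0 ^^ m) \<psi>)"
      using G_periodic_nat[of s t n] st k(1) m(1) mT G_compose[OF k(1), of "of_nat m * T + of_nat k * T" \<phi>]
        G_compose[of s1 "of_nat m * T + of_nat k * T" t1 \<phi>]
      by (simp add: s1_def t1_def \<psi>_def)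
    then have "?n t1 (G t s \<phi>) \<le> ?n 0 ((G T 0 ^^ m) \<psi>)"
      using G_Lp_contraction[OF p m(1), of "(G T 0 ^^ m) \<psi>"] by (simp add: \<mu>mk)
    also have "\<dots> \<le> C * \<rho> ^ m * ?n 0 \<psi>" by (rule C[OF \<psi>0])
    also have "\<dots> \<le> max 1 C * \<rho> ^ m * ?n 0 \<psi>" by (intro mult_right_mono) (auto simp: \<rho>_def)
    also have "\<dots> \<le> max 1 C * (exp (- 2 * \<omega> * T) * exp (\<omega> * (t - s))) * ?n s \<phi>"
    proof (intro mult_mono)
      have "t - s - 2 * T \<le> of_nat m * T" using m(2) k(2) by (simp add: t1_def s1_def)
      then have "\<omega> * (of_nat m * T) \<le> \<omega> * (t - s - 2 * T)" using \<omega> by (intro mult_left_mono_neg) auto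
      moreover have "\<rho> ^ m = exp (\<omega> * (of_nat m * T))"
        unfolding \<rho>_def exp_of_nat_mult[symmetric] by (simp add: algebra_simps)
      ultimately show "\<rho> ^ m \<le> exp (- 2 * \<omega> * T) * exp (\<omega> * (t - s))"
        by (simp add: exp_add[symmetric] algebra_simps)
      show "?n 0 \<psi> \<le> ?n s \<phi>"
        using G_Lp_contraction[OF p k(1), of \<phi>] by (simp add: \<psi>_def \<mu>k s1_def \<mu>_periodic_nat)
    qed (auto simp: \<rho>_def)
    finally show ?thesis by (simp add: t1_def \<mu>_periodic_nat M_def mult.assoc)
  qed
  ultimately show thesis by (rule that)
qed

section \<open>The extension to L^p, its compactness and its decay\<close>

lemma Lp_approx_sequence:
  assumes p: "1 < p" and f: "f \<in> Lp_space p (\<mu> s)"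
  obtains \<phi> :: "nat \<Rightarrow> (real^'n) \<Rightarrow>\<^sub>C real"
  where "(\<lambda>n. Lp_norm p (\<mu> s) (\<lambda>x. apply_bcontfun (\<phi> n) x - f x)) \<longlonglongrightarrow> 0"
proof -
  have "\<exists>\<phi>. Lp_norm p (\<mu> s) (\<lambda>x. apply_bcontfun \<phi> x - f x) \<le> 1 / real (Suc n)" for n
    by (rule bcontfun_dense_Lp[OF prob_space_\<mu> sets_\<mu> p f]) simp
  then obtain \<phi> where \<phi>: "\<And>n. Lp_norm p (\<mu> s) (\<lambda>x. apply_bcontfun (\<phi> n) x - f x) \<le> 1 / real (Suc n)"
    by metis
  have "(\<lambda>n. Lp_norm p (\<mu> s) (\<lambda>x. apply_bcontfun (\<phi> n) x - f x)) \<longlonglongrightarrow> 0"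
    by (rule real_tendsto_sandwich[OF _ _ tendsto_const LIMSEQ_inverse_real_of_nat])
       (use \<phi> in \<open>auto simp: inverse_eq_divide\<close>)
  then show thesis by (rule that)
qed

lemma G_Lp_contraction_diff:
  assumes "1 < p" "s \<le> t"
  shows "Lp_norm p (\<mu> t) (\<lambda>x. apply_bcontfun (G t s \<phi>) x - apply_bcontfun (G t s \<psi>) x)
    \<le> Lp_norm p (\<mu> s) (\<lambda>x. apply_bcontfun \<phi> x - apply_bcontfun \<psi> x)"
  using G_Lp_contraction[OF assms, of "\<phi> - \<psi>"] assms by (simp add: G_diff)

text \<open>This justifies the choice in \<open>Lp_extension\<close>. A limit exists along one
  approximating sequence by completeness, and contractivity of \<open>G\<close> on differences
  forces every other approximating sequence to the same limit.\<close>

lemma Lp_extension_G: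
  fixes f :: "real^'n \<Rightarrow> real"
  assumes p: "1 < p" and st: "s \<le> t" and f: "f \<in> Lp_space p (\<mu> s)"
  shows "Lp_extension p (\<mu> s) (\<mu> t) (G t s) f \<in> Lp_space p (\<mu> t)"
    and "\<And>\<phi>. (\<lambda>n. Lp_norm p (\<mu> s) (\<lambda>x. apply_bcontfun (\<phi> n) x - f x)) \<longlonglongrightarrow> 0 \<Longrightarrow>
      (\<lambda>n. Lp_norm p (\<mu> t) (\<lambda>x. apply_bcontfun (G t s (\<phi> n)) x - Lp_extension p (\<mu> s) (\<mu> t) (G t s) f x)) \<longlonglongrightarrow> 0"
proof -
  interpret prob_space "\<mu> t" by (rule prob_space_\<mu>)
  note bL = bcontfun_in_Lp[OF p]
  obtain \<phi> where \<phi>: "(\<lambda>n. Lp_norm p (\<mu> s) (\<lambda>x. apply_bcontfun (\<phi> n) x - f x)) \<longlonglongrightarrow> 0"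
    by (rule Lp_approx_sequence[OF p f])
  obtain g where g: "g \<in> Lp_space p (\<mu> t)"
    "(\<lambda>n. Lp_norm p (\<mu> t) (\<lambda>x. apply_bcontfun (G t s (\<phi> n)) x - g x)) \<longlonglongrightarrow> 0"
  proof (rule Lp_complete[OF p, of "\<lambda>n. apply_bcontfun (G t s (\<phi> n))"])
    show "apply_bcontfun (G t s (\<phi> n)) \<in> Lp_space p (\<mu> t)" for n by (rule bL)
    fix e :: real assume "e > 0"
    then obtain N where N: "\<And>n. n \<ge> N \<Longrightarrow> Lp_norm p (\<mu> s) (\<lambda>x. apply_bcontfun (\<phi> n) x - f x) < e / 2"
      using LIMSEQ_D[OF \<phi>, of "e / 2"] by auto
    show "\<exists>N. \<forall>m\<ge>N. \<forall>n\<ge>N. Lp_norm p (\<mu> t) (\<lambda>x. apply_bcontfun (G t s (\<phi> m)) x - apply_bcontfun (G t s (\<phi> n)) x) \<le> e"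
    proof (intro exI[of _ N] allI impI)
      fix m n assume mn: "N \<le> m" "N \<le> n"
      have "Lp_norm p (\<mu> s) (\<lambda>x. apply_bcontfun (\<phi> m) x - apply_bcontfun (\<phi> n) x) \<le> e"
        using Lp_norm_triangle_diff[OF p bL f bL, of "\<phi> m" "\<phi> n"] N[OF mn(1)] N[OF mn(2)]
          Lp_norm_minus_commute[of p "\<mu> s" f "apply_bcontfun (\<phi> n)"] by simp
      then show "Lp_norm p (\<mu> t) (\<lambda>x. apply_bcontfun (G t s (\<phi> m)) x - apply_bcontfun (G t s (\<phi> n)) x) \<le> e"
        using G_Lp_contraction_diff[OF p st, of "\<phi> m" "\<phi> n"] by linarith
    qed
  qed auto
  have "(\<lambda>n. Lp_norm p (\<mu> t) (\<lambda>x. apply_bcontfun (G t s (\<psi> n)) x - g x)) \<longlonglongrightarrow> 0"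
    if \<psi>: "(\<lambda>n. Lp_norm p (\<mu> s) (\<lambda>x. apply_bcontfun (\<psi> n) x - f x)) \<longlonglongrightarrow> 0" for \<psi>
  proof (rule real_tendsto_sandwich[OF _ _ tendsto_const])
    show "(\<lambda>n. Lp_norm p (\<mu> s) (\<lambda>x. apply_bcontfun (\<psi> n) x - f x) + Lp_norm p (\<mu> s) (\<lambda>x. apply_bcontfun (\<phi> n) x - f x)
        + Lp_norm p (\<mu> t) (\<lambda>x. apply_bcontfun (G t s (\<phi> n)) x - g x)) \<longlonglongrightarrow> 0"
      using tendsto_add[OF tendsto_add[OF \<psi> \<phi>] g(2)] by simp
    show "\<forall>\<^sub>F n in sequentially. Lp_norm p (\<mu> t) (\<lambda>x. apply_bcontfun (G t s (\<psi> n)) x - g x)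
      \<le> Lp_norm p (\<mu> s) (\<lambda>x. apply_bcontfun (\<psi> n) x - f x) + Lp_norm p (\<mu> s) (\<lambda>x. apply_bcontfun (\<phi> n) x - f x)
        + Lp_norm p (\<mu> t) (\<lambda>x. apply_bcontfun (G t s (\<phi> n)) x - g x)"
    proof (rule always_eventually, rule allI)
      fix n
      show "Lp_norm p (\<mu> t) (\<lambda>x. apply_bcontfun (G t s (\<psi> n)) x - g x)
      \<le> Lp_norm p (\<mu> s) (\<lambda>x. apply_bcontfun (\<psi> n) x - f x) + Lp_norm p (\<mu> s) (\<lambda>x. apply_bcontfun (\<phi> n) x - f x)
        + Lp_norm p (\<mu> t) (\<lambda>x. apply_bcontfun (G t s (\<phi> n)) x - g x)"
        using Lp_norm_triangle_diff[OF p bL bL g(1), of "G t s (\<psi> n)" "G t s (\<phi> n)"]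
          G_Lp_contraction_diff[OF p st, of "\<psi> n" "\<phi> n"]
          Lp_norm_triangle_diff[OF p bL f bL, of "\<psi> n" "\<phi> n"]
          Lp_norm_minus_commute[of p "\<mu> s" f "apply_bcontfun (\<phi> n)"] by linarith
    qed
  qed auto
  then have "\<exists>g. g \<in> Lp_space p (\<mu> t) \<and>
        (\<forall>\<phi>n. (\<lambda>n. Lp_norm p (\<mu> s) (\<lambda>x. apply_bcontfun (\<phi>n n) x - f x)) \<longlonglongrightarrow> 0 \<longrightarrow>
           (\<lambda>n. Lp_norm p (\<mu> t) (\<lambda>x. apply_bcontfun (G t s (\<phi>n n)) x - g x)) \<longlonglongrightarrow> 0)"
    using g(1) by blast
  from someI_ex[OF this, folded Lp_extension_def]
  show "Lp_extension p (\<mu> s) (\<mu> t) (G t s) f \<in> Lp_space p (\<mu> t)"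
    and "\<And>\<phi>. (\<lambda>n. Lp_norm p (\<mu> s) (\<lambda>x. apply_bcontfun (\<phi> n) x - f x)) \<longlonglongrightarrow> 0 \<Longrightarrow>
      (\<lambda>n. Lp_norm p (\<mu> t) (\<lambda>x. apply_bcontfun (G t s (\<phi> n)) x - Lp_extension p (\<mu> s) (\<mu> t) (G t s) f x)) \<longlonglongrightarrow> 0"
    by blast+
qed

text \<open>Comparing the extension at \<open>f\<close> with \<open>G\<close> at one bounded
  continuous function is how the extension enters all later estimates; linearity of the chosen
  representatives never comes up.\<close>

lemma Lp_extension_G_contraction:
  assumes p: "1 < p" and st: "s \<le> t" and f: "f \<in> Lp_space p (\<mu> s)"
  shows "Lp_norm p (\<mu> t) (\<lambda>x. apply_bcontfun (G t s \<phi>) x - Lp_extension p (\<mu> s) (\<mu> t) (G t s) f x)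
    \<le> Lp_norm p (\<mu> s) (\<lambda>x. apply_bcontfun \<phi> x - f x)"
proof -
  let ?E = "Lp_extension p (\<mu> s) (\<mu> t) (G t s) f"
  note bL = bcontfun_in_Lp[OF p]
  obtain \<psi> where \<psi>: "(\<lambda>n. Lp_norm p (\<mu> s) (\<lambda>x. apply_bcontfun (\<psi> n) x - f x)) \<longlonglongrightarrow> 0"
    by (rule Lp_approx_sequence[OF p f])
  note E = Lp_extension_G[OF p st f]
  have "(\<lambda>n. Lp_norm p (\<mu> s) (\<lambda>x. apply_bcontfun \<phi> x - f x) + Lp_norm p (\<mu> s) (\<lambda>x. apply_bcontfun (\<psi> n) x - f x)
      + Lp_norm p (\<mu> t) (\<lambda>x. apply_bcontfun (G t s (\<psi> n)) x - ?E x)) \<longlonglongrightarrow> Lp_norm p (\<mu> s) (\<lambda>x. apply_bcontfun \<phi> x - f x) + 0 + 0"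
    by (intro tendsto_add tendsto_const \<psi> E(2))
  moreover have "Lp_norm p (\<mu> t) (\<lambda>x. apply_bcontfun (G t s \<phi>) x - ?E x)
      \<le> Lp_norm p (\<mu> s) (\<lambda>x. apply_bcontfun \<phi> x - f x) + Lp_norm p (\<mu> s) (\<lambda>x. apply_bcontfun (\<psi> n) x - f x)
      + Lp_norm p (\<mu> t) (\<lambda>x. apply_bcontfun (G t s (\<psi> n)) x - ?E x)" for n
    using Lp_norm_triangle_diff[OF p bL bL E(1), of "G t s \<phi>" "G t s (\<psi> n)"]
      G_Lp_contraction_diff[OF p st, of \<phi> "\<psi> n"]
      Lp_norm_triangle_diff[OF p bL f bL, of \<phi> "\<psi> n"]
      Lp_norm_minus_commute[of p "\<mu> s" f "apply_bcontfun (\<psi> n)"] by linarith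
  ultimately show ?thesis by (intro LIMSEQ_le_const) auto
qed

text \<open>Each \<open>f n\<close> is replaced by a bounded continuous function within
  \<open>1 / (n + 1)\<close> of it. Total boundedness yields a Cauchy subsequence of the images of
  these, and the replacement errors vanish along it.\<close>

theorem G_Lp_compact:
  assumes p: "1 < p" and st: "s < t"
  shows "Lp_compact_operator p (\<mu> s) (\<mu> t) (Lp_extension p (\<mu> s) (\<mu> t) (G t s))"
  unfolding Lp_compact_operator_def
proof (intro conjI allI impI)
  let ?E = "Lp_extension p (\<mu> s) (\<mu> t) (G t s)"
  interpret prob_space "\<mu> t" by (rule prob_space_\<mu>)
  have st': "s \<le> t" using st by simp
  note bL = bcontfun_in_Lp[OF p] and E = Lp_extension_G[OF p st']
  show "?E ` Lp_space p (\<mu> s) \<subseteq> Lp_space p (\<mu> t)" using E(1) by blast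
  fix f :: "nat \<Rightarrow> real^'n \<Rightarrow> real"
  assume f: "\<forall>n. f n \<in> Lp_space p (\<mu> s)" and "\<exists>K. \<forall>n. Lp_norm p (\<mu> s) (f n) \<le> K"
  then obtain K where K: "\<And>n. Lp_norm p (\<mu> s) (f n) \<le> K" by blast
  have "\<exists>\<phi>. Lp_norm p (\<mu> s) (\<lambda>x. apply_bcontfun \<phi> x - f n x) \<le> 1 / real (Suc n)" for n
    by (rule bcontfun_dense_Lp[OF prob_space_\<mu> sets_\<mu> p]) (use f in auto)
  then obtain \<phi> where \<phi>: "\<And>n. Lp_norm p (\<mu> s) (\<lambda>x. apply_bcontfun (\<phi> n) x - f n x) \<le> 1 / real (Suc n)"
    by metis
  have \<phi>K: "Lp_norm p (\<mu> s) (apply_bcontfun (\<phi> n)) \<le> K + 1" for n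
  proof -
    have "1 / real (Suc n) \<le> 1" and fn: "f n \<in> Lp_space p (\<mu> s)" using f by simp_all
    then show ?thesis
      using Lp_norm_le_add_diff[OF p bL fn, of "\<phi> n"] K[of n] \<phi>[of n] by linarith
  qed
  define d where "d m n = Lp_norm p (\<mu> t) (\<lambda>x. apply_bcontfun (G t s (\<phi> m)) x - apply_bcontfun (G t s (\<phi> n)) x)" for m n
  obtain k :: "nat \<Rightarrow> nat" where k: "strict_mono k" "\<And>e. e > 0 \<Longrightarrow> \<exists>N. \<forall>m\<ge>N. \<forall>n\<ge>N. d (k m) (k n) \<le> e"
  proof (rule totally_bounded_Cauchy_subsequence[of d])
    show "d m n = d n m" for m n unfolding d_def by (rule Lp_norm_minus_commute)
    show "d m n \<le> d m k + d k n" for m n k unfolding d_def by (rule Lp_norm_triangle_diff[OF p bL bL bL])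
    fix e :: real assume e: "e > 0"
    obtain F where F: "finite F" "F \<subseteq> range \<phi>"
      "\<And>\<psi>. \<psi> \<in> range \<phi> \<Longrightarrow> \<exists>\<psi>'\<in>F. Lp_norm p (\<mu> t) (apply_bcontfun (G t s \<psi> - G t s \<psi>')) \<le> e"
      using G_Lp_totally_bounded[OF p st, of "range \<phi>" "K + 1" e] \<phi>K e by blast
    then obtain F' where F': "finite F'" "F = \<phi> ` F'" by (meson finite_subset_image)
    have "\<exists>m\<in>F'. d n m \<le> e" for n using F(3)[of "\<phi> n"] by (auto simp: F'(2) d_def)
    then show "\<exists>F. finite F \<and> (\<forall>n. \<exists>m\<in>F. d n m \<le> e)" using F'(1) by blast
  qed blast
  obtain g where g: "g \<in> Lp_space p (\<mu> t)"
    "(\<lambda>n. Lp_norm p (\<mu> t) (\<lambda>x. apply_bcontfun (G t s (\<phi> (k n))) x - g x)) \<longlonglongrightarrow> 0"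
    using Lp_complete[OF p, of "\<lambda>n. apply_bcontfun (G t s (\<phi> (k n)))"] bL k(2) unfolding d_def by blast
  have "(\<lambda>n. Lp_norm p (\<mu> t) (\<lambda>x. ?E (f (k n)) x - g x)) \<longlonglongrightarrow> 0"
  proof (rule real_tendsto_sandwich[OF _ _ tendsto_const])
    have "(\<lambda>n. 1 / real (Suc (k n))) \<longlonglongrightarrow> 0"
      using LIMSEQ_subseq_LIMSEQ[OF LIMSEQ_inverse_real_of_nat k(1)] by (simp add: comp_def inverse_eq_divide)
    from tendsto_add[OF this g(2)]
    show "(\<lambda>n. 1 / real (Suc (k n)) + Lp_norm p (\<mu> t) (\<lambda>x. apply_bcontfun (G t s (\<phi> (k n))) x - g x)) \<longlonglongrightarrow> 0" by simp
    show "\<forall>\<^sub>F n in sequentially. Lp_norm p (\<mu> t) (\<lambda>x. ?E (f (k n)) x - g x)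
        \<le> 1 / real (Suc (k n)) + Lp_norm p (\<mu> t) (\<lambda>x. apply_bcontfun (G t s (\<phi> (k n))) x - g x)"
    proof (rule always_eventually, rule allI)
      fix n
      have fk: "f (k n) \<in> Lp_space p (\<mu> s)" using f by blast
      show "Lp_norm p (\<mu> t) (\<lambda>x. ?E (f (k n)) x - g x)
        \<le> 1 / real (Suc (k n)) + Lp_norm p (\<mu> t) (\<lambda>x. apply_bcontfun (G t s (\<phi> (k n))) x - g x)"
        using Lp_norm_triangle_diff[OF p E(1)[OF fk] bL g(1), of "G t s (\<phi> (k n))"]
          Lp_extension_G_contraction[OF p st' fk, of "\<phi> (k n)"] \<phi>[of "k n"]
          Lp_norm_minus_commute[of p "\<mu> t" "?E (f (k n))" "apply_bcontfun (G t s (\<phi> (k n)))"]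
        by linarith
    qed
  qed auto
  then show "\<exists>g\<in>Lp_space p (\<mu> t). \<exists>k. strict_mono k \<and> (\<lambda>n. Lp_norm p (\<mu> t) (\<lambda>x. ?E (f (k n)) x - g x)) \<longlonglongrightarrow> 0"
    using g(1) k(1) by blast
qed

text \<open>The mean is at most the L^p norm in modulus, so centering at most doubles the norm; this
  is the 2 in the final constant \<open>2 * M\<close>. Density carries the bound from continuous
  functions to \<open>f\<close>.\<close>

theorem Lp_decay:
  assumes p: "1 < p" and rate: "log_rate T (subunit_radius T G) < ereal \<omega>" and \<omega>: "\<omega> < 0"
  shows "\<exists>M>0. Lp_decay_estimate G \<mu> p \<omega> M"
proof -
  obtain M where M: "M > 0" "\<And>s t \<phi>. s < t \<Longrightarrow> mean s \<phi> = 0 \<Longrightarrow>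
    Lp_norm p (\<mu> t) (apply_bcontfun (G t s \<phi>)) \<le> M * exp (\<omega> * (t - s)) * Lp_norm p (\<mu> s) (apply_bcontfun \<phi>)"
    using centered_Lp_decay[OF p rate \<omega>] by blast
  note bL = bcontfun_in_Lp[OF p]
  have "Lp_norm p (\<mu> t) (\<lambda>x. Lp_extension p (\<mu> s) (\<mu> t) (G t s) f x - (\<integral>y. f y \<partial>\<mu> s))
      \<le> (2 * M) * exp (\<omega> * (t - s)) * Lp_norm p (\<mu> s) f"
    if st: "s < t" and f: "f \<in> Lp_space p (\<mu> s)" for s t f
  proof -
    interpret s: prob_space "\<mu> s" by (rule prob_space_\<mu>)
    interpret t: prob_space "\<mu> t" by (rule prob_space_\<mu>)
    let ?E = "Lp_extension p (\<mu> s) (\<mu> t) (G t s) f"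
    let ?n = "\<lambda>\<phi>. Lp_norm p (\<mu> s) (\<lambda>x. apply_bcontfun \<phi> x - f x)"
    define A where "A = M * exp (\<omega> * (t - s))"
    have A: "A > 0" using M(1) by (simp add: A_def)
    have st': "s \<le> t" using st by simp
    obtain \<phi> where \<phi>: "(\<lambda>n. ?n (\<phi> n)) \<longlonglongrightarrow> 0" by (rule Lp_approx_sequence[OF p f])
    note E = Lp_extension_G(1)[OF p st' f]
    \<comment> \<open>The three summands bound the distance of the extension from
      \<open>G \<psi>\<close>, the decay of \<open>\<psi>\<close> after centering, and the change of
      the mean from \<open>\<psi>\<close> to \<open>f\<close>.\<close>
    have main: "Lp_norm p (\<mu> t) (\<lambda>x. ?E x - (\<integral>y. f y \<partial>\<mu> s))
        \<le> ?n \<psi> + (2 * A * (Lp_norm p (\<mu> s) f + ?n \<psi>) + ?n \<psi>)" for \<psi>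
    proof -
      have mean_le: "\<bar>mean s \<psi>\<bar> \<le> Lp_norm p (\<mu> s) (apply_bcontfun \<psi>)"
        unfolding mean_def by (rule s.abs_integral_le_Lp_norm[OF p bL])
      define \<psi>0 where "\<psi>0 = \<psi> - const_bcontfun (mean s \<psi>)"
      have "Lp_norm p (\<mu> s) (apply_bcontfun \<psi>0) \<le> Lp_norm p (\<mu> s) (apply_bcontfun \<psi>) + \<bar>mean s \<psi>\<bar>"
        using Lp_norm_triangle[OF p bL s.Lp_const[of "- mean s \<psi>"], of \<psi>]
        by (simp add: \<psi>0_def s.Lp_norm_const[OF p])
      then have \<psi>0n: "Lp_norm p (\<mu> s) (apply_bcontfun \<psi>0) \<le> 2 * Lp_norm p (\<mu> s) (apply_bcontfun \<psi>)"
        using mean_le by simp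
      have "Lp_norm p (\<mu> t) (\<lambda>x. apply_bcontfun (G t s \<psi>) x - mean s \<psi>) \<le> A * Lp_norm p (\<mu> s) (apply_bcontfun \<psi>0)"
        using M(2)[OF st, of \<psi>0] st' by (simp add: \<psi>0_def mean_diff G_diff G_const A_def)
      also have "\<dots> \<le> A * (2 * Lp_norm p (\<mu> s) (apply_bcontfun \<psi>))" using A \<psi>0n by (intro mult_left_mono) auto
      also have "\<dots> \<le> A * (2 * (Lp_norm p (\<mu> s) f + ?n \<psi>))"
        using A Lp_norm_le_add_diff[OF p bL f, of \<psi>] by (intro mult_left_mono) auto
      finally have 1: "Lp_norm p (\<mu> t) (\<lambda>x. apply_bcontfun (G t s \<psi>) x - mean s \<psi>) \<le> 2 * A * (Lp_norm p (\<mu> s) f + ?n \<psi>)"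
        by (simp add: algebra_simps)
      have "mean s \<psi> - (\<integral>y. f y \<partial>\<mu> s) = (\<integral>x. apply_bcontfun \<psi> x - f x \<partial>\<mu> s)"
        using s.Lp_integrable[OF p f] by (simp add: mean_def)
      then have 2: "\<bar>mean s \<psi> - (\<integral>y. f y \<partial>\<mu> s)\<bar> \<le> ?n \<psi>"
        using s.abs_integral_le_Lp_norm[OF p Lp_space_diff[OF p bL f], of \<psi>] by simp
      show ?thesis
        using Lp_norm_triangle_diff[OF p E bL t.Lp_const[of "\<integral>y. f y \<partial>\<mu> s"], of "G t s \<psi>"]
          Lp_norm_triangle_diff[OF p bL t.Lp_const[of "mean s \<psi>"] t.Lp_const[of "\<integral>y. f y \<partial>\<mu> s"], of "G t s \<psi>"]
          t.Lp_norm_const[OF p, of "mean s \<psi> - (\<integral>y. f y \<partial>\<mu> s)"] 1 2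
          Lp_extension_G_contraction[OF p st' f, of \<psi>]
          Lp_norm_minus_commute[of p "\<mu> t" ?E "apply_bcontfun (G t s \<psi>)"]
        by linarith
    qed
    have "(\<lambda>n. ?n (\<phi> n) + (2 * A * (Lp_norm p (\<mu> s) f + ?n (\<phi> n)) + ?n (\<phi> n)))
        \<longlonglongrightarrow> 0 + (2 * A * (Lp_norm p (\<mu> s) f + 0) + 0)"
      by (intro tendsto_intros \<phi>)
    then have "Lp_norm p (\<mu> t) (\<lambda>x. ?E x - (\<integral>y. f y \<partial>\<mu> s)) \<le> 0 + (2 * A * (Lp_norm p (\<mu> s) f + 0) + 0)"
      by (rule LIMSEQ_le_const) (use main in blast)
    then show ?thesis by (simp add: A_def)
  qed
  then show ?thesis using M(1) unfolding Lp_decay_estimate_def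
    by (intro exI[of _ "2 * M"]) auto
qed

section \<open>Optimality of the rate\<close>

text \<open>Full support of \<open>\<mu> s\<close> makes the seminorm definite on bounded continuous
  functions, so nonzero eigenfunctions have nonzero L^p norm.\<close>

lemma Lp_norm_bcontfun_eq_0:
  assumes p: "1 < p" and 0: "Lp_norm p (\<mu> s) (apply_bcontfun \<phi>) = 0"
  shows "\<phi> = 0"
proof (rule bcontfun_eqI, rule ccontr)
  fix x assume "apply_bcontfun \<phi> x \<noteq> apply_bcontfun 0 x"
  then have "0 < mean s (abs_powr_bcontfun p \<phi>)"
    unfolding mean_def by (intro integral_pos[of _ x]) (auto simp: apply_abs_powr_bcontfun p)
  then show False using 0 by (simp add: mean_abs_powr_bcontfun p)
qed

text \<open>Since \<open>exp (\<omega> * T) < r\<close>, some eigenvalue satisfies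
  \<open>exp (\<omega> * T) < |c| < 1\<close>, and its eigenfunction has mean zero. Writing it as
  \<open>c ^ (- m)\<close> times its image under \<open>V ^^ m\<close>, the estimate for its real
  and imaginary parts bounds its norm by a constant times \<open>\<kappa> ^ m\<close> with
  \<open>\<kappa> < 1\<close>.\<close>

theorem Lp_decay_rate_optimal:
  assumes p: "1 < p" and rate: "ereal \<omega> < log_rate T (subunit_radius T G)"
  shows "\<not> Lp_decay_estimate G \<mu> p \<omega> M"
proof
  assume est: "Lp_decay_estimate G \<mu> p \<omega> M"
  define r where "r = subunit_radius T G"
  have "r \<noteq> 0" using rate by (auto simp: log_rate_def r_def)
  then have r: "r > 0" using subunit_radius_nonneg by (simp add: r_def)
  have "\<omega> * T < ln r" using rate \<open>r \<noteq> 0\<close> T_pos by (simp add: log_rate_def r_def pos_less_divide_eq)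
  then have "exp (\<omega> * T) < r" using r by (metis exp_less_mono exp_ln)
  then obtain x where "x \<in> {cmod c | c s. c \<in> op_spectrum (G (s + T) s) \<and> cmod c < 1}" "exp (\<omega> * T) < x"
    unfolding r_def spectral_set(3) using less_cSup_iff[OF _ spectral_set(1)] spectral_set(2) by blast
  then obtain c s where c: "c \<in> op_spectrum (G (s + T) s)" "cmod c < 1" "exp (\<omega> * T) < cmod c" by auto
  then have c0: "c \<noteq> 0" "c \<noteq> 1" using exp_gt_zero[of "\<omega> * T"] by auto
  have sT: "s < s + T" "s \<le> s + T" using T_pos by auto
  obtain f where f: "f \<noteq> 0" "complexified (G (s + T) s) f = complex_scale c f"
    using op_spectrum_eigenvector[OF bounded_linear_G[OF sT(2)] compact[OF sT(1)] c(1) c0(1)] by blast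
  obtain u v where uv: "f = (u, v)" by (cases f)
  note m0 = eigenvector_mean_zero[OF f(2)[unfolded uv] c0(2)]
  let ?n = "\<lambda>\<phi>. Lp_norm p (\<mu> s) (apply_bcontfun \<phi>)"
  let ?V = "G (s + T) s"
  define \<kappa> where "\<kappa> = exp (\<omega> * T) / cmod c"
  have \<kappa>: "0 \<le> \<kappa>" "\<kappa> < 1" using c c0 by (auto simp: \<kappa>_def)
  have dec: "?n ((?V ^^ m) \<phi>) \<le> M * exp (\<omega> * T) ^ m * ?n \<phi>" if m: "m > 0" and \<phi>: "mean s \<phi> = 0" for m \<phi>
  proof -
    define t where "t = s + of_nat m * T"
    have st: "s < t" using m T_pos by (simp add: t_def)
    let ?E = "Lp_extension p (\<mu> s) (\<mu> t) (G t s) (apply_bcontfun \<phi>)"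
    have E: "?E \<in> Lp_space p (\<mu> t)"
      by (rule Lp_extension_G(1)[OF p less_imp_le[OF st] bcontfun_in_Lp[OF p]])
    \<comment> \<open>The assumed estimate concerns the extension; comparing it with
      \<open>\<phi>\<close> itself shows that it lies at L^p distance 0 from
      \<open>G t s \<phi>\<close>.\<close>
    have "Lp_norm p (\<mu> t) (\<lambda>x. apply_bcontfun (G t s \<phi>) x - ?E x) \<le> ?n 0"
      using Lp_extension_G_contraction[OF p less_imp_le[OF st] bcontfun_in_Lp[OF p], of \<phi> \<phi>] by simp
    also have "?n 0 = 0" using p by (simp add: Lp_norm_def)
    finally have "Lp_norm p (\<mu> t) (apply_bcontfun (G t s \<phi>)) \<le> Lp_norm p (\<mu> t) ?E"
      using Lp_norm_le_add_diff[OF p bcontfun_in_Lp[OF p] E, of "G t s \<phi>"] by simp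
    also have "\<dots> \<le> M * exp (\<omega> * (t - s)) * ?n \<phi>"
      using est[unfolded Lp_decay_estimate_def, rule_format, OF st bcontfun_in_Lp[OF p, of \<phi>]] \<phi>
      by (simp add: mean_def)
    also have "\<omega> * (t - s) = of_nat m * (\<omega> * T)" by (simp add: t_def)
    finally show ?thesis
      unfolding exp_of_nat_mult by (simp add: t_def \<mu>_periodic_nat G_power)
  qed
  have key: "?n u + ?n v \<le> 2 * (M * (?n u + ?n v)) * \<kappa> ^ m" if m: "m > 0" for m
  proof -
    define a where "a = (1 / c) ^ m"
    have ca: "cmod a = 1 / cmod c ^ m" by (simp add: a_def norm_power norm_divide power_divide)
    have "complex_scale a ((complexified ?V ^^ m) f) = f"
      unfolding complexified_funpow_eigenvector[OF linear_G[OF sT(2)] f(2)]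
      using c0 by (simp add: complex_scale_scale a_def power_mult_distrib[symmetric])
    then have eqs: "u = Re a *\<^sub>R (?V ^^ m) u + (- Im a) *\<^sub>R (?V ^^ m) v" "v = Re a *\<^sub>R (?V ^^ m) v + Im a *\<^sub>R (?V ^^ m) u"
      by (auto simp: uv complexified_funpow complex_scale_def)
    have bound: "?n (x *\<^sub>R (?V ^^ m) g + y *\<^sub>R (?V ^^ m) h) \<le> cmod a * (M * exp (\<omega> * T) ^ m * (?n u + ?n v))"
      if xy: "\<bar>x\<bar> \<le> cmod a" "\<bar>y\<bar> \<le> cmod a" and gh: "(g, h) = (u, v) \<or> (g, h) = (v, u)" for x y g h
    proof -
      have "?n (x *\<^sub>R (?V ^^ m) g + y *\<^sub>R (?V ^^ m) h) \<le> \<bar>x\<bar> * ?n ((?V ^^ m) g) + \<bar>y\<bar> * ?n ((?V ^^ m) h)"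
        using Lp_norm_bcontfun_add[OF p] unfolding Lp_norm_bcontfun_scaleR[OF p, symmetric] by blast
      also have "\<dots> \<le> cmod a * (M * exp (\<omega> * T) ^ m * ?n g) + cmod a * (M * exp (\<omega> * T) ^ m * ?n h)"
        using xy gh m0 by (intro add_mono mult_mono dec m) auto
      finally show ?thesis using gh by (auto simp: algebra_simps)
    qed
    have "?n u \<le> cmod a * (M * exp (\<omega> * T) ^ m * (?n u + ?n v))"
      using bound[of "Re a" "- Im a" u v] abs_Re_le_cmod[of a] abs_Im_le_cmod[of a] unfolding eqs(1)[symmetric] by simp
    moreover have "?n v \<le> cmod a * (M * exp (\<omega> * T) ^ m * (?n u + ?n v))"
      using bound[of "Re a" "Im a" v u] abs_Re_le_cmod[of a] abs_Im_le_cmod[of a] unfolding eqs(2)[symmetric] by simp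
    ultimately have "?n u + ?n v \<le> 2 * (cmod a * (M * exp (\<omega> * T) ^ m * (?n u + ?n v)))" by linarith
    also have "\<dots> = 2 * (M * (?n u + ?n v)) * (cmod a * exp (\<omega> * T) ^ m)" by (simp only: ac_simps)
    also have "cmod a * exp (\<omega> * T) ^ m = \<kappa> ^ m" by (simp add: ca \<kappa>_def power_divide)
    finally show ?thesis .
  qed
  \<comment> \<open>The exponent is \<open>Suc m\<close> because the estimate is available for
    \<open>t > s\<close> only, that is for at least one period.\<close>
  have "(\<lambda>m. 2 * (M * (?n u + ?n v)) * \<kappa> ^ Suc m) \<longlonglongrightarrow> 2 * (M * (?n u + ?n v)) * 0"
    using \<kappa> by (intro tendsto_intros LIMSEQ_Suc LIMSEQ_power_zero) auto
  then have "?n u + ?n v \<le> 2 * (M * (?n u + ?n v)) * 0"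
    by (rule LIMSEQ_le_const) (use key in blast)
  then have "?n u = 0" "?n v = 0" using Lp_norm_nonneg[of p "\<mu> s"] by (auto simp: add_nonneg_eq_0_iff order_antisym_conv)
  then show False using Lp_norm_bcontfun_eq_0[OF p] f(1) uv by (auto simp: zero_prod_def)
qed

end

theorem proposition4p4:
  fixes T :: real
    and Q :: "real \<Rightarrow> real^'n::finite \<Rightarrow> real^'n^'n"
    and b :: "real \<Rightarrow> real^'n \<Rightarrow> real^'n"
    and G :: "real \<Rightarrow> real \<Rightarrow> ((real^'n) \<Rightarrow>\<^sub>C real) \<Rightarrow> ((real^'n) \<Rightarrow>\<^sub>C real)"
    and \<mu> :: "real \<Rightarrow> (real^'n) measure"
    and r :: real and \<omega>\<^sub>0 :: ereal
  assumes "T > 0"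
    and "time_periodic T Q" and "time_periodic T b"
    and "hyp_H1 Q b" and "hyp_H2 Q" and "hyp_H3 Q b"
    and "evolution_operator Q b G"
    and "\<And>s t. s < t \<Longrightarrow> compact_operator (G t s)"
    and "evolution_system_of_measures G \<mu>" and "time_periodic T \<mu>"
    and r_def: "r = subunit_radius T G"
    and \<omega>\<^sub>0_def: "\<omega>\<^sub>0 = log_rate T r"
  shows "(\<forall>p>1. \<forall>s t. s < t \<longrightarrow>
            Lp_compact_operator p (\<mu> s) (\<mu> t) (Lp_extension p (\<mu> s) (\<mu> t) (G t s))) \<and>
         r < 1 \<and>
         (\<forall>\<omega> p. \<omega>\<^sub>0 < ereal \<omega> \<longrightarrow> \<omega> < 0 \<longrightarrow> 1 < p \<longrightarrow>
            (\<exists>M>0. Lp_decay_estimate G \<mu> p \<omega> M)) \<and>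
         (\<forall>\<omega> p. ereal \<omega> < \<omega>\<^sub>0 \<longrightarrow> 1 < p \<longrightarrow>
            \<not> (\<exists>M. Lp_decay_estimate G \<mu> p \<omega> M))"
proof -
  interpret periodic_evolution T Q b G \<mu>
    by unfold_locales (fact assms)+
  show ?thesis
    unfolding \<omega>\<^sub>0_def r_def
    using G_Lp_compact subunit_radius_less_1 Lp_decay Lp_decay_rate_optimal by blast
qed

end
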